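(* Let $n,N$ be positive integers, $\lambda\in\mathcal{O}(n,N)$, $\Lambda\in\mathcal{L}(\lambda,n)$ and $k\in\{1,\dots,n-1\}$. Suppose that $\Lambda(k-1)\neq\Lambda(k+1)$. Then $x_k(\Lambda)\neq x_{k+1}(\Lambda)$ and $$s_k(\Lambda,\Lambda)=\bigl(x_{k+1}(\Lambda)-x_k(\Lambda)\bigr)^{-1}.$$
   Context: Brauer algebra. For $n\ge1$ let $\mathcal{G}(n)$ be the set of partitions of $\{1,\dots,n,\bar1,\dots,\bar n\}$ into pairs (graphs with $n$ edges). $B(n,N)$ is the complex associative algebra with basis $b(\gamma)$, $\gamma\in\mathcal{G}(n)$, and product $b(\gamma)b(\gamma')=N^{q}b(\gamma\circ\gamma')$: identify the vertices $\bar1,\dots,\bar n$ of $\gamma$ with $1,\dots,n$ of $\gamma'$, let $q$ be the number of loops, remove the loops and replace the other components by single edges joining their terminal vertices to get $\gamma\circ\gamma'$. A permutation $s\in S(n)$ is identified with $b(\gamma)$, $\gamma$ having edges $\{s(m),\bar m\}$. For $k\neq l$, $(k,l)$ is the transposition and $\overline{(k,l)}=b(\gamma)$ with $\gamma$ having edges $\{k,l\},\{\bar k,\bar l\}$ and $\{m,\bar m\}$, $m\ne k,l$. Put $s_k=(k,k+1)$. $B(n-1,N)\subset B(n,N)$ is spanned by the $b(\gamma)$ with $\{n,\bar n\}\in\gamma$. For $k=1,\dots,n$, $x_k=\frac{N-1}{2}+\sum_{l=1}^{k-1}\bigl((k,l)-\overline{(k,l)}\bigr)$. Representations. $N$ is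 a positive integer, $U=\mathbb{C}^N$ with standard orthonormal basis $u(1),\dots,u(N)$, $G=O(N,\mathbb{C})$, $C(n,N)=\operatorname{End}_G(U^{\otimes n})$. $B(n,N)$ maps onto $C(n,N)$: $(k,l)$ permutes the $k$-th and $l$-th tensor factors, and $\overline{(k,l)}$ sends $u(i_1)\otimes\cdots\otimes u(i_n)$ to $\delta_{i_k i_l}\sum_{i=1}^N$ of the same tensor with both the $k$-th and $l$-th factors replaced by $u(i)$. $\mathcal{O}(n,N)$ is the set of Young diagrams with at most $N$ boxes in the first two columns together and with $n-2r$ boxes in total, $r=0,1,\dots,[n/2]$. For such a diagram $\lambda$ with $m$ boxes, $U(\lambda,N)$ is Weyl's irreducible representation of $G$: the space of traceless tensors in $U^{\otimes m}$ (those killed by all $\overline{(k,l)}$) decomposes under $G\times S(m)$ as $\bigoplus_\lambda U(\lambda,N)\otimes S^\lambda$, over diagrams $\lambda$ with $m$ boxes and at most $N$ boxes in the first two columns, $S^\lambda$ being the irreducible $S(m)$-module of $\lambda$ (trivial for a one-row diagram). One has $U^{\otimes n}=\bigoplus_{\lambda\in\mathcal{O}(n,N)}U(\lambda,N)\otimes V(\lambda,n)$ with $V(\lambda,n)$ the irreducible $C(n,N)$-modules, also regarded as $B(n,N)$-modules. The restriction of $V(\lambda,n)$ to $C(n-1,N)$ is the multiplicity-free direct sum of $V(\mu,n-1)$ over $\mu\in\mathcal{O}(n-1,N)$ obtained from $\lambda$ by removing or adding one box. Canonical basis. $\mathcal{L}(\lambda,n)$ is the set of sequences $\Lambda=(\Lambda(1),\dots,\Lambda(n))\in\mathcal{O}(1,N)\times\cdots\times\mathcal{O}(n,N)$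 with $\Lambda(n)=\lambda$ and neighbouring terms differing by exactly one box; $\Lambda(0)$ is the empty diagram. The canonical basis of $V(\lambda,n)$ consists of vectors $v(\Lambda)$, $\Lambda\in\mathcal{L}(\lambda,n)$, determined up to nonzero scalars by: $v(\Lambda)$ lies in the component $V(\Lambda(k),k)$ of the restriction of $V(\lambda,n)$ to $C(k,N)$ for every $k=1,\dots,n-1$. Each $v(\Lambda)$ is an eigenvector of $x_1,\dots,x_n$; $x_k(\Lambda)$ denotes the eigenvalue of $x_k$ on $v(\Lambda)$. Matrix elements are defined by $s_k\cdot v(\Lambda)=\sum_{\Lambda'\in\mathcal{L}(\lambda,n)}s_k(\Lambda,\Lambda')\,v(\Lambda')$. *)

theory Defs
  imports
    "HOL-Library.Function_Algebras"
    "HOL-Library.FuncSet"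
    "HOL-Library.Disjoint_Sets"
    "HOL-Combinatorics.Permutations"
    "Jordan_Normal_Form.Matrix"
begin

section \<open>Complex vector spaces of functions\<close>

definition scale_fun :: "complex \<Rightarrow> ('a \<Rightarrow> complex) \<Rightarrow> 'a \<Rightarrow> complex" where
  "scale_fun c f = (\<lambda>x. c * f x)"

definition scale_map :: "complex \<Rightarrow> ('d \<Rightarrow> 'a \<Rightarrow> complex) \<Rightarrow> 'd \<Rightarrow> 'a \<Rightarrow> complex" where
  "scale_map c f = (\<lambda>x. scale_fun c (f x))"

interpretation funs: vector_space "scale_fun :: complex \<Rightarrow> ('a \<Rightarrow> complex) \<Rightarrow> _"
  by unfold_locales (auto simp: scale_fun_def fun_eq_iff algebra_simps)

interpretation maps: vector_space "scale_map :: complex \<Rightarrow> ('d \<Rightarrow> 'a \<Rightarrow> complex) \<Rightarrow> _"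
  by unfold_locales (auto simp: scale_map_def scale_fun_def fun_eq_iff algebra_simps)


section \<open>Tensors\<close>

text \<open>
  The basis vectors of \<open>U = \<complex>\<^sup>N\<close> are indexed by \<open>{..<N}\<close>, the tensor factors of
  \<open>U\<^sup>\<otimes>\<^sup>n\<close> by \<open>{1..n}\<close>. A tensor is the family of its coordinates with respect to the
  basis \<open>u(i 1) \<otimes> \<dots> \<otimes> u(i n)\<close>, extended by zero to all functions \<open>i\<close>.
\<close>

type_synonym tensor = "(nat \<Rightarrow> nat) \<Rightarrow> complex"

definition indices :: "nat \<Rightarrow> nat \<Rightarrow> (nat \<Rightarrow> nat) set" where
  "indices N n = {1..n} \<rightarrow>\<^sub>E {..<N}"

definition tensors :: "nat \<Rightarrow> nat \<Rightarrow> tensor set" where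
  "tensors N n = {T. \<forall>i. i \<notin> indices N n \<longrightarrow> T i = 0}"

definition unit_tensor :: "(nat \<Rightarrow> nat) \<Rightarrow> tensor" where
  "unit_tensor i = (\<lambda>j. if j = i then 1 else 0)"


section \<open>The Brauer algebra and its action on tensors\<close>

text \<open>\<open>Inl m\<close> stands for the vertex \<open>m\<close> and \<open>Inr m\<close> for the vertex \<open>m\<close> with a bar.\<close>

type_synonym diagram = "(nat + nat) set set"

definition diagrams :: "nat \<Rightarrow> diagram set" where
  "diagrams n = {\<gamma>. partition_on (Inl ` {1..n} \<union> Inr ` {1..n}) \<gamma> \<and> (\<forall>e\<in>\<gamma>. card e = 2)}"

text \<open>
  An element of \<open>B(n,N)\<close> is the family of its coefficients with respect to the basis
  \<open>b(\<gamma>)\<close>, \<open>\<gamma> \<in> diagrams n\<close>. The multiplication of \<open>B(n,N)\<close> enters below only through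
  the representation \<open>act\<close> on tensors.
\<close>

type_synonym brauer = "diagram \<Rightarrow> complex"

definition brauer_basis :: "diagram \<Rightarrow> brauer" where
  "brauer_basis \<gamma> = (\<lambda>\<gamma>'. if \<gamma>' = \<gamma> then 1 else 0)"

definition vertex_label :: "(nat \<Rightarrow> nat) \<Rightarrow> (nat \<Rightarrow> nat) \<Rightarrow> nat + nat \<Rightarrow> nat" where
  "vertex_label i j = case_sum i j"

text \<open>
  The coefficient of \<open>u(i)\<close> in \<open>b(\<gamma>) u(j)\<close> is \<open>1\<close> or \<open>0\<close>, according to whether the two
  ends of every edge carry the same label when \<open>m\<close> is labelled \<open>i m\<close> and \<open>m\<close> with a bar
  is labelled \<open>j m\<close>. Gluing the barred vertices of one diagram to the unbarred vertices of
  the next one corresponds to matrix multiplication, every loop giving a factor \<open>N\<close>.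
\<close>

definition diagram_coeff :: "diagram \<Rightarrow> (nat \<Rightarrow> nat) \<Rightarrow> (nat \<Rightarrow> nat) \<Rightarrow> complex" where
  "diagram_coeff \<gamma> i j =
     (if \<forall>e\<in>\<gamma>. \<forall>p\<in>e. \<forall>q\<in>e. vertex_label i j p = vertex_label i j q then 1 else 0)"

definition act :: "nat \<Rightarrow> nat \<Rightarrow> brauer \<Rightarrow> tensor \<Rightarrow> tensor" where
  "act N n a T = (\<lambda>i. if i \<in> indices N n
     then \<Sum>\<gamma>\<in>diagrams n. a \<gamma> * (\<Sum>j\<in>indices N n. diagram_coeff \<gamma> i j * T j) else 0)"

definition perm_diagram :: "nat \<Rightarrow> (nat \<Rightarrow> nat) \<Rightarrow> diagram" where
  "perm_diagram n s = {{Inl (s m), Inr m} | m. m \<in> {1..n}}"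

definition bar_diagram :: "nat \<Rightarrow> nat \<Rightarrow> nat \<Rightarrow> diagram" where
  "bar_diagram n k l =
     {{Inl k, Inl l}, {Inr k, Inr l}} \<union> {{Inl m, Inr m} | m. m \<in> {1..n} - {k, l}}"

definition simple_transposition :: "nat \<Rightarrow> nat \<Rightarrow> brauer" where
  "simple_transposition n k = brauer_basis (perm_diagram n (transpose k (k + 1)))"

definition jucys_murphy :: "nat \<Rightarrow> nat \<Rightarrow> nat \<Rightarrow> brauer" where
  "jucys_murphy N n k =
     scale_fun ((of_nat N - 1) / 2) (brauer_basis (perm_diagram n id))
     + (\<Sum>l\<in>{1..<k}. brauer_basis (perm_diagram n (transpose k l)) - brauer_basis (bar_diagram n k l))"


section \<open>The orthogonal group and its centralizer algebras\<close>

definition orth_group :: "nat \<Rightarrow> complex mat set" where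
  "orth_group N = {g \<in> carrier_mat N N. g * g\<^sup>T = 1\<^sub>m N}"

definition group_act :: "nat \<Rightarrow> nat \<Rightarrow> complex mat \<Rightarrow> tensor \<Rightarrow> tensor" where
  "group_act N n g T = (\<lambda>i. if i \<in> indices N n
     then \<Sum>j\<in>indices N n. (\<Prod>m\<in>{1..n}. g $$ (i m, j m)) * T j else 0)"

text \<open>
  \<open>Hom\<^sub>G(W, X)\<close> for \<open>G\<close>-submodules \<open>W\<close> of \<open>U\<^sup>\<otimes>\<^sup>m\<close> and \<open>X\<close> of \<open>U\<^sup>\<otimes>\<^sup>n\<close>. Extending the maps
  by zero outside \<open>W\<close> makes equality of maps equality on \<open>W\<close>.
\<close>

definition hom_G :: "nat \<Rightarrow> nat \<Rightarrow> tensor set \<Rightarrow> nat \<Rightarrow> tensor set \<Rightarrow> (tensor \<Rightarrow> tensor) set" where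
  "hom_G N m W n X = {f.
     (\<forall>T\<in>W. f T \<in> X) \<and>
     (\<forall>S\<in>W. \<forall>T\<in>W. f (S + T) = f S + f T) \<and>
     (\<forall>c. \<forall>T\<in>W. f (scale_fun c T) = scale_fun c (f T)) \<and>
     (\<forall>g\<in>orth_group N. \<forall>T\<in>W. f (group_act N m g T) = group_act N n g (f T)) \<and>
     (\<forall>T. T \<notin> W \<longrightarrow> f T = 0)}"

definition centralizer :: "nat \<Rightarrow> nat \<Rightarrow> (tensor \<Rightarrow> tensor) set" where
  "centralizer n N = hom_G N n (tensors N n) n (tensors N n)"

text \<open>
  The inclusion \<open>A \<mapsto> A \<otimes> 1\<close> of \<open>C(k,N)\<close> into \<open>C(n,N)\<close>, \<open>k \<le> n\<close>: \<open>A\<close> is applied to the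
  first \<open>k\<close> tensor factors, for each choice of the remaining \<open>n - k\<close> indices.
\<close>

definition glue :: "nat \<Rightarrow> (nat \<Rightarrow> nat) \<Rightarrow> (nat \<Rightarrow> nat) \<Rightarrow> nat \<Rightarrow> nat" where
  "glue k j i = (\<lambda>m. if m \<le> k then j m else i m)"

definition embed :: "nat \<Rightarrow> nat \<Rightarrow> nat \<Rightarrow> (tensor \<Rightarrow> tensor) \<Rightarrow> tensor \<Rightarrow> tensor" where
  "embed N k n A T = (\<lambda>i. if i \<in> indices N n
     then A (\<lambda>j. if j \<in> indices N k then T (glue k j i) else 0) (restrict i {1..k}) else 0)"


section \<open>Young diagrams\<close>

text \<open>A Young diagram is the set of its boxes \<open>(row, column)\<close>, both counted from \<open>1\<close>.\<close>

type_synonym young = "(nat \<times> nat) set"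

definition young_diagram :: "young \<Rightarrow> bool" where
  "young_diagram \<mu> \<longleftrightarrow> finite \<mu> \<and> \<mu> \<subseteq> {1..} \<times> {1..} \<and> (\<forall>(i, j)\<in>\<mu>. {1..i} \<times> {1..j} \<subseteq> \<mu>)"

definition \<O> :: "nat \<Rightarrow> nat \<Rightarrow> young set" where
  "\<O> n N = {\<mu>. young_diagram \<mu> \<and> card {x \<in> \<mu>. snd x \<le> 2} \<le> N \<and>
                (\<exists>r \<in> {0..n div 2}. card \<mu> = n - 2 * r)}"

definition one_box_apart :: "young \<Rightarrow> young \<Rightarrow> bool" where
  "one_box_apart \<mu> \<nu> \<longleftrightarrow> (\<exists>x. x \<notin> \<mu> \<and> \<nu> = insert x \<mu>) \<or> (\<exists>x. x \<notin> \<nu> \<and> \<mu> = insert x \<nu>)"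

text \<open>
  The sequences carry the additional term \<open>\<Lambda> 0\<close>; it is the empty diagram, the only
  element of \<open>\<O> 0 N\<close>.
\<close>

definition \<L> :: "nat \<Rightarrow> young \<Rightarrow> nat \<Rightarrow> (nat \<Rightarrow> young) set" where
  "\<L> N \<mu> n = {\<Lambda> \<in> Pi\<^sub>E {0..n} (\<lambda>k. \<O> k N).
     \<Lambda> n = \<mu> \<and> (\<forall>k<n. one_box_apart (\<Lambda> k) (\<Lambda> (k + 1)))}"


section \<open>Weyl's representations of the orthogonal group\<close>

text \<open>The boxes of \<open>\<mu>\<close> are filled with \<open>1, \<dots>, card \<mu>\<close> row by row.\<close>

definition tableau :: "young \<Rightarrow> nat \<times> nat \<Rightarrow> nat" where
  "tableau \<mu> x = card {y \<in> \<mu>. fst y < fst x \<or> fst y = fst x \<and> snd y \<le> snd x}"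

definition row_group :: "young \<Rightarrow> (nat \<Rightarrow> nat) set" where
  "row_group \<mu> = {p. p permutes {1..card \<mu>} \<and>
     (\<forall>x\<in>\<mu>. \<forall>y\<in>\<mu>. p (tableau \<mu> x) = tableau \<mu> y \<longrightarrow> fst x = fst y)}"

definition column_group :: "young \<Rightarrow> (nat \<Rightarrow> nat) set" where
  "column_group \<mu> = {q. q permutes {1..card \<mu>} \<and>
     (\<forall>x\<in>\<mu>. \<forall>y\<in>\<mu>. q (tableau \<mu> x) = tableau \<mu> y \<longrightarrow> snd x = snd y)}"

definition young_symmetrizer :: "young \<Rightarrow> brauer" where
  "young_symmetrizer \<mu> = (\<Sum>p\<in>row_group \<mu>. \<Sum>q\<in>column_group \<mu>.
     scale_fun (of_int (sign q)) (brauer_basis (perm_diagram (card \<mu>) (p \<circ> q))))"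

definition traceless :: "nat \<Rightarrow> nat \<Rightarrow> tensor set" where
  "traceless N m = {T \<in> tensors N m.
     \<forall>k\<in>{1..m}. \<forall>l\<in>{1..m}. k \<noteq> l \<longrightarrow> act N m (brauer_basis (bar_diagram m k l)) T = 0}"

text \<open>
  Let \<open>c\<close> be the Young symmetrizer of \<open>\<mu>\<close> and \<open>m\<close> the number of boxes. The left ideal
  \<open>\<complex>[S(m)] c\<close> is the irreducible module \<open>S\<^sup>\<mu>\<close>, and \<open>c\<close> maps \<open>S\<^sup>\<mu>\<close> onto a line and annihilates
  \<open>S\<^sup>\<nu>\<close> for \<open>\<nu> \<noteq> \<mu>\<close>. Hence the image of \<open>c\<close> on the traceless tensors
  \<open>\<Oplus>\<^sub>\<nu> U(\<nu>,N) \<otimes> S\<^sup>\<nu>\<close> is a copy of \<open>U(\<mu>,N)\<close>; this is Weyl's construction.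
\<close>

definition weyl_module :: "young \<Rightarrow> nat \<Rightarrow> tensor set" where
  "weyl_module \<mu> N = act N (card \<mu>) (young_symmetrizer \<mu>) ` traceless N (card \<mu>)"


section \<open>The modules of the centralizer algebra and the canonical basis\<close>

text \<open>
  \<open>V(\<mu>,n)\<close>, realised as the multiplicity space of \<open>U(\<mu>,N)\<close> in \<open>U\<^sup>\<otimes>\<^sup>n\<close>. Elements of \<open>C(n,N)\<close> and \<open>B(n,N)\<close> act on it
  by composition on the left: \<open>A \<in> C(k,N)\<close> as \<open>f \<mapsto> embed N k n A \<circ> f\<close> and
  \<open>a \<in> B(n,N)\<close> as \<open>f \<mapsto> act N n a \<circ> f\<close>.
\<close>

definition mult_module :: "nat \<Rightarrow> young \<Rightarrow> nat \<Rightarrow> (tensor \<Rightarrow> tensor) set" where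
  "mult_module N \<mu> n = hom_G N (card \<mu>) (weyl_module \<mu> N) n (tensors N n)"

definition is_copy :: "nat \<Rightarrow> young \<Rightarrow> nat \<Rightarrow> young \<Rightarrow> nat \<Rightarrow> (tensor \<Rightarrow> tensor) set \<Rightarrow> bool" where
  "is_copy N \<mu> k \<nu> n W \<longleftrightarrow>
     maps.subspace W \<and> W \<subseteq> mult_module N \<nu> n \<and>
     (\<forall>A\<in>centralizer k N. \<forall>f\<in>W. embed N k n A \<circ> f \<in> W) \<and>
     (\<exists>\<phi>. bij_betw \<phi> (mult_module N \<mu> k) W \<and>
        (\<forall>f\<in>mult_module N \<mu> k. \<forall>g\<in>mult_module N \<mu> k. \<phi> (f + g) = \<phi> f + \<phi> g) \<and>
        (\<forall>c. \<forall>f\<in>mult_module N \<mu> k. \<phi> (scale_map c f) = scale_map c (\<phi> f)) \<and>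
        (\<forall>A\<in>centralizer k N. \<forall>f\<in>mult_module N \<mu> k. \<phi> (A \<circ> f) = embed N k n A \<circ> \<phi> f))"

text \<open>
  The \<open>V(\<mu>,k)\<close>-isotypic component of the restriction of \<open>V(\<nu>,n)\<close> to \<open>C(k,N)\<close>: the sum of
  all submodules isomorphic to \<open>V(\<mu>,k)\<close>.
\<close>

definition component :: "nat \<Rightarrow> young \<Rightarrow> nat \<Rightarrow> young \<Rightarrow> nat \<Rightarrow> (tensor \<Rightarrow> tensor) set" where
  "component N \<mu> k \<nu> n = maps.span (\<Union>{W. is_copy N \<mu> k \<nu> n W})"

definition canonical_basis ::
    "nat \<Rightarrow> young \<Rightarrow> nat \<Rightarrow> ((nat \<Rightarrow> young) \<Rightarrow> tensor \<Rightarrow> tensor) \<Rightarrow> bool" where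
  "canonical_basis N \<mu> n v \<longleftrightarrow>
     inj_on v (\<L> N \<mu> n) \<and>
     maps.independent (v ` \<L> N \<mu> n) \<and>
     maps.span (v ` \<L> N \<mu> n) = mult_module N \<mu> n \<and>
     (\<forall>\<Lambda>\<in>\<L> N \<mu> n. \<forall>k\<in>{1..n - 1}. v \<Lambda> \<in> component N (\<Lambda> k) k \<mu> n)"

definition x_eigenvalue ::
    "nat \<Rightarrow> nat \<Rightarrow> ((nat \<Rightarrow> young) \<Rightarrow> tensor \<Rightarrow> tensor) \<Rightarrow> nat \<Rightarrow> (nat \<Rightarrow> young) \<Rightarrow> complex" where
  "x_eigenvalue N n v k \<Lambda> = (THE c. act N n (jucys_murphy N n k) \<circ> v \<Lambda> = scale_map c (v \<Lambda>))"

definition s_matrix_element ::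
    "nat \<Rightarrow> young \<Rightarrow> nat \<Rightarrow> ((nat \<Rightarrow> young) \<Rightarrow> tensor \<Rightarrow> tensor) \<Rightarrow>
     nat \<Rightarrow> (nat \<Rightarrow> young) \<Rightarrow> (nat \<Rightarrow> young) \<Rightarrow> complex" where
  "s_matrix_element N \<mu> n v k \<Lambda> \<Lambda>' =
     maps.representation (v ` \<L> N \<mu> n) (act N n (simple_transposition n k) \<circ> v \<Lambda>) (v \<Lambda>')"


section \<open>The action of the generators on basis tensors\<close>

lemma ball_collect: "(\<forall>e\<in>{f m | m. P m}. Q e) \<longleftrightarrow> (\<forall>m. P m \<longrightarrow> Q (f m))"
  by blast

lemma edge_labels:
  "(\<forall>p\<in>{Inl x, Inr y}. \<forall>q\<in>{Inl x, Inr y}. vertex_label i j p = vertex_label i j q) \<longleftrightarrow> i x = j y"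
  by (auto simp: vertex_label_def)

lemma finite_indices: "finite (indices N n)"
  unfolding indices_def by (intro finite_PiE) auto

lemma finite_diagrams: "finite (diagrams n)"
proof (rule finite_subset)
  show "diagrams n \<subseteq> Pow (Pow (Inl ` {1..n} \<union> Inr ` {1..n}))"
    by (auto simp: diagrams_def partition_on_def)
qed simp

lemma act_brauer_basis:
  assumes "\<gamma> \<in> diagrams n" and "j \<in> indices N n"
  shows "act N n (brauer_basis \<gamma>) (unit_tensor j) = (\<lambda>i. if i \<in> indices N n then diagram_coeff \<gamma> i j else 0)"
proof
  fix i
  have "(\<Sum>\<gamma>'\<in>diagrams n. brauer_basis \<gamma> \<gamma>' * f \<gamma>') = (\<Sum>\<gamma>'\<in>diagrams n. if \<gamma>' = \<gamma> then f \<gamma>' else 0)" for f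
    by (rule sum.cong) (auto simp: brauer_basis_def)
  then have "(\<Sum>\<gamma>'\<in>diagrams n. brauer_basis \<gamma> \<gamma>' * f \<gamma>') = f \<gamma>" for f
    using assms(1) finite_diagrams[of n] by simp
  moreover have "(\<Sum>j'\<in>indices N n. diagram_coeff \<gamma> i j' * unit_tensor j j') = diagram_coeff \<gamma> i j"
    using assms(2) finite_indices[of N n] by (simp add: unit_tensor_def if_distrib cong: if_cong)
  ultimately show "act N n (brauer_basis \<gamma>) (unit_tensor j) i
      = (if i \<in> indices N n then diagram_coeff \<gamma> i j else 0)"
    by (simp add: act_def)
qed

lemma perm_diagram_in_diagrams:
  assumes "s permutes {1..n}"
  shows "perm_diagram n s \<in> diagrams n"
proof -
  have img: "s ` {1..n} = {1..n}" and inj: "inj s"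
    using assms by (auto simp: permutes_image permutes_inj)
  have "partition_on (Inl ` {1..n} \<union> Inr ` {1..n}) (perm_diagram n s)"
  proof (rule partition_onI)
    have "\<Union>(perm_diagram n s) = Inl ` s ` {1..n} \<union> Inr ` {1..n}"
      unfolding perm_diagram_def Setcompr_eq_image by auto
    then show "\<Union>(perm_diagram n s) = Inl ` {1..n} \<union> Inr ` {1..n}"
      unfolding img .
    show "disjnt p q" if "p \<in> perm_diagram n s" "q \<in> perm_diagram n s" "p \<noteq> q" for p q
      using that by (auto simp: perm_diagram_def disjnt_def inj_eq[OF inj])
  qed (auto simp: perm_diagram_def)
  then show ?thesis
    by (auto simp: diagrams_def perm_diagram_def)
qed

lemma bar_diagram_in_diagrams:
  assumes "k \<in> {1..n}" "l \<in> {1..n}" "k \<noteq> l"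
  shows "bar_diagram n k l \<in> diagrams n"
proof -
  have "partition_on (Inl ` {1..n} \<union> Inr ` {1..n}) (bar_diagram n k l)"
  proof (rule partition_onI)
    show "\<Union>(bar_diagram n k l) = Inl ` {1..n} \<union> Inr ` {1..n}"
    proof (intro equalityI subsetI)
      fix p assume "p \<in> Inl ` {1..n} \<union> Inr ` {1..n}"
      then obtain m where m: "m \<in> {1..n}" "p = Inl m \<or> p = Inr m" by auto
      show "p \<in> \<Union>(bar_diagram n k l)"
      proof (cases "m \<in> {k, l}")
        case True
        then show ?thesis using m by (auto simp: bar_diagram_def)
      next
        case False
        then have "{Inl m, Inr m} \<in> bar_diagram n k l" using m by (auto simp: bar_diagram_def)
        then show ?thesis using m by blast
      qed
    qed (use assms in \<open>auto simp: bar_diagram_def\<close>)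
    show "disjnt p q" if "p \<in> bar_diagram n k l" "q \<in> bar_diagram n k l" "p \<noteq> q" for p q
      using that by (auto simp: bar_diagram_def disjnt_def)
  qed (auto simp: bar_diagram_def)
  then show ?thesis
    using assms by (auto simp: diagrams_def bar_diagram_def)
qed

lemma act_transposition:
  assumes "k \<in> {1..n}" "l \<in> {1..n}" "j \<in> indices N n"
  shows "act N n (brauer_basis (perm_diagram n (transpose k l))) (unit_tensor j)
    = unit_tensor (j \<circ> transpose k l)"
proof -
  let ?t = "transpose k l"
  have t: "?t permutes {1..n}" using assms by (simp add: permutes_swap_id)
  have mem: "j \<circ> ?t \<in> indices N n"
    using assms permutes_in_image[OF t] permutes_not_in[OF t]
    by (auto simp: indices_def PiE_iff extensional_def)
  have "diagram_coeff (perm_diagram n ?t) i j = unit_tensor (j \<circ> ?t) i" if i: "i \<in> indices N n" for i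
  proof -
    have "(\<forall>m\<in>{1..n}. i (?t m) = j m) \<longleftrightarrow> i = j \<circ> ?t"
    proof
      assume *: "\<forall>m\<in>{1..n}. i (?t m) = j m"
      show "i = j \<circ> ?t"
      proof
        fix m
        show "i m = (j \<circ> ?t) m"
        proof (cases "m \<in> {1..n}")
          case True
          then have "?t m \<in> {1..n}" using permutes_in_image[OF t] by blast
          with * have "i (?t (?t m)) = j (?t m)" by blast
          then show ?thesis by simp
        next
          case False
          then show ?thesis using i mem by (auto simp: indices_def PiE_iff extensional_def)
        qed
      qed
    qed auto
    moreover have "(\<forall>e\<in>perm_diagram n ?t. \<forall>p\<in>e. \<forall>q\<in>e. vertex_label i j p = vertex_label i j q)
        \<longleftrightarrow> (\<forall>m\<in>{1..n}. i (?t m) = j m)"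
      unfolding perm_diagram_def ball_collect edge_labels by blast
    ultimately show ?thesis by (simp add: diagram_coeff_def unit_tensor_def)
  qed
  moreover have "unit_tensor (j \<circ> ?t) i = 0" if "i \<notin> indices N n" for i
    using that mem by (auto simp: unit_tensor_def)
  ultimately show ?thesis
    unfolding act_brauer_basis[OF perm_diagram_in_diagrams[OF t] assms(3)] by (intro ext) simp
qed

lemma act_bar:
  assumes "k \<in> {1..n}" "l \<in> {1..n}" "k \<noteq> l" "j \<in> indices N n"
  shows "act N n (brauer_basis (bar_diagram n k l)) (unit_tensor j)
    = (if j k = j l then \<Sum>a<N. unit_tensor (j(k := a, l := a)) else 0)"
proof
  fix i
  have coeff: "diagram_coeff (bar_diagram n k l) i j =
      (if i k = i l \<and> j k = j l \<and> (\<forall>m\<in>{1..n} - {k, l}. i m = j m) then 1 else 0)"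
  proof -
    have "(\<forall>e\<in>bar_diagram n k l. \<forall>p\<in>e. \<forall>q\<in>e. vertex_label i j p = vertex_label i j q)
        \<longleftrightarrow> i k = i l \<and> j k = j l \<and> (\<forall>m\<in>{1..n} - {k, l}. i m = j m)"
      unfolding bar_diagram_def ball_Un ball_collect ball_simps vertex_label_def sum.case by metis
    then show ?thesis by (simp add: diagram_coeff_def)
  qed
  have sum: "(\<Sum>a<N. unit_tensor (j(k := a, l := a))) i =
      (if i \<in> indices N n \<and> i k = i l \<and> (\<forall>m\<in>{1..n} - {k, l}. i m = j m) then 1 else 0)"
    (is "_ = (if ?P then 1 else 0)")
  proof -
    have "(\<Sum>a<N. unit_tensor (j(k := a, l := a))) i
        = (\<Sum>a<N. unit_tensor (j(k := a, l := a)) i)"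
      by (induction N) simp_all
    also have "\<dots> = (\<Sum>a<N. if a = i k \<and> ?P then 1 else 0)"
    proof (rule sum.cong)
      fix a assume a: "a \<in> {..<N}"
      have "i = j(k := a, l := a) \<longleftrightarrow> a = i k \<and> ?P"
      proof
        assume "i = j(k := a, l := a)"
        then show "a = i k \<and> ?P"
          using assms a by (auto simp: indices_def PiE_iff extensional_def)
      next
        assume *: "a = i k \<and> ?P"
        show "i = j(k := a, l := a)"
        proof
          fix m
          show "i m = (j(k := a, l := a)) m"
            using * assms by (cases "m \<in> {1..n}") (auto simp: indices_def PiE_iff extensional_def)
        qed
      qed
      then show "unit_tensor (j(k := a, l := a)) i = (if a = i k \<and> ?P then 1 else 0)"
        by (simp add: unit_tensor_def)
    qed simp
    also have "\<dots> = (if ?P then 1 else 0)"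
    proof (cases ?P)
      case True
      then have "i k < N" using assms by (auto simp: indices_def PiE_iff)
      then show ?thesis using True by simp
    next
      case False
      then have "(a = i k \<and> ?P) = False" for a by blast
      then show ?thesis using False by (simp only: if_False sum.neutral_const)
    qed
    finally show ?thesis .
  qed
  show "act N n (brauer_basis (bar_diagram n k l)) (unit_tensor j) i =
      (if j k = j l then \<Sum>a<N. unit_tensor (j(k := a, l := a)) else 0) i"
    unfolding act_brauer_basis[OF bar_diagram_in_diagrams[OF assms(1-3)] assms(4)] coeff
    using sum by (cases "j k = j l") simp_all
qed

end

theory Submission
  imports "HOL-Probability.Probability" "Jordan_Normal_Form.Determinant" Defs
begin

text \<open>
  The sum \<open>z\<^sub>k = x\<^sub>1 + \<dots> + x\<^sub>k\<close> is a multiple of the Casimir operator of the orthogonal Lie algebra.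
  Hence it commutes with all \<open>G\<close>-homomorphisms, and on Weyl's modules it is a scalar given by the contents
  of the boxes; this makes \<open>x\<^sub>k = z\<^sub>k - z\<^sub>k\<^sub>-\<^sub>1\<close> diagonal in the canonical basis. Let \<open>b\<close> be the bar of
  \<open>(k, k + 1)\<close>. The relation \<open>s\<^sub>k x\<^sub>k = x\<^sub>k\<^sub>+\<^sub>1 s\<^sub>k - 1 + b\<close> gives the result once \<open>b\<close> annihilates \<open>v \<Lambda>\<close>.
  If \<open>\<Lambda> (k - 1)\<close> and \<open>\<Lambda> (k + 1)\<close> have equally many boxes, their content sums differ, and
  \<open>b (x\<^sub>k + x\<^sub>k\<^sub>+\<^sub>1) = 0\<close> suffices. Otherwise the eigenvalues need not separate the two diagrams (they agree for
  associated diagrams). Then \<open>b (v \<Lambda>)\<close> vanishes because traceless tensors of different degrees admit no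
  invariant pairing. This fragment of the first fundamental theorem is proved by applying a random Gaussian matrix to
  every slot of an invariant tensor and taking the expectation.
\<close>

hide_const (open) Finite_Cartesian_Product.transpose

section \<open>Invariant tensors\<close>

text \<open>The Casimir operator sees only the Lie algebra, that is, the connected component of the
  group. It cannot tell a diagram from its associate, whose first column has N minus as many boxes.
  If \<open>\<Lambda> (k - 1)\<close> and \<open>\<Lambda> (k + 1)\<close> differ only in first
  columns of N/2 - 1 and N/2 + 1 boxes, then x_k + x_{k+1} = 0, and no argument with eigenvalues can
  work. This case needs reflections: the alternating tensor of degree N >= 2 is traceless and fixed
  by all rotations, yet not zero. Reflections enter through the QR decomposition, which must give a
  nonnegative diagonal for matrices of negative determinant too. Gaussian matrices take the place of
  the Haar measure: their moments are explicit, and the QR decomposition replaces the invariance of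
  the measure. The bridge from the canonical basis to tensors is the orthogonal projection onto an
  isotypic component of the k-th tensor power. It belongs to C(k,N) and fixes V(\<gamma>,k), hence
  also every copy of V(\<gamma>,k) in a larger module. So the first k factors of every value of
  \<open>v \<Lambda>\<close> lie in that component.\<close>

definition gauss_moment :: "nat \<Rightarrow> real" where
  "gauss_moment k = (LBINT x. std_normal_density x * x ^ k)"

lemma gauss_moment_0 [simp]: "gauss_moment 0 = 1"
  using integral_std_normal_moment_even[of 0] by (simp add: gauss_moment_def)

text \<open>Integration by parts against the Gaussian density, here read off from the closed
  formulas for even and odd moments. At \<open>k = 0\<close> the truncated \<open>k - 1\<close> is
  harmless because of the factor \<open>real k\<close>.\<close>

lemma gauss_moment_Suc: "gauss_moment (Suc k) = real k * gauss_moment (k - 1)"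
proof (cases "even k")
  case True
  then obtain j where k: "k = 2 * j" by blast
  have 1: "gauss_moment (Suc k) = 0"
    using integral_std_normal_moment_odd[of j] by (simp add: gauss_moment_def k)
  show ?thesis
  proof (cases j)
    case 0
    then show ?thesis using 1 k by simp
  next
    case (Suc i)
    have "gauss_moment (k - 1) = 0"
      using integral_std_normal_moment_odd[of i] by (simp add: gauss_moment_def k Suc)
    then show ?thesis using 1 by simp
  qed
next
  case False
  then obtain j where k: "k = 2 * j + 1" using oddE by blast
  have "gauss_moment (2 * Suc j) = fact (2 * Suc j) / (2 ^ Suc j * fact (Suc j))"
    unfolding gauss_moment_def by (rule integral_std_normal_moment_even)
  also have "(fact (2 * Suc j) :: real) = (2 * real (Suc j)) * (real (2 * j + 1) * fact (2 * j))"
    by (simp add: algebra_simps)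
  also have "(2 ^ Suc j * fact (Suc j) :: real) = (2 * real (Suc j)) * (2 ^ j * fact j)"
    by (simp add: algebra_simps)
  also have "(2 * real (Suc j)) * (real (2 * j + 1) * fact (2 * j)) / ((2 * real (Suc j)) * (2 ^ j * fact j))
      = real (2 * j + 1) * (fact (2 * j) / (2 ^ j * fact j))"
    by (subst mult_divide_mult_cancel_left) auto
  also have "fact (2 * j) / (2 ^ j * fact j) = gauss_moment (2 * j)"
    unfolding gauss_moment_def by (rule integral_std_normal_moment_even[symmetric])
  finally show ?thesis by (simp add: k)
qed

text \<open>The expectation of a product of standard normal variables, one factor for each slot in
  \<open>A\<close>: slots of the same colour \<open>c s\<close> carry the same variable, slots of
  different colours independent ones. Grouping by colour leaves a product of moments.\<close>

definition wick :: "('s \<Rightarrow> 'c) \<Rightarrow> 's set \<Rightarrow> real" where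
  "wick c A = (\<Prod>x\<in>c ` A. gauss_moment (card {s \<in> A. c s = x}))"

lemma wick_superset:
  assumes "finite I" "c ` A \<subseteq> I"
  shows "wick c A = (\<Prod>x\<in>I. gauss_moment (card {s \<in> A. c s = x}))"
  unfolding wick_def
proof (rule prod.mono_neutral_left[OF assms])
  show "\<forall>x\<in>I - c ` A. gauss_moment (card {s \<in> A. c s = x}) = 1"
  proof
    fix x assume "x \<in> I - c ` A"
    then have "{s \<in> A. c s = x} = {}" by auto
    then show "gauss_moment (card {s \<in> A. c s = x}) = 1" by (simp only: card.empty gauss_moment_0)
  qed
qed

lemma wick_cong: "(\<And>s. s \<in> A \<Longrightarrow> c s = c' s) \<Longrightarrow> wick c A = wick c' A"
proof -
  assume *: "\<And>s. s \<in> A \<Longrightarrow> c s = c' s"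
  then have "c ` A = c' ` A" by auto
  moreover have "{s \<in> A. c s = x} = {s \<in> A. c' s = x}" for x using * by auto
  ultimately show ?thesis by (simp add: wick_def)
qed

text \<open>Wick's formula in recursive form: \<open>s\<close> is paired with another slot
  \<open>t\<close> of its colour. Each of the \<open>k\<close> candidates leaves
  \<open>k - 1\<close> slots of that colour, so \<open>gauss_moment_Suc\<close> turns the moment of
  this colour into the sum over the choices of \<open>t\<close>.\<close>

lemma wick_rec:
  assumes "finite A" "s \<in> A"
  shows "wick c A = (\<Sum>t\<in>A - {s}. if c t = c s then wick c (A - {s, t}) else 0)"
proof -
  define T where "T = {t \<in> A - {s}. c t = c s}"
  define k where "k = card T"
  define J where "J = c ` A"
  define P where "P = (\<Prod>x\<in>J - {c s}. gauss_moment (card {r \<in> A. c r = x}))"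
  have J: "finite J" "c s \<in> J" using assms by (auto simp: J_def)
  have T: "finite T" using assms by (simp add: T_def)
  have "{r \<in> A. c r = c s} = insert s T" using assms by (auto simp: T_def)
  then have "card {r \<in> A. c r = c s} = Suc k" using T by (simp add: k_def T_def)
  moreover have "wick c A = (\<Prod>x\<in>J. gauss_moment (card {r \<in> A. c r = x}))"
    by (simp add: wick_def J_def)
  ultimately have 1: "wick c A = gauss_moment (Suc k) * P"
    using J by (simp add: prod.remove P_def)
  have 2: "wick c (A - {s, t}) = gauss_moment (k - 1) * P" if t: "t \<in> T" for t
  proof -
    have "wick c (A - {s, t}) = (\<Prod>x\<in>J. gauss_moment (card {r \<in> A - {s, t}. c r = x}))"
      by (rule wick_superset) (auto simp: J_def assms)
    also have "\<dots> = gauss_moment (card {r \<in> A - {s, t}. c r = c s}) *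
        (\<Prod>x\<in>J - {c s}. gauss_moment (card {r \<in> A - {s, t}. c r = x}))"
      using J by (simp add: prod.remove)
    also have "{r \<in> A - {s, t}. c r = c s} = T - {t}" by (auto simp: T_def)
    also have "card (T - {t}) = k - 1" using t T by (simp add: k_def)
    also have "(\<Prod>x\<in>J - {c s}. gauss_moment (card {r \<in> A - {s, t}. c r = x})) = P"
      unfolding P_def
    proof (rule prod.cong[OF refl])
      fix x assume "x \<in> J - {c s}"
      then have "{r \<in> A - {s, t}. c r = x} = {r \<in> A. c r = x}" using t by (auto simp: T_def)
      then show "gauss_moment (card {r \<in> A - {s, t}. c r = x}) = gauss_moment (card {r \<in> A. c r = x})"
        by simp
    qed
    finally show ?thesis .
  qed
  have "(\<Sum>t\<in>A - {s}. if c t = c s then wick c (A - {s, t}) else 0) = (\<Sum>t\<in>T. wick c (A - {s, t}))"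
    unfolding T_def by (rule sum.inter_filter[symmetric]) (simp add: assms)
  also have "\<dots> = real k * (gauss_moment (k - 1) * P)"
    using 2 by (simp add: k_def)
  finally show ?thesis using 1 by (simp add: gauss_moment_Suc)
qed

section \<open>Integration against independent standard normal variables\<close>

abbreviation gauss_measure :: "'c set \<Rightarrow> ('c \<Rightarrow> real) measure" where
  "gauss_measure I \<equiv> Pi\<^sub>M I (\<lambda>_. density lborel (\<lambda>x. ennreal (std_normal_density x)))"

lemma prob_space_std_normal: "prob_space (density lborel (\<lambda>x. ennreal (std_normal_density x)))"
  by (rule prob_space_normal_density) simp

lemma product_sigma_finite_gauss:
  "product_sigma_finite (\<lambda>_ :: 'c. density lborel (\<lambda>x. ennreal (std_normal_density x)))"
  by (rule product_sigma_finite.intro)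
     (rule prob_space_imp_sigma_finite[OF prob_space_std_normal])

lemma gauss_monomial:
  fixes c :: "'s \<Rightarrow> 'c"
  assumes "finite I" "finite A" "c ` A \<subseteq> I"
  shows "integrable (gauss_measure I) (\<lambda>M. \<Prod>s\<in>A. M (c s))"
    and "(LINT M|gauss_measure I. (\<Prod>s\<in>A. M (c s))) = wick c A"
proof -
  interpret product_sigma_finite "\<lambda>_ :: 'c. density lborel (\<lambda>x. ennreal (std_normal_density x))"
    by (rule product_sigma_finite_gauss)
  have eq: "(\<Prod>s\<in>A. M (c s)) = (\<Prod>x\<in>I. M x ^ card {s \<in> A. c s = x})" for M :: "'c \<Rightarrow> real"
  proof -
    have "(\<Prod>s\<in>A. M (c s)) = (\<Prod>x\<in>I. \<Prod>s\<in>{s \<in> A. c s = x}. M (c s))"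
      by (rule prod.group[symmetric, OF assms(2,1,3)])
    also have "\<dots> = (\<Prod>x\<in>I. M x ^ card {s \<in> A. c s = x})"
      by (rule prod.cong) auto
    finally show ?thesis .
  qed
  have int: "integrable (density lborel (\<lambda>x. ennreal (std_normal_density x))) (\<lambda>x. x ^ k)" for k
    by (subst integrable_density) (auto simp: integrable_std_normal_moment)
  have mom: "integral\<^sup>L (density lborel (\<lambda>x. ennreal (std_normal_density x))) (\<lambda>x. x ^ k) = gauss_moment k" for k
    unfolding gauss_moment_def by (subst integral_density) auto
  show "integrable (gauss_measure I) (\<lambda>M. \<Prod>s\<in>A. M (c s))"
    unfolding eq by (rule product_integrable_prod[OF assms(1) int])
  show "(LINT M|gauss_measure I. (\<Prod>s\<in>A. M (c s))) = wick c A"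
    unfolding eq wick_superset[OF assms(1,3)] mom[symmetric]
    by (rule product_integral_prod[OF assms(1) int])
qed

text \<open>\<open>Q\<close> vanishes almost everywhere. If it were positive at \<open>M\<close>,
  continuity in the product topology would give an open box around \<open>M\<close> on which it is
  positive, and a box with nonempty open sides has positive Gaussian measure because the density is
  positive.\<close>

lemma gauss_continuous_nonneg_zero:
  fixes Q :: "('c \<Rightarrow> real) \<Rightarrow> real"
  assumes "finite I" "integrable (gauss_measure I) Q" "integral\<^sup>L (gauss_measure I) Q = 0"
    and nonneg: "\<And>M. 0 \<le> Q M"
    and cont: "continuous_on UNIV Q"
    and local: "\<And>M M'. (\<And>c. c \<in> I \<Longrightarrow> M c = M' c) \<Longrightarrow> Q M = Q M'"
  shows "Q M = 0"
proof (rule ccontr)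
  interpret product_sigma_finite "\<lambda>_ :: 'c. density lborel (\<lambda>x. ennreal (std_normal_density x))"
    by (rule product_sigma_finite_gauss)
  assume "Q M \<noteq> 0"
  then have pos: "Q M > 0" using nonneg[of M] by linarith
  have "open (Q -` {0<..})" using cont by (simp add: open_vimage)
  moreover have "M \<in> Q -` {0<..}" using pos by simp
  ultimately obtain X where X: "\<And>i. open (X i)" "M \<in> Pi\<^sub>E UNIV X" "Pi\<^sub>E UNIV X \<subseteq> Q -` {0<..}"
    using product_topology_open_contains_basis[of "\<lambda>_. euclidean" UNIV "Q -` {0<..}" M]
    by (auto simp: open_fun_def)
  have "AE M in gauss_measure I. Q M = 0"
    using integral_nonneg_eq_0_iff_AE[OF assms(2)] assms(3) nonneg by simp
  then obtain Z where Z: "{M \<in> space (gauss_measure I). Q M \<noteq> 0} \<subseteq> Z" "Z \<in> sets (gauss_measure I)" "emeasure (gauss_measure I) Z = 0"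
    by (rule AE_E) simp
  have "Pi\<^sub>E I X \<subseteq> {M \<in> space (gauss_measure I). Q M \<noteq> 0}"
  proof
    fix M' assume M': "M' \<in> Pi\<^sub>E I X"
    \<comment> \<open>Points of the product measure are \<open>undefined\<close> outside
      \<open>I\<close>, whereas the open box may constrain every coordinate. Outside
      \<open>I\<close> the coordinates of \<open>M\<close> are filled in, which by
      \<open>local\<close> does not change \<open>Q\<close>.\<close>
    define M'' where "M'' = (\<lambda>c. if c \<in> I then M' c else M c)"
    have "M'' \<in> Pi\<^sub>E UNIV X" using M' X(2) by (auto simp: M''_def PiE_iff)
    then have "Q M'' > 0" using X(3) by auto
    moreover have "Q M'' = Q M'" by (rule local) (simp add: M''_def)
    ultimately show "M' \<in> {M \<in> space (gauss_measure I). Q M \<noteq> 0}"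
      using M' by (auto simp: space_PiM PiE_iff)
  qed
  then have "Pi\<^sub>E I X \<subseteq> Z" using Z by blast
  then have "emeasure (gauss_measure I) (Pi\<^sub>E I X) = 0"
    using emeasure_mono[of "Pi\<^sub>E I X" Z "gauss_measure I"] Z by simp
  moreover have "emeasure (gauss_measure I) (Pi\<^sub>E I X)
      = (\<Prod>i\<in>I. emeasure (density lborel (\<lambda>x. ennreal (std_normal_density x))) (X i))"
    by (rule emeasure_PiM) (simp_all add: X(1) assms(1))
  ultimately obtain i where i: "emeasure (density lborel (\<lambda>x. ennreal (std_normal_density x))) (X i) = 0"
    using \<open>finite I\<close> by auto
  have "X i \<in> null_sets (density lborel (\<lambda>x. ennreal (std_normal_density x)))"
    using i X(1)[of i] by (auto simp: null_sets_def)
  then have "AE x in lborel. x \<in> X i \<longrightarrow> ennreal (std_normal_density x) = 0"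
    by (subst (asm) null_sets_density_iff) auto
  then have "AE x in lborel. x \<notin> X i"
  proof (rule AE_mp, intro AE_I2 impI notI)
    fix x assume "x \<in> X i \<longrightarrow> ennreal (std_normal_density x) = 0" "x \<in> X i"
    then show False using normal_density_pos[of 1 0 x] by (simp add: ennreal_eq_0_iff)
  qed
  then have "emeasure lborel (X i) = 0"
    using X(1)[of i] by (subst (asm) AE_iff_null[where M=lborel]) (auto simp: null_sets_def)
  moreover have "X i \<noteq> {}" using X(2) by auto
  ultimately show False
    using X(1)[of i] open_not_negligible[of "X i"]
    by (auto simp: negligible_iff_emeasure0 emeasure_lborel_countable)
qed
lemma sum_of_bool_times:
  fixes f :: "'b \<Rightarrow> 'a::semiring_1"
  assumes "finite A" "a \<in> A"
  shows "(\<Sum>c\<in>A. of_bool (a = c) * f c) = f a" "(\<Sum>c\<in>A. of_bool (c = a) * f c) = f a"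
proof -
  have "(\<Sum>c\<in>A. of_bool (a = c) * f c) = (\<Sum>c\<in>A. if a = c then f c else 0)"
    by (rule sum.cong) auto
  then show "(\<Sum>c\<in>A. of_bool (a = c) * f c) = f a" using assms by simp
  then show "(\<Sum>c\<in>A. of_bool (c = a) * f c) = f a" by (simp add: eq_commute[of _ a])
qed

section \<open>Contraction of slots and Wick sums\<close>

lemma sum_PiE_diagonal:
  fixes w :: "('s \<Rightarrow> nat) \<Rightarrow> 'a::comm_monoid_add"
  assumes "finite A" "s \<in> A" "t \<in> A" "s \<noteq> t"
  shows "(\<Sum>j\<in>A \<rightarrow>\<^sub>E {..<N}. if j t = j s then w j else 0)
    = (\<Sum>j\<in>A - {s, t} \<rightarrow>\<^sub>E {..<N}. \<Sum>a<N. w (j(s := a, t := a)))"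
proof -
  have fin: "finite (B \<rightarrow>\<^sub>E {..<N})" if "B \<subseteq> A" for B
    using that assms(1) by (intro finite_PiE) (auto intro: finite_subset)
  have "(\<Sum>j\<in>A \<rightarrow>\<^sub>E {..<N}. if j t = j s then w j else 0)
      = (\<Sum>j\<in>{j \<in> A \<rightarrow>\<^sub>E {..<N}. j t = j s}. w j)"
    by (rule sum.inter_filter[symmetric]) (simp add: fin)
  also have "\<dots> = (\<Sum>(j, a)\<in>(A - {s, t} \<rightarrow>\<^sub>E {..<N}) \<times> {..<N}. w (j(s := a, t := a)))"
  proof (rule sum.reindex_bij_witness[where i = "\<lambda>(j, a). j(s := a, t := a)"
        and j = "\<lambda>j. (restrict j (A - {s, t}), j s)"])
    fix j assume "j \<in> {j \<in> A \<rightarrow>\<^sub>E {..<N}. j t = j s}"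
    then have j: "j \<in> A \<rightarrow>\<^sub>E {..<N}" "j t = j s" by auto
    have eq: "(restrict j (A - {s, t}))(s := j s, t := j s) = j"
      using j assms by (auto simp: fun_eq_iff PiE_iff extensional_def)
    then show "(case (restrict j (A - {s, t}), j s) of (j, a) \<Rightarrow> j(s := a, t := a)) = j" by simp
    show "(case (restrict j (A - {s, t}), j s) of (j, a) \<Rightarrow> w (j(s := a, t := a))) = w j"
      using eq by simp
    show "(restrict j (A - {s, t}), j s) \<in> (A - {s, t} \<rightarrow>\<^sub>E {..<N}) \<times> {..<N}"
      using j assms by (auto simp: PiE_iff)
  next
    fix p assume p: "p \<in> (A - {s, t} \<rightarrow>\<^sub>E {..<N}) \<times> {..<N}"
    obtain j a where [simp]: "p = (j, a)" by fastforce
    show "(restrict (case p of (j, a) \<Rightarrow> j(s := a, t := a)) (A - {s, t}),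
        (case p of (j, a) \<Rightarrow> j(s := a, t := a)) s) = p"
      using p assms by (auto simp: fun_eq_iff PiE_iff extensional_def)
    show "(case p of (j, a) \<Rightarrow> j(s := a, t := a)) \<in> {j \<in> A \<rightarrow>\<^sub>E {..<N}. j t = j s}"
      using p assms by (auto simp: PiE_iff extensional_def)
  qed
  also have "\<dots> = (\<Sum>j\<in>A - {s, t} \<rightarrow>\<^sub>E {..<N}. \<Sum>a<N. w (j(s := a, t := a)))"
    by (rule sum.cartesian_product[symmetric])
  finally show ?thesis .
qed

text \<open>By Wick's formula the sum runs over pairings of the slots, and since \<open>A2\<close>
  is larger, every pairing joins two slots of \<open>A2\<close>, where \<open>F\<close> has trace 0.
  The induction removes a slot \<open>s\<close> of \<open>A2\<close> together with its partner
  \<open>t\<close>: for \<open>t\<close> in \<open>A2\<close> the contraction vanishes, for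
  \<open>t\<close> in \<open>A1\<close> it is traceless in the rest of \<open>A2\<close> and both
  sets lose one slot. The fixed second colour \<open>f\<close> merely decides which pairings
  contribute.\<close>

lemma wick_sum_traceless:
  fixes F :: "('s \<Rightarrow> nat) \<Rightarrow> complex" and f :: "'s \<Rightarrow> nat"
  assumes "finite A1" "finite A2" "A1 \<inter> A2 = {}" "card A1 < card A2"
    and "\<And>s t j. s \<in> A2 \<Longrightarrow> t \<in> A2 \<Longrightarrow> s \<noteq> t \<Longrightarrow> j \<in> A1 \<union> A2 \<rightarrow>\<^sub>E {..<N} \<Longrightarrow>
      (\<Sum>a<N. F (j(s := a, t := a))) = 0"
  shows "(\<Sum>j\<in>A1 \<union> A2 \<rightarrow>\<^sub>E {..<N}. F j * of_real (wick (\<lambda>s. (j s, f s)) (A1 \<union> A2))) = 0"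
  using assms
proof (induction "card A1" arbitrary: A1 A2 F rule: less_induct)
  case less
  note fin = less.prems(1,2) and disj = less.prems(3) and card = less.prems(4) and tr = less.prems(5)
  let ?A = "A1 \<union> A2"
  from card obtain s where s: "s \<in> A2" by fastforce
  have "(\<Sum>j\<in>?A \<rightarrow>\<^sub>E {..<N}. F j * of_real (wick (\<lambda>s. (j s, f s)) ?A))
      = (\<Sum>j\<in>?A \<rightarrow>\<^sub>E {..<N}. \<Sum>t\<in>?A - {s}. if j t = j s \<and> f t = f s
          then F j * of_real (wick (\<lambda>s. (j s, f s)) (?A - {s, t})) else 0)"
  proof (rule sum.cong[OF refl])
    fix j :: "'s \<Rightarrow> nat"
    have "wick (\<lambda>s. (j s, f s)) ?A = (\<Sum>t\<in>?A - {s}. if (j t, f t) = (j s, f s)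
        then wick (\<lambda>s. (j s, f s)) (?A - {s, t}) else 0)"
      by (rule wick_rec) (use fin s in auto)
    then show "F j * of_real (wick (\<lambda>s. (j s, f s)) ?A) = (\<Sum>t\<in>?A - {s}. if j t = j s \<and> f t = f s
          then F j * of_real (wick (\<lambda>s. (j s, f s)) (?A - {s, t})) else 0)"
      by (simp add: sum_distrib_left if_distrib cong: if_cong)
  qed
  also have "\<dots> = (\<Sum>t\<in>?A - {s}. \<Sum>j\<in>?A \<rightarrow>\<^sub>E {..<N}. if j t = j s \<and> f t = f s
          then F j * of_real (wick (\<lambda>s. (j s, f s)) (?A - {s, t})) else 0)"
    by (rule sum.swap)
  also have "\<dots> = 0"
  proof (rule sum.neutral, rule ballI)
    fix t assume t: "t \<in> ?A - {s}"
    define G where "G j = (\<Sum>a<N. F (j(s := a, t := a)))" for j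
    have *: "(\<Sum>j\<in>?A \<rightarrow>\<^sub>E {..<N}. if j t = j s
          then F j * of_real (wick (\<lambda>s. (j s, f s)) (?A - {s, t})) else 0)
        = (\<Sum>j\<in>?A - {s, t} \<rightarrow>\<^sub>E {..<N}. G j * of_real (wick (\<lambda>s. (j s, f s)) (?A - {s, t})))"
    proof -
      have w: "wick (\<lambda>r. ((j(s := a, t := a)) r, f r)) (?A - {s, t}) = wick (\<lambda>r. (j r, f r)) (?A - {s, t})"
        for j a by (rule wick_cong) auto
      have "(\<Sum>j\<in>?A \<rightarrow>\<^sub>E {..<N}. if j t = j s
          then F j * of_real (wick (\<lambda>s. (j s, f s)) (?A - {s, t})) else 0)
        = (\<Sum>j\<in>?A - {s, t} \<rightarrow>\<^sub>E {..<N}. \<Sum>a<N. F (j(s := a, t := a)) *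
            of_real (wick (\<lambda>r. ((j(s := a, t := a)) r, f r)) (?A - {s, t})))"
        by (rule sum_PiE_diagonal) (use fin s t in auto)
      then show ?thesis unfolding w by (simp add: G_def sum_distrib_right)
    qed
    have "(\<Sum>j\<in>?A - {s, t} \<rightarrow>\<^sub>E {..<N}. G j * of_real (wick (\<lambda>s. (j s, f s)) (?A - {s, t}))) = 0"
    proof (cases "t \<in> A2")
      case True
      have "G j = 0" if j: "j \<in> ?A - {s, t} \<rightarrow>\<^sub>E {..<N}" for j
      proof (cases "N = 0")
        case False
        \<comment> \<open>\<open>tr\<close> asks for an index defined on all slots; the values at
          \<open>s\<close> and \<open>t\<close> are fillers that the trace overwrites.\<close>
        have "j(s := 0, t := 0) \<in> ?A \<rightarrow>\<^sub>E {..<N}"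
          using j s t False by (auto simp: PiE_iff extensional_def)
        from tr[OF s True _ this] t show ?thesis by (auto simp: G_def)
      qed (simp add: G_def)
      then show ?thesis by (intro sum.neutral) simp
    next
      case False
      then have t1: "t \<in> A1" using t by auto
      have A: "?A - {s, t} = (A1 - {t}) \<union> (A2 - {s})" using s t1 disj False by auto
      show ?thesis unfolding A
      proof (rule less.hyps)
        show "card (A1 - {t}) < card A1" using t1 fin by (meson card_Diff1_less)
        have "card A1 > 0" using t1 fin by (auto simp: card_gt_0_iff)
        then show "card (A1 - {t}) < card (A2 - {s})" using t1 s fin card by simp
        fix s' t' j
        assume st: "s' \<in> A2 - {s}" "t' \<in> A2 - {s}" "s' \<noteq> t'"
          and j: "j \<in> A1 - {t} \<union> (A2 - {s}) \<rightarrow>\<^sub>E {..<N}"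
        have "(\<Sum>a<N. G (j(s' := a, t' := a)))
            = (\<Sum>b<N. \<Sum>a<N. F ((j(s' := a, t' := a))(s := b, t := b)))"
          unfolding G_def by (rule sum.swap)
        also have "\<dots> = 0"
        proof (rule sum.neutral, rule ballI)
          fix b assume b: "b \<in> {..<N}"
          have "(j(s' := a, t' := a))(s := b, t := b) = (j(s := b, t := b))(s' := a, t' := a)" for a
            using st t1 s disj by (auto simp: fun_eq_iff)
          moreover have "j(s := b, t := b) \<in> ?A \<rightarrow>\<^sub>E {..<N}"
            using j b s t1 by (auto simp: PiE_iff extensional_def)
          ultimately show "(\<Sum>a<N. F ((j(s' := a, t' := a))(s := b, t := b))) = 0"
            using tr[of s' t' "j(s := b, t := b)"] st by simp
        qed
        finally show "(\<Sum>a<N. G (j(s' := a, t' := a))) = 0" .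
      qed (use fin disj in auto)
    qed
    then show "(\<Sum>j\<in>?A \<rightarrow>\<^sub>E {..<N}. if j t = j s \<and> f t = f s
          then F j * of_real (wick (\<lambda>s. (j s, f s)) (?A - {s, t})) else 0) = 0"
      using * by (cases "f t = f s") auto
  qed
  finally show ?case .
qed

section \<open>Real orthogonal matrices and the QR decomposition\<close>

definition orth_mat :: "nat \<Rightarrow> (nat \<Rightarrow> nat \<Rightarrow> real) \<Rightarrow> bool" where
  "orth_mat N g \<longleftrightarrow> (\<forall>a<N. \<forall>b<N. (\<Sum>c<N. g a c * g b c) = of_bool (a = b) \<and>
     (\<Sum>c<N. g c a * g c b) = of_bool (a = b))"

lemma orth_mat_transpose: "orth_mat N g \<Longrightarrow> orth_mat N (\<lambda>a b. g b a)"
  by (simp add: orth_mat_def)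

lemma orth_mat_one: "orth_mat N (\<lambda>a b. of_bool (a = b))"
  using sum_of_bool_times[of "{..<N}" _ "\<lambda>c. of_bool (c = _)"]
    sum_of_bool_times[of "{..<N}" _ "\<lambda>c. of_bool (_ = c)"]
  by (auto simp: orth_mat_def)

lemma orth_mat_mult_aux:
  fixes g h :: "nat \<Rightarrow> nat \<Rightarrow> real"
  assumes g: "\<And>a b. a < N \<Longrightarrow> b < N \<Longrightarrow> (\<Sum>c<N. g a c * g b c) = of_bool (a = b)"
    and h: "\<And>a b. a < N \<Longrightarrow> b < N \<Longrightarrow> (\<Sum>c<N. h a c * h b c) = of_bool (a = b)"
    and "a < N" "b < N"
  shows "(\<Sum>c<N. (\<Sum>d<N. h a d * g d c) * (\<Sum>d<N. h b d * g d c)) = of_bool (a = b)"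
proof -
  have "(\<Sum>c<N. (\<Sum>d<N. h a d * g d c) * (\<Sum>d<N. h b d * g d c))
      = (\<Sum>c<N. \<Sum>d<N. \<Sum>e<N. (h a d * h b e) * (g d c * g e c))"
    by (simp add: sum_product algebra_simps)
  also have "\<dots> = (\<Sum>d<N. \<Sum>c<N. \<Sum>e<N. (h a d * h b e) * (g d c * g e c))"
    by (rule sum.swap)
  also have "\<dots> = (\<Sum>d<N. \<Sum>e<N. \<Sum>c<N. (h a d * h b e) * (g d c * g e c))"
    by (intro sum.cong refl sum.swap)
  also have "\<dots> = (\<Sum>d<N. \<Sum>e<N. (h a d * h b e) * of_bool (d = e))"
    by (intro sum.cong refl) (simp add: sum_distrib_left[symmetric] g)
  also have "\<dots> = (\<Sum>d<N. h a d * h b d)"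
    by (intro sum.cong refl) (simp only: mult.commute[of _ "of_bool _"] sum_of_bool_times finite_lessThan)
  also have "\<dots> = of_bool (a = b)" using assms by simp
  finally show ?thesis .
qed

lemma orth_mat_mult:
  assumes g: "orth_mat N g" and h: "orth_mat N h"
  shows "orth_mat N (\<lambda>a b. \<Sum>c<N. h a c * g c b)"
proof -
  have "(\<Sum>c<N. (\<Sum>d<N. h a d * g d c) * (\<Sum>d<N. h b d * g d c)) = of_bool (a = b)"
    if "a < N" "b < N" for a b
    by (rule orth_mat_mult_aux) (use that g h in \<open>auto simp: orth_mat_def\<close>)
  moreover have "(\<Sum>c<N. (\<Sum>d<N. g d a * h c d) * (\<Sum>d<N. g d b * h c d)) = of_bool (a = b)"
    if "a < N" "b < N" for a b
    by (rule orth_mat_mult_aux[of N "\<lambda>a b. h b a" "\<lambda>a b. g b a"])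
       (use that g h in \<open>auto simp: orth_mat_def\<close>)
  ultimately show ?thesis
    by (simp add: orth_mat_def mult.commute)
qed

text \<open>The reflection in the hyperplane orthogonal to \<open>w\<close>. If \<open>w\<close>
  vanishes, then \<open>q = 0\<close>, and division by 0 turns the formula into the identity matrix,
  so the degenerate case is covered.\<close>

lemma householder:
  fixes w :: "nat \<Rightarrow> real" and N :: nat
  defines "q \<equiv> \<Sum>c<N. w c * w c"
  shows "orth_mat N (\<lambda>a b. of_bool (a = b) - 2 * w a * w b / q)"
proof -
  have "(\<Sum>c<N. (of_bool (a = c) - 2 * w a * w c / q) * (of_bool (b = c) - 2 * w b * w c / q))
      = of_bool (a = b)" if "a < N" "b < N" for a b
  proof -
    have "(\<Sum>c<N. (of_bool (a = c) - 2 * w a * w c / q) * (of_bool (b = c) - 2 * w b * w c / q))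
        = (\<Sum>c<N. of_bool (a = c) * of_bool (b = c)) - (\<Sum>c<N. of_bool (a = c) * (2 * w b * w c / q))
          - (\<Sum>c<N. of_bool (b = c) * (2 * w a * w c / q)) + (\<Sum>c<N. (4 * w a * w b / (q * q)) * (w c * w c))"
      unfolding sum_subtractf[symmetric] sum.distrib[symmetric]
      by (intro sum.cong refl) (simp add: algebra_simps)
    also have "(\<Sum>c<N. (4 * w a * w b / (q * q)) * (w c * w c)) = 4 * w a * w b / q"
      unfolding sum_distrib_left[symmetric] q_def[symmetric] by simp
    also have "(\<Sum>c<N. of_bool (a = c) * of_bool (b = c)) = (of_bool (a = b) :: real)"
      using that sum_of_bool_times(1)[of "{..<N}" a "\<lambda>c. of_bool (b = c) :: real"] by (simp add: eq_commute)
    also have "(\<Sum>c<N. of_bool (a = c) * (2 * w b * w c / q)) = 2 * w a * w b / q"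
      using that by (subst sum_of_bool_times) (simp_all add: mult_ac)
    also have "(\<Sum>c<N. of_bool (b = c) * (2 * w a * w c / q)) = 2 * w a * w b / q"
      using that by (subst sum_of_bool_times) (simp_all add: mult_ac)
    finally show ?thesis by simp
  qed
  moreover have "(of_bool (c = a) - 2 * w c * w a / q) = (of_bool (a = c) - 2 * w a * w c / q)" for a c
    by auto
  ultimately show ?thesis unfolding orth_mat_def by simp
qed

lemma householder_apply:
  fixes w u :: "nat \<Rightarrow> real"
  assumes "i < N"
  shows "(\<Sum>c<N. (of_bool (i = c) - 2 * w i * w c / q) * u c) = u i - 2 * w i / q * (\<Sum>c<N. w c * u c)"
proof -
  have "(\<Sum>c<N. (of_bool (i = c) - 2 * w i * w c / q) * u c)
      = (\<Sum>c<N. of_bool (i = c) * u c) - (\<Sum>c<N. 2 * w i / q * (w c * u c))"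
    unfolding sum_subtractf[symmetric] by (intro sum.cong refl) (simp add: algebra_simps)
  then show ?thesis
    using assms sum_of_bool_times(1)[of "{..<N}" i u] by (simp add: sum_distrib_left)
qed

text \<open>One Householder reflection per column. Its vector \<open>w\<close> is supported on the
  coordinates from \<open>k\<close> on, where the earlier columns already vanish, so these columns
  stay fixed. The sign of the diagonal can be prescribed because the determinant of \<open>g\<close>
  is left free.\<close>

lemma qr_decomposition:
  fixes X :: "nat \<Rightarrow> nat \<Rightarrow> real"
  assumes "k \<le> N"
  shows "\<exists>g. orth_mat N g \<and> (\<forall>j<k. \<forall>i<N. j < i \<longrightarrow> (\<Sum>c<N. g i c * X c j) = 0) \<and>
    (\<forall>j<k. 0 \<le> (\<Sum>c<N. g j c * X c j))"
  using assms
proof (induction k)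
  case 0
  then show ?case using orth_mat_one by blast
next
  case (Suc k)
  then obtain g where g: "orth_mat N g"
    and tri: "\<And>i j. j < k \<Longrightarrow> i < N \<Longrightarrow> j < i \<Longrightarrow> (\<Sum>c<N. g i c * X c j) = 0"
    and pos: "\<And>j. j < k \<Longrightarrow> 0 \<le> (\<Sum>c<N. g j c * X c j)"
    by (auto simp: Suc_le_eq)
  have k: "k < N" using Suc.prems by simp
  define y where "y i j = (\<Sum>c<N. g i c * X c j)" for i j
  define r where "r = sqrt (\<Sum>i\<in>{k..<N}. y i k * y i k)"
  \<comment> \<open>The tail of column \<open>k\<close> and \<open>r\<close> times the unit vector
    at \<open>k\<close> have the same length. Since \<open>w\<close> is their difference, the
    reflection exchanges them: \<open>q\<close> turns out to be twice the inner product of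
    \<open>w\<close> with the column, so exactly \<open>w\<close> is subtracted.\<close>
  define w where "w i = (if i < k then 0 else y i k - (if i = k then r else 0))" for i
  define q where "q = (\<Sum>c<N. w c * w c)"
  define h where "h a b = of_bool (a = b) - 2 * w a * w b / q" for a b
  have h: "orth_mat N h" using householder[of N w] by (simp add: h_def[abs_def] q_def)
  have r2: "r * r = (\<Sum>i\<in>{k..<N}. y i k * y i k)" and r0: "r \<ge> 0"
    by (auto simp: r_def sum_nonneg)
  have split: "(\<Sum>c<N. w c * z c) = (\<Sum>c\<in>{k..<N}. y c k * z c) - r * z k" for z
  proof -
    have "(\<Sum>c<N. w c * z c) = (\<Sum>c\<in>{k..<N}. w c * z c)"
      by (rule sum.mono_neutral_right) (auto simp: w_def)
    also have "\<dots> = (\<Sum>c\<in>{k..<N}. y c k * z c - (if c = k then r * z c else 0))"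
      by (intro sum.cong refl) (auto simp: w_def algebra_simps)
    also have "\<dots> = (\<Sum>c\<in>{k..<N}. y c k * z c) - r * z k"
      using k by (simp add: sum_subtractf)
    finally show ?thesis .
  qed
  have wy: "(\<Sum>c<N. w c * y c k) = r * r - r * y k k"
    by (simp add: split r2)
  have "q = (\<Sum>c\<in>{k..<N}. w c * y c k) - r * w k"
    unfolding q_def split by (simp add: mult.commute)
  also have "(\<Sum>c\<in>{k..<N}. w c * y c k) = (\<Sum>c<N. w c * y c k)"
    by (rule sum.mono_neutral_left) (auto simp: w_def)
  finally have q: "q = 2 * (r * r - r * y k k)"
    unfolding wy by (simp add: w_def algebra_simps)
  have hy: "(\<Sum>c<N. h i c * y c k) = y i k - w i" if "i < N" for i
  proof (cases "q = 0")
    case True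
    then have "\<forall>c<N. w c * w c = 0"
      unfolding q_def by (subst (asm) sum_nonneg_eq_0_iff) auto
    then show ?thesis using that unfolding h_def householder_apply[OF that] by simp
  next
    case False
    have "(\<Sum>c<N. h i c * y c k) = y i k - 2 * w i / q * (q / 2)"
    proof -
      have "(\<Sum>c<N. w c * y c k) = q / 2" unfolding wy q by simp
      then show ?thesis using householder_apply[OF that, of w q "\<lambda>c. y c k"] by (simp only: h_def)
    qed
    then show ?thesis using False by simp
  qed
  have hy': "(\<Sum>c<N. h i c * y c j) = y i j" if "i < N" "j < k" for i j
  proof -
    have "(\<Sum>c<N. w c * y c j) = 0"
      by (rule sum.neutral) (use that tri in \<open>auto simp: w_def y_def\<close>)
    then show ?thesis using householder_apply[OF that(1), of w q "\<lambda>c. y c j"] by (simp add: h_def)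
  qed
  define g' where "g' a b = (\<Sum>c<N. h a c * g c b)" for a b
  have gy: "(\<Sum>c<N. g' i c * X c j) = (\<Sum>c<N. h i c * y c j)" for i j
  proof -
    have "(\<Sum>c<N. g' i c * X c j) = (\<Sum>c<N. \<Sum>d<N. h i d * (g d c * X c j))"
      by (simp add: g'_def sum_distrib_right mult.assoc)
    also have "\<dots> = (\<Sum>d<N. \<Sum>c<N. h i d * (g d c * X c j))" by (rule sum.swap)
    finally show ?thesis by (simp add: y_def sum_distrib_left)
  qed
  have "orth_mat N g'" unfolding g'_def[abs_def] by (rule orth_mat_mult[OF g h])
  moreover have "(\<Sum>c<N. g' i c * X c j) = 0" if "j < Suc k" "i < N" "j < i" for i j
    using that hy[of i] hy'[of i j] tri[of j i] unfolding gy
    by (cases "j = k") (auto simp: w_def y_def)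
  moreover have "0 \<le> (\<Sum>c<N. g' j c * X c j)" if "j < Suc k" for j
    using that hy[of j] hy'[of j j] pos[of j] k r0 unfolding gy
    by (cases "j = k") (auto simp: w_def y_def)
  ultimately show ?case by blast
qed

text \<open>The proof compares two computations of the coefficient of \<open>F\<close> at a minimal index after applying a
  Gaussian matrix to every slot: a QR decomposition shows that it is a nonnegative multiple of the coefficient of \<open>F\<close>,
  while its expectation vanishes by Wick's recursion, since every complete contraction of \<open>F\<close>
  contracts two slots in \<open>A2\<close>.\<close>

lemma invariant_traceless_zero:
  fixes F :: "('s \<Rightarrow> nat) \<Rightarrow> complex"
  assumes fin: "finite A1" "finite A2" and disj: "A1 \<inter> A2 = {}" and card: "card A1 < card A2"
    and tr: "\<And>s t j. s \<in> A2 \<Longrightarrow> t \<in> A2 \<Longrightarrow> s \<noteq> t \<Longrightarrow> j \<in> A1 \<union> A2 \<rightarrow>\<^sub>E {..<N} \<Longrightarrow>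
      (\<Sum>a<N. F (j(s := a, t := a))) = 0"
    and inv: "\<And>g i. orth_mat N g \<Longrightarrow> i \<in> A1 \<union> A2 \<rightarrow>\<^sub>E {..<N} \<Longrightarrow>
      (\<Sum>j\<in>A1 \<union> A2 \<rightarrow>\<^sub>E {..<N}. (\<Prod>s\<in>A1 \<union> A2. of_real (g (i s) (j s))) * F j) = F i"
    and i: "i \<in> A1 \<union> A2 \<rightarrow>\<^sub>E {..<N}"
  shows "F i = 0"
proof (rule ccontr)
  assume Fi: "F i \<noteq> 0"
  define A where "A = A1 \<union> A2"
  define P where "P = (A \<rightarrow>\<^sub>E {..<N})"
  have A: "finite A" and P: "finite P"
    using fin by (auto simp: A_def P_def intro!: finite_PiE)
  \<comment> \<open>Minimality of the sum leaves a single term after the QR decomposition: another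
    index \<open>j\<close> either exceeds \<open>f\<close> in some slot, where the triangular matrix
    has entry 0, or lies below \<open>f\<close> everywhere, so that its sum is smaller and
    \<open>F j = 0\<close>.\<close>
  obtain f where f: "f \<in> P" "F f \<noteq> 0" and min: "\<And>j. j \<in> P \<Longrightarrow> F j \<noteq> 0 \<Longrightarrow> sum f A \<le> sum j A"
    using ex_has_least_nat[of "\<lambda>j. j \<in> P \<and> F j \<noteq> 0" i "\<lambda>j. sum j A"] i Fi
    by (auto simp: A_def P_def)
  \<comment> \<open>Division by \<open>F f\<close> turns the coefficient into a product of diagonal
    entries of the triangular factor, hence a nonnegative real number, and gives it the value 1 at
    the identity matrix. This value is what the vanishing expectation contradicts.\<close>
  define Q where "Q M = Re ((\<Sum>h\<in>P. of_real (\<Prod>s\<in>A. M (h s, f s)) * F h) / F f)" for M :: "nat \<times> nat \<Rightarrow> real"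
  define I where "I = {..<N} \<times> {..<N}"
  have hI: "(\<lambda>s. (h s, f s)) ` A \<subseteq> I" if "h \<in> P" for h
    using that f(1) by (auto simp: I_def P_def)
  have Re_scale: "Re (of_real c * z / w) = Re (z / w) * c" for c z w
  proof -
    have "of_real c * z / w = of_real c * (z / w)" by simp
    then show ?thesis by (simp only: Re_complex_of_real Im_complex_of_real times_complex.sel) simp
  qed
  have Qsum: "Q M = (\<Sum>h\<in>P. Re (F h / F f) * (\<Prod>s\<in>A. M (h s, f s)))" for M
    unfolding Q_def sum_divide_distrib Re_sum Re_scale ..
  have nonneg: "0 \<le> Q M" for M
  proof -
    obtain g where g: "orth_mat N g"
      and tri: "\<And>i j. j < N \<Longrightarrow> i < N \<Longrightarrow> j < i \<Longrightarrow> (\<Sum>c<N. g i c * M (c, j)) = 0"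
      and pos: "\<And>j. j < N \<Longrightarrow> 0 \<le> (\<Sum>c<N. g j c * M (c, j))"
      using qr_decomposition[of N N "\<lambda>c j. M (c, j)"] by auto
    have "(\<Sum>h\<in>P. of_real (\<Prod>s\<in>A. M (h s, f s)) * F h)
        = (\<Sum>h\<in>P. of_real (\<Prod>s\<in>A. M (h s, f s)) * (\<Sum>j\<in>P. (\<Prod>s\<in>A. of_real (g (j s) (h s))) * F j))"
      using inv[OF orth_mat_transpose[OF g]] by (intro sum.cong refl) (simp add: P_def A_def)
    also have "\<dots> = (\<Sum>h\<in>P. \<Sum>j\<in>P. of_real (\<Prod>s\<in>A. g (j s) (h s) * M (h s, f s)) * F j)"
      by (simp add: sum_distrib_left prod.distrib mult_ac)
    also have "\<dots> = (\<Sum>j\<in>P. of_real (\<Sum>h\<in>P. \<Prod>s\<in>A. g (j s) (h s) * M (h s, f s)) * F j)"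
      by (subst sum.swap) (simp add: sum_distrib_right)
    also have "\<dots> = (\<Sum>j\<in>P. of_real (\<Prod>s\<in>A. \<Sum>c<N. g (j s) c * M (c, f s)) * F j)"
      using A by (simp add: P_def prod_sum_PiE)
    also have "\<dots> = (\<Sum>j\<in>P. if j = f then of_real (\<Prod>s\<in>A. \<Sum>c<N. g (f s) c * M (c, f s)) * F f else 0)"
    proof (rule sum.cong[OF refl])
      fix j assume j: "j \<in> P"
      have "of_real (\<Prod>s\<in>A. \<Sum>c<N. g (j s) c * M (c, f s)) * F j = 0" if ne: "j \<noteq> f"
      proof (cases "\<forall>s\<in>A. j s \<le> f s")
        case True
        obtain s where s: "j s \<noteq> f s" using ne by auto
        then have "s \<in> A" using j f(1) unfolding P_def by (metis PiE_arb)
        then have "sum j A < sum f A"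
          using True s A by (intro sum_strict_mono_ex1) (auto intro!: bexI[of _ s] simp: le_less)
        then have "F j = 0" using min[OF j] by fastforce
        then show ?thesis by simp
      next
        case False
        then obtain s where s: "s \<in> A" "f s < j s" by auto
        then have "(\<Sum>c<N. g (j s) c * M (c, f s)) = 0"
          using j f(1) by (intro tri) (auto simp: P_def)
        then have "(\<Prod>s\<in>A. \<Sum>c<N. g (j s) c * M (c, f s)) = 0" using A s by auto
        then show ?thesis by simp
      qed
      then show "of_real (\<Prod>s\<in>A. \<Sum>c<N. g (j s) c * M (c, f s)) * F j
          = (if j = f then of_real (\<Prod>s\<in>A. \<Sum>c<N. g (f s) c * M (c, f s)) * F f else 0)" by auto
    qed
    also have "\<dots> = of_real (\<Prod>s\<in>A. \<Sum>c<N. g (f s) c * M (c, f s)) * F f"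
      using P f by simp
    finally have "Q M = (\<Prod>s\<in>A. \<Sum>c<N. g (f s) c * M (c, f s))"
      using f by (simp add: Q_def del: of_real_prod of_real_sum of_real_mult)
    moreover have "0 \<le> (\<Prod>s\<in>A. \<Sum>c<N. g (f s) c * M (c, f s))"
      by (rule prod_nonneg) (use f(1) in \<open>auto intro!: pos simp: P_def\<close>)
    ultimately show ?thesis by simp
  qed
  have int: "integrable (gauss_measure I) Q"
    unfolding Qsum[abs_def]
    by (intro Bochner_Integration.integrable_sum integrable_mult_right gauss_monomial(1)) (use hI A in \<open>auto simp: I_def\<close>)
  have int0: "integral\<^sup>L (gauss_measure I) Q = 0"
  proof -
    have "integral\<^sup>L (gauss_measure I) Q
        = (\<Sum>h\<in>P. integral\<^sup>L (gauss_measure I) (\<lambda>M. Re (F h / F f) * (\<Prod>s\<in>A. M (h s, f s))))"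
      unfolding Qsum[abs_def]
      by (intro Bochner_Integration.integral_sum integrable_mult_right gauss_monomial(1))
         (use hI A in \<open>auto simp: I_def\<close>)
    also have "\<dots> = (\<Sum>h\<in>P. Re (F h / F f) * wick (\<lambda>s. (h s, f s)) A)"
    proof (rule sum.cong[OF refl])
      fix h assume "h \<in> P"
      from gauss_monomial(2)[of I A "\<lambda>s. (h s, f s)", OF _ A hI[OF this]]
      show "integral\<^sup>L (gauss_measure I) (\<lambda>M. Re (F h / F f) * (\<Prod>s\<in>A. M (h s, f s)))
          = Re (F h / F f) * wick (\<lambda>s. (h s, f s)) A"
        by (simp add: I_def)
    qed
    also have "\<dots> = Re ((\<Sum>h\<in>P. F h * of_real (wick (\<lambda>s. (h s, f s)) A)) / F f)"
      unfolding sum_divide_distrib Re_sum mult.commute[of "F _" "of_real _"] Re_scale ..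
    also have "(\<Sum>h\<in>P. F h * of_real (wick (\<lambda>s. (h s, f s)) A)) = 0"
      unfolding P_def A_def by (rule wick_sum_traceless) (use fin disj card tr in auto)
    finally show ?thesis by simp
  qed
  have cont: "continuous_on UNIV Q"
    unfolding Qsum[abs_def] by (intro continuous_intros continuous_on_product_coordinates)
  have local: "Q M = Q M'" if *: "\<And>c. c \<in> I \<Longrightarrow> M c = M' c" for M M'
  proof -
    have "M (h s, f s) = M' (h s, f s)" if "h \<in> P" "s \<in> A" for h s
      using hI[OF that(1)] that(2) by (intro *) auto
    then show ?thesis unfolding Qsum by (intro sum.cong refl arg_cong2[of _ _ _ _ "(*)"] prod.cong) auto
  qed
  have "finite I" by (simp add: I_def)
  then have "Q (\<lambda>(a, b). of_bool (a = b)) = 0"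
    by (rule gauss_continuous_nonneg_zero[of I Q, OF _ int int0 nonneg cont local])
  moreover have "Q (\<lambda>(a, b). of_bool (a = b)) = 1"
  proof -
    have "(\<Prod>s\<in>A. of_bool (h s = f s) :: real) = of_bool (h = f)" if "h \<in> P" for h
    proof (cases "h = f")
      case False
      then obtain s where "h s \<noteq> f s" by auto
      moreover from this have "s \<in> A" using that f(1) unfolding P_def by (metis PiE_arb)
      ultimately show ?thesis using A False by auto
    qed simp
    then have "(\<Sum>h\<in>P. of_real (\<Prod>s\<in>A. of_bool (h s = f s) :: real) * F h) = (\<Sum>h\<in>P. if h = f then F f else 0)"
      by (intro sum.cong refl) auto
    also have "\<dots> = F f" using P f by simp
    finally show ?thesis using f by (simp add: Q_def)
  qed
  ultimately show False by simp
qed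

section \<open>Jucys-Murphy elements on tensors\<close>

lemma index_less: "i \<in> indices N n \<Longrightarrow> m \<in> {1..n} \<Longrightarrow> i m < N"
  by (auto simp: indices_def)

lemma index_undefined: "i \<in> indices N n \<Longrightarrow> m \<notin> {1..n} \<Longrightarrow> i m = undefined"
  unfolding indices_def by (rule PiE_arb)

lemma index_upd: "i \<in> indices N n \<Longrightarrow> m \<in> {1..n} \<Longrightarrow> a < N \<Longrightarrow> i(m := a) \<in> indices N n"
  by (auto simp: indices_def PiE_iff extensional_def)

lemma index_upd2:
  "i \<in> indices N n \<Longrightarrow> k \<in> {1..n} \<Longrightarrow> l \<in> {1..n} \<Longrightarrow> a < N \<Longrightarrow> b < N \<Longrightarrow> i(k := a, l := b) \<in> indices N n"
  by (intro index_upd) auto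

lemma index_perm:
  assumes "s permutes {1..n}" "i \<in> indices N n"
  shows "i \<circ> s \<in> indices N n"
  using assms(2) permutes_in_image[OF assms(1)] permutes_not_in[OF assms(1)]
  by (auto simp: indices_def PiE_iff extensional_def)

lemma sum_fun_apply: "(\<Sum>x\<in>A. f x) i = (\<Sum>x\<in>A. f x i)" for f :: "'b \<Rightarrow> 'a \<Rightarrow> complex"
  by (induction A rule: infinite_finite_induct) auto

lemma act_add: "act N n (a + b) T = act N n a T + act N n b T"
  by (auto simp: act_def fun_eq_iff distrib_right sum.distrib)

lemma act_minus: "act N n (a - b) T = act N n a T - act N n b T"
  by (auto simp: act_def fun_eq_iff left_diff_distrib sum_subtractf)

lemma act_scale: "act N n (scale_fun c a) T = scale_fun c (act N n a T)"
  by (auto simp: act_def scale_fun_def fun_eq_iff sum_distrib_left mult.assoc)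

lemma act_sum: "act N n (\<Sum>x\<in>A. f x) T = (\<Sum>x\<in>A. act N n (f x) T)"
  by (rule Modules.additive.sum[of "\<lambda>a. act N n a T"]) (rule Modules.additive.intro, rule act_add)

lemma act_basis:
  assumes "\<gamma> \<in> diagrams n"
  shows "act N n (brauer_basis \<gamma>) T = (\<lambda>i. if i \<in> indices N n
    then \<Sum>j\<in>indices N n. diagram_coeff \<gamma> i j * T j else 0)"
proof -
  have "(\<Sum>\<gamma>'\<in>diagrams n. brauer_basis \<gamma> \<gamma>' * f \<gamma>') = (\<Sum>\<gamma>'\<in>diagrams n. if \<gamma>' = \<gamma> then f \<gamma>' else 0)"
    for f by (rule sum.cong) (auto simp: brauer_basis_def)
  then have *: "(\<Sum>\<gamma>'\<in>diagrams n. brauer_basis \<gamma> \<gamma>' * f \<gamma>') = f \<gamma>" for f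
    using assms finite_diagrams[of n] by simp
  show ?thesis unfolding act_def by (subst *) (rule refl)
qed

lemma act_perm:
  assumes "s permutes {1..n}"
  shows "act N n (brauer_basis (perm_diagram n s)) T = (\<lambda>i. if i \<in> indices N n then T (i \<circ> s) else 0)"
proof -
  have "diagram_coeff (perm_diagram n s) i j = (if j = i \<circ> s then 1 else 0)"
    if "i \<in> indices N n" "j \<in> indices N n" for i j
  proof -
    have "(\<forall>e\<in>perm_diagram n s. \<forall>p\<in>e. \<forall>q\<in>e. vertex_label i j p = vertex_label i j q)
        \<longleftrightarrow> (\<forall>m\<in>{1..n}. i (s m) = j m)"
      unfolding perm_diagram_def ball_collect edge_labels by blast
    also have "\<dots> \<longleftrightarrow> j = i \<circ> s"
    proof
      assume *: "\<forall>m\<in>{1..n}. i (s m) = j m"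
      show "j = i \<circ> s"
      proof
        fix m
        show "j m = (i \<circ> s) m"
          using * index_undefined[OF that(2), of m] index_undefined[OF index_perm[OF assms that(1)], of m]
          by (cases "m \<in> {1..n}") auto
      qed
    qed auto
    finally show ?thesis by (simp add: diagram_coeff_def)
  qed
  then have "(\<Sum>j\<in>indices N n. diagram_coeff (perm_diagram n s) i j * T j)
      = (\<Sum>j\<in>indices N n. if j = i \<circ> s then T j else 0)" if "i \<in> indices N n" for i
    using that by (intro sum.cong refl) simp
  then have "(\<Sum>j\<in>indices N n. diagram_coeff (perm_diagram n s) i j * T j) = T (i \<circ> s)"
    if "i \<in> indices N n" for i
    using that index_perm[OF assms that] finite_indices[of N n] by simp
  then show ?thesis
    by (auto simp: act_basis[OF perm_diagram_in_diagrams[OF assms]])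
qed

text \<open>The bar of \<open>(k, l)\<close> is this contraction followed by the insertion of the
  invariant tensor, the sum of all u(a) \<otimes> u(a). The value does not depend on
  \<open>i k\<close> and \<open>i l\<close>, so the other slots keep their numbers.\<close>

definition contract :: "nat \<Rightarrow> nat \<Rightarrow> nat \<Rightarrow> tensor \<Rightarrow> tensor" where
  "contract N k l T = (\<lambda>i. \<Sum>a<N. T (i(k := a, l := a)))"

lemma act_bar_diagram:
  assumes "k \<in> {1..n}" "l \<in> {1..n}" "k \<noteq> l"
  shows "act N n (brauer_basis (bar_diagram n k l)) T =
    (\<lambda>i. if i \<in> indices N n \<and> i k = i l then contract N k l T i else 0)"
proof -
  have "(\<Sum>j\<in>indices N n. diagram_coeff (bar_diagram n k l) i j * T j)
      = (if i k = i l then contract N k l T i else 0)" if i: "i \<in> indices N n" for i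
  proof -
    let ?A = "{1..n} - {k, l}"
    have coeff: "diagram_coeff (bar_diagram n k l) i j =
        (if i k = i l \<and> j k = j l \<and> (\<forall>m\<in>?A. i m = j m) then 1 else 0)" for j
    proof -
      define P where "P e \<longleftrightarrow> (\<forall>p\<in>e. \<forall>q\<in>e. vertex_label i j p = vertex_label i j q)" for e
      have "(\<forall>e\<in>bar_diagram n k l. P e) \<longleftrightarrow> P {Inl k, Inl l} \<and> P {Inr k, Inr l} \<and> (\<forall>m\<in>?A. P {Inl m, Inr m})"
        unfolding bar_diagram_def ball_Un ball_collect by auto
      moreover have "P {Inl k, Inl l} \<longleftrightarrow> i k = i l" "P {Inr k, Inr l} \<longleftrightarrow> j k = j l"
        by (auto simp: P_def vertex_label_def)
      moreover have "P {Inl m, Inr m} \<longleftrightarrow> i m = j m" for m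
        unfolding P_def by (rule edge_labels)
      ultimately have "(\<forall>e\<in>bar_diagram n k l. \<forall>p\<in>e. \<forall>q\<in>e. vertex_label i j p = vertex_label i j q)
          \<longleftrightarrow> i k = i l \<and> j k = j l \<and> (\<forall>m\<in>?A. i m = j m)"
        unfolding P_def[symmetric] by (simp only:)
      then show ?thesis by (simp add: diagram_coeff_def)
    qed
    define w where "w j = (if \<forall>m\<in>?A. i m = j m then T j else 0)" for j
    have ri: "restrict i ?A \<in> ?A \<rightarrow>\<^sub>E {..<N}"
      using i by (auto simp: indices_def)
    have "(\<Sum>j\<in>indices N n. if j l = j k then w j else 0)
        = (\<Sum>j\<in>?A \<rightarrow>\<^sub>E {..<N}. \<Sum>a<N. w (j(k := a, l := a)))"
      unfolding indices_def by (rule sum_PiE_diagonal) (use assms in auto)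
    also have "\<dots> = (\<Sum>j\<in>?A \<rightarrow>\<^sub>E {..<N}. if j = restrict i ?A then contract N k l T i else 0)"
    proof (rule sum.cong[OF refl])
      fix j assume j: "j \<in> ?A \<rightarrow>\<^sub>E {..<N}"
      have "(\<forall>m\<in>?A. i m = (j(k := a, l := a)) m) \<longleftrightarrow> j = restrict i ?A" for a
      proof
        assume *: "\<forall>m\<in>?A. i m = (j(k := a, l := a)) m"
        show "j = restrict i ?A"
        proof
          fix m show "j m = restrict i ?A m"
            using * PiE_arb[OF j, of m] by (cases "m \<in> ?A") auto
        qed
      qed auto
      moreover have "(restrict i ?A)(k := a, l := a) = i(k := a, l := a)" for a
        using i assms by (auto simp: indices_def fun_eq_iff PiE_iff extensional_def)
      ultimately show "(\<Sum>a<N. w (j(k := a, l := a))) = (if j = restrict i ?A then contract N k l T i else 0)"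
        by (auto simp: w_def contract_def)
    qed
    also have "\<dots> = contract N k l T i"
      using ri by (simp add: finite_PiE)
    finally have *: "(\<Sum>j\<in>indices N n. if j l = j k then w j else 0) = contract N k l T i" .
    have "(\<Sum>j\<in>indices N n. diagram_coeff (bar_diagram n k l) i j * T j)
        = (\<Sum>j\<in>indices N n. if i k = i l then (if j l = j k then w j else 0) else 0)"
      by (intro sum.cong refl) (auto simp: coeff w_def)
    then show ?thesis using * by simp
  qed
  then show ?thesis
    by (auto simp: act_basis[OF bar_diagram_in_diagrams[OF assms]])
qed

text \<open>The coordinates of x_p without reference to the degree: only slots up to
  \<open>p\<close> are touched. The same formula therefore serves for a tensor and for its
  slices.\<close>

definition jm :: "nat \<Rightarrow> nat \<Rightarrow> tensor \<Rightarrow> tensor" where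
  "jm N p T = (\<lambda>i. (of_nat N - 1) / 2 * T i +
     (\<Sum>l\<in>{1..<p}. T (i \<circ> transpose p l) - (if i p = i l then contract N p l T i else 0)))"

lemma act_jucys_murphy:
  assumes "p \<in> {1..n}"
  shows "act N n (jucys_murphy N n p) T = (\<lambda>i. if i \<in> indices N n then jm N p T i else 0)"
proof
  fix i
  have l: "act N n (brauer_basis (perm_diagram n (transpose p l)) - brauer_basis (bar_diagram n p l)) T i
      = (if i \<in> indices N n then T (i \<circ> transpose p l) - (if i p = i l then contract N p l T i else 0) else 0)"
    if "l \<in> {1..<p}" for l
  proof -
    have "transpose p l permutes {1..n}" using assms that by (intro permutes_swap_id) auto
    then show ?thesis using assms that by (simp add: act_minus act_perm act_bar_diagram)
  qed
  have id: "act N n (brauer_basis (perm_diagram n id)) T i = (if i \<in> indices N n then T i else 0)"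
    by (subst act_perm) (auto simp: permutes_id)
  have "act N n (jucys_murphy N n p) T i
      = (of_nat N - 1) / 2 * act N n (brauer_basis (perm_diagram n id)) T i + (\<Sum>l\<in>{1..<p}.
        act N n (brauer_basis (perm_diagram n (transpose p l)) - brauer_basis (bar_diagram n p l)) T i)"
    unfolding jucys_murphy_def act_add act_scale act_sum plus_fun_apply sum_fun_apply by (simp only: scale_fun_def)
  also have "\<dots> = (of_nat N - 1) / 2 * (if i \<in> indices N n then T i else 0) + (\<Sum>l\<in>{1..<p}.
      if i \<in> indices N n then T (i \<circ> transpose p l) - (if i p = i l then contract N p l T i else 0) else 0)"
    by (intro arg_cong2[of _ _ _ _ "(+)"] sum.cong refl l) (simp only: id)
  also have "\<dots> = (if i \<in> indices N n then jm N p T i else 0)"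
    by (cases "i \<in> indices N n") (simp_all only: jm_def if_True if_False sum.neutral_const mult_zero_right add_0)
  finally show "act N n (jucys_murphy N n p) T i = (if i \<in> indices N n then jm N p T i else 0)" .
qed

text \<open>Conjugation by s_k turns \<open>(k, l)\<close> and its bar into
  \<open>(k + 1, l)\<close> and its bar for \<open>l < k\<close>. The remaining summand
  \<open>l = k\<close> of x_{k+1} consists of s_k and minus the bar \<open>b\<close>; multiplied by
  s_k they give 1 and \<open>- b\<close>, since \<open>b\<close> absorbs s_k.\<close>

lemma jm_simple_transposition:
  fixes k :: nat
  defines "\<tau> \<equiv> transpose k (k + 1)"
  assumes "k \<ge> 1"
  shows "jm N (k + 1) (\<lambda>i. T (i \<circ> \<tau>)) i
    = jm N k T (i \<circ> \<tau>) + T i - (if i k = i (k + 1) then contract N k (k + 1) T i else 0)"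
proof -
  have dom: "{1..<k + 1} = insert k {1..<k}" using assms(2) by auto
  have 1: "i \<circ> transpose (k + 1) l \<circ> \<tau> = i \<circ> \<tau> \<circ> transpose k l" if "l \<in> {1..<k}" for l
    using that by (auto simp: \<tau>_def fun_eq_iff Transposition.transpose_def)
  have 2: "(i(k + 1 := a, l := a)) \<circ> \<tau> = (i \<circ> \<tau>)(k := a, l := a)" if "l \<in> {1..<k}" for l a
    using that by (auto simp: \<tau>_def fun_eq_iff Transposition.transpose_def)
  have 3: "(i(k + 1 := a, k := a)) \<circ> \<tau> = i(k := a, k + 1 := a)" for a
    by (auto simp: \<tau>_def fun_eq_iff Transposition.transpose_def)
  have 4: "i \<circ> transpose (k + 1) k \<circ> \<tau> = i"
    by (auto simp: \<tau>_def fun_eq_iff Transposition.transpose_def)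
  have 5: "(i \<circ> \<tau>) k = i (k + 1)" "(i \<circ> \<tau>) l = i l" if "l \<in> {1..<k}" for l
    using that by (auto simp: \<tau>_def Transposition.transpose_def)
  define g where "g l = T (i \<circ> transpose (k + 1) l \<circ> \<tau>) -
      (if i (k + 1) = i l then contract N (k + 1) l (\<lambda>i. T (i \<circ> \<tau>)) i else 0)" for l
  have gk: "g k = T i - (if i k = i (k + 1) then contract N k (k + 1) T i else 0)"
    unfolding g_def 4 contract_def 3 eq_commute[of "i (k + 1)"] ..
  have g: "(\<Sum>l\<in>{1..<k}. g l) = (\<Sum>l\<in>{1..<k}. T (i \<circ> \<tau> \<circ> transpose k l) -
      (if (i \<circ> \<tau>) k = (i \<circ> \<tau>) l then contract N k l T (i \<circ> \<tau>) else 0))"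
    unfolding g_def by (intro sum.cong refl) (simp only: 1 5 contract_def 2)
  have "jm N (k + 1) (\<lambda>i. T (i \<circ> \<tau>)) i
      = (of_nat N - 1) / 2 * T (i \<circ> \<tau>) + (\<Sum>l\<in>insert k {1..<k}. g l)"
    unfolding jm_def dom g_def ..
  also have "(\<Sum>l\<in>insert k {1..<k}. g l) = g k + (\<Sum>l\<in>{1..<k}. g l)"
    by simp
  finally have "jm N (k + 1) (\<lambda>i. T (i \<circ> \<tau>)) i
      = (of_nat N - 1) / 2 * T (i \<circ> \<tau>) + (g k + (\<Sum>l\<in>{1..<k}. g l))" .
  moreover have "c + (t - y + s) = c + s + t - y" for c s t y :: complex by simp
  ultimately show ?thesis unfolding gk g jm_def[of N k] by (simp only:)
qed

text \<open>After contraction of the slots \<open>k\<close> and \<open>k + 1\<close> the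
  transposition \<open>(k, l)\<close> equals the bar of \<open>(k + 1, l)\<close>, and likewise with
  \<open>k\<close> and \<open>k + 1\<close> exchanged, so all terms with \<open>l < k\<close>
  cancel. There remain N - 1 from the two constants, 1 from s_k, and -N from the bar of
  \<open>(k, k + 1)\<close>, whose square is N times itself.\<close>

lemma contract_jm:
  assumes "i \<in> indices N n" "1 \<le> k" "k + 1 \<le> n"
  shows "contract N k (k + 1) (\<lambda>i. jm N k T i + jm N (k + 1) T i) i = 0"
proof -
  define u where "u a = i(k := a, k + 1 := a)" for a
  define c where "c = (\<Sum>a<N. T (u a))"
  have dom: "{1..<k + 1} = insert k {1..<k}" using assms(2) by auto
  have cancel: "(\<Sum>a<N. T (u a \<circ> transpose p l)) = (\<Sum>a<N. if u a q = u a l then contract N q l T (u a) else 0)"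
    (is "_ = ?r") if l: "l \<in> {1..<k}" and pq: "p = k \<and> q = k + 1 \<or> p = k + 1 \<and> q = k" for l p q
  proof -
    have "?r = (\<Sum>a<N. if a = i l then contract N q l T (u (i l)) else 0)"
      using l pq by (intro sum.cong refl) (auto simp: u_def)
    also have "\<dots> = contract N q l T (u (i l))"
      using index_less[OF assms(1), of l] l assms by simp
    also have "\<dots> = (\<Sum>a<N. T (u a \<circ> transpose p l))"
      unfolding contract_def
      by (intro sum.cong refl arg_cong[of _ _ T])
        (use l pq in \<open>auto simp: u_def fun_eq_iff Transposition.transpose_def\<close>)
    finally show ?thesis by simp
  qed
  have e1: "(\<Sum>l\<in>{1..<k}. \<Sum>a<N. T (u a \<circ> transpose k l)) = (\<Sum>l\<in>{1..<k}.
      \<Sum>a<N. if u a (k + 1) = u a l then contract N (k + 1) l T (u a) else 0)"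
    by (intro sum.cong refl cancel) auto
  have e2: "(\<Sum>l\<in>{1..<k}. \<Sum>a<N. T (u a \<circ> transpose (k + 1) l)) = (\<Sum>l\<in>{1..<k}.
      \<Sum>a<N. if u a k = u a l then contract N k l T (u a) else 0)"
    by (intro sum.cong refl cancel) auto
  have 3: "(\<Sum>a<N. T (u a \<circ> transpose (k + 1) k)) = c"
    unfolding c_def by (intro sum.cong refl arg_cong[of _ _ T]) (auto simp: u_def fun_eq_iff Transposition.transpose_def)
  have 4: "(\<Sum>a<N. if u a (k + 1) = u a k then contract N (k + 1) k T (u a) else 0) = of_nat N * c"
  proof -
    have "contract N (k + 1) k T (u a) = c" for a
      unfolding contract_def c_def
      by (intro sum.cong refl arg_cong[of _ _ T]) (auto simp: u_def fun_eq_iff)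
    then show ?thesis by (simp add: u_def)
  qed
  have "contract N k (k + 1) (\<lambda>i. jm N k T i + jm N (k + 1) T i) i
      = (\<Sum>a<N. jm N k T (u a)) + (\<Sum>a<N. jm N (k + 1) T (u a))"
    by (simp add: contract_def u_def sum.distrib)
  also have "(\<Sum>a<N. jm N k T (u a)) = (of_nat N - 1) / 2 * c +
      (\<Sum>l\<in>{1..<k}. (\<Sum>a<N. T (u a \<circ> transpose k l)) - (\<Sum>a<N. if u a k = u a l then contract N k l T (u a) else 0))"
    unfolding jm_def sum.distrib sum_subtractf c_def sum_distrib_left
    by (simp add: sum.swap[of _ "{..<N}"])
  also have "(\<Sum>a<N. jm N (k + 1) T (u a)) = (of_nat N - 1) / 2 * c +
      (\<Sum>l\<in>{1..<k + 1}. (\<Sum>a<N. T (u a \<circ> transpose (k + 1) l)) -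
        (\<Sum>a<N. if u a (k + 1) = u a l then contract N (k + 1) l T (u a) else 0))"
    unfolding jm_def sum.distrib sum_subtractf c_def sum_distrib_left
    by (simp add: sum.swap[of _ "{..<N}"])
  also have "(\<Sum>l\<in>{1..<k + 1}. (\<Sum>a<N. T (u a \<circ> transpose (k + 1) l)) -
        (\<Sum>a<N. if u a (k + 1) = u a l then contract N (k + 1) l T (u a) else 0))
      = c - of_nat N * c + (\<Sum>l\<in>{1..<k}. (\<Sum>a<N. T (u a \<circ> transpose (k + 1) l)) -
        (\<Sum>a<N. if u a (k + 1) = u a l then contract N (k + 1) l T (u a) else 0))"
    unfolding dom using 3 4 by (subst sum.insert) auto
  finally show ?thesis
    unfolding sum_subtractf e1 e2 by (simp add: field_simps)
qed

text \<open>The tensor in the first \<open>k\<close> factors that remains when the later indices are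
  frozen as in \<open>i\<close>. These are exactly the tensors to which \<open>embed\<close> applies
  its operator.\<close>

definition slice :: "nat \<Rightarrow> nat \<Rightarrow> tensor \<Rightarrow> (nat \<Rightarrow> nat) \<Rightarrow> tensor" where
  "slice N k T i = (\<lambda>j. if j \<in> indices N k then T (glue k j i) else 0)"

lemma slice_in_tensors: "slice N k T i \<in> tensors N k"
  by (simp add: slice_def tensors_def)

lemma index_restrict: "i \<in> indices N n \<Longrightarrow> k \<le> n \<Longrightarrow> restrict i {1..k} \<in> indices N k"
  by (auto simp: indices_def)

lemma slice_restrict:
  assumes "i \<in> indices N n" "k \<le> n"
  shows "slice N k T i (restrict i {1..k}) = T i"
proof -
  have "glue k (restrict i {1..k}) i = i"
  proof
    fix m
    show "glue k (restrict i {1..k}) i m = i m"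
      using index_undefined[OF assms(1), of 0] by (cases m) (auto simp: glue_def)
  qed
  then show ?thesis using index_restrict[OF assms] by (simp add: slice_def)
qed

lemma jm_slice:
  assumes i: "i \<in> indices N n" and p: "1 \<le> p" "p \<le> k" and k: "k \<le> n"
  shows "jm N p (slice N k T i) (restrict i {1..k}) = jm N p T i"
proof -
  let ?r = "restrict i {1..k}"
  have r: "?r \<in> indices N k" using index_restrict[OF i k] .
  \<comment> \<open>\<open>glue\<close> takes the index 0 from the degree \<open>k\<close> side,
    where it is \<open>undefined\<close>; \<open>i\<close> has to agree with it there.\<close>
  have 0: "i x = undefined" if "\<not> Suc 0 \<le> x" for x using index_undefined[OF i, of x] that by simp
  have perm: "slice N k T i (?r \<circ> transpose p l) = T (i \<circ> transpose p l)" if l: "l \<in> {1..<p}" for l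
  proof -
    have "?r \<circ> transpose p l \<in> indices N k"
      by (rule index_perm[OF _ r]) (use l p in \<open>auto intro!: permutes_swap_id\<close>)
    moreover have "glue k (?r \<circ> transpose p l) i = i \<circ> transpose p l"
      using l p 0 by (auto simp: glue_def fun_eq_iff Transposition.transpose_def)
    ultimately show ?thesis by (simp add: slice_def)
  qed
  have upd: "slice N k T i (?r(p := a, l := a)) = T (i(p := a, l := a))"
    if l: "l \<in> {1..<p}" and a: "a < N" for l a
  proof -
    have "?r(p := a, l := a) \<in> indices N k"
      by (rule index_upd2[OF r]) (use l p a in auto)
    moreover have "glue k (?r(p := a, l := a)) i = i(p := a, l := a)"
      using l p 0 by (auto simp: glue_def fun_eq_iff)
    ultimately show ?thesis by (simp add: slice_def)
  qed
  have "?r p = i p" "\<And>l. l \<in> {1..<p} \<Longrightarrow> ?r l = i l" using p by auto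
  then show ?thesis
    unfolding jm_def slice_restrict[OF i k]
    by (intro arg_cong2[of _ _ _ _ "(+)"] refl sum.cong)
      (simp add: perm upd contract_def del: One_nat_def atLeastLessThan_iff)
qed

section \<open>The orthogonal group and orthogonal projections\<close>

lemma group_act_apply:
  "i \<in> indices N n \<Longrightarrow> group_act N n g T i = (\<Sum>j\<in>indices N n. (\<Prod>m\<in>{1..n}. g $$ (i m, j m)) * T j)"
  by (simp add: group_act_def)

lemma group_act_in_tensors: "group_act N n g T \<in> tensors N n"
  by (simp add: group_act_def tensors_def)

lemma group_act_add: "group_act N n g (S + T) = group_act N n g S + group_act N n g T"
  by (auto simp: group_act_def fun_eq_iff distrib_left sum.distrib)

lemma group_act_scale: "group_act N n g (scale_fun c T) = scale_fun c (group_act N n g T)"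
  by (auto simp: group_act_def scale_fun_def fun_eq_iff sum_distrib_left mult_ac)

lemma group_act_minus: "group_act N n g (S - T) = group_act N n g S - group_act N n g T"
  by (auto simp: group_act_def fun_eq_iff right_diff_distrib sum_subtractf)

lemma act_linear: "act N n a (S + T) = act N n a S + act N n a T"
  "act N n a (scale_fun c T) = scale_fun c (act N n a T)"
  by (auto simp: act_def scale_fun_def fun_eq_iff distrib_left sum.distrib sum_distrib_left mult_ac)

lemma act_in_tensors: "act N n a T \<in> tensors N n"
  by (simp add: act_def tensors_def)

lemma tensors_eqI:
  "S \<in> tensors N n \<Longrightarrow> T \<in> tensors N n \<Longrightarrow> (\<And>i. i \<in> indices N n \<Longrightarrow> S i = T i) \<Longrightarrow> S = T"
  by (force simp: tensors_def fun_eq_iff)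

lemma subspace_tensors: "funs.subspace (tensors N n)"
  by (auto simp: funs.subspace_def tensors_def scale_fun_def)

lemma sum_indices_perm:
  assumes "s permutes {1..n}"
  shows "(\<Sum>j\<in>indices N n. f (j \<circ> s)) = (\<Sum>j\<in>indices N n. f j)"
proof (rule sum.reindex_bij_witness[where i = "\<lambda>j. j \<circ> inv_into UNIV s" and j = "\<lambda>j. j \<circ> s"])
  show "j \<circ> s \<circ> inv_into UNIV s = j" "j \<circ> inv_into UNIV s \<circ> s = j" for j :: "nat \<Rightarrow> nat"
    using permutes_inv_o[OF assms] by (simp_all add: comp_assoc)
qed (use index_perm[OF assms] index_perm[OF permutes_inv[OF assms]] in auto)

lemma group_act_perm:
  assumes s: "s permutes {1..n}"
  shows "group_act N n g (act N n (brauer_basis (perm_diagram n s)) T)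
    = act N n (brauer_basis (perm_diagram n s)) (group_act N n g T)"
proof (rule tensors_eqI[OF group_act_in_tensors act_in_tensors])
  fix i assume i: "i \<in> indices N n"
  have "group_act N n g (act N n (brauer_basis (perm_diagram n s)) T) i
      = (\<Sum>j\<in>indices N n. (\<Prod>m\<in>{1..n}. g $$ (i (s m), (j \<circ> s) m)) * T (j \<circ> s))"
    unfolding group_act_apply[OF i]
  proof (rule sum.cong[OF refl])
    fix j assume j: "j \<in> indices N n"
    have "(\<Prod>m\<in>{1..n}. g $$ (i m, j m)) = (\<Prod>m\<in>{1..n}. g $$ (i (s m), (j \<circ> s) m))"
      using prod.permute[OF s, of "\<lambda>m. g $$ (i m, j m)"] by (simp add: comp_def)
    then show "(\<Prod>m\<in>{1..n}. g $$ (i m, j m)) * act N n (brauer_basis (perm_diagram n s)) T j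
        = (\<Prod>m\<in>{1..n}. g $$ (i (s m), (j \<circ> s) m)) * T (j \<circ> s)"
      using j by (simp add: act_perm[OF s])
  qed
  also have "\<dots> = (\<Sum>j\<in>indices N n. (\<Prod>m\<in>{1..n}. g $$ (i (s m), j m)) * T j)"
    by (rule sum_indices_perm[OF s])
  also have "\<dots> = act N n (brauer_basis (perm_diagram n s)) (group_act N n g T) i"
    using i index_perm[OF s i] by (simp add: act_perm[OF s] group_act_apply)
  finally show "group_act N n g (act N n (brauer_basis (perm_diagram n s)) T) i
    = act N n (brauer_basis (perm_diagram n s)) (group_act N n g T) i" .
qed

lemma orth_group_rows:
  assumes "g \<in> orth_group N" "a < N" "b < N"
  shows "(\<Sum>c<N. g $$ (a, c) * g $$ (b, c)) = of_bool (a = b)"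
proof -
  have g: "g \<in> carrier_mat N N" "g * g\<^sup>T = 1\<^sub>m N" using assms(1) by (auto simp: orth_group_def)
  have "(g * g\<^sup>T) $$ (a, b) = (\<Sum>c<N. g $$ (a, c) * g $$ (b, c))"
    using g(1) assms by (simp add: scalar_prod_def atLeast0LessThan)
  moreover have "(g * g\<^sup>T) $$ (a, b) = of_bool (a = b)" unfolding g(2) using assms by simp
  ultimately show ?thesis by simp
qed

lemma orth_group_transpose: "g \<in> orth_group N \<Longrightarrow> g\<^sup>T \<in> orth_group N"
  unfolding orth_group_def
  by (auto intro: mat_mult_left_right_inverse)

lemma orth_group_columns:
  assumes "g \<in> orth_group N" "a < N" "b < N"
  shows "(\<Sum>c<N. g $$ (c, a) * g $$ (c, b)) = of_bool (a = b)"
proof -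
  have "g \<in> carrier_mat N N" using assms(1) by (simp add: orth_group_def)
  then show ?thesis using orth_group_rows[OF orth_group_transpose[OF assms(1)] assms(2,3)] assms(2,3) by simp
qed

text \<open>Complex orthogonal matrices need not preserve the Hermitian form. Stability of
  orthogonal complements rests instead on the group being closed under conjugate
  transposition.\<close>

definition adj :: "nat \<Rightarrow> complex mat \<Rightarrow> complex mat" where
  "adj N g = mat N N (\<lambda>(a, b). cnj (g $$ (b, a)))"

lemma adj_in_orth_group:
  assumes "g \<in> orth_group N"
  shows "adj N g \<in> orth_group N"
proof -
  have "(\<Sum>c<N. cnj (g $$ (c, a)) * cnj (g $$ (c, b))) = of_bool (a = b)" if "a < N" "b < N" for a b
    using arg_cong[OF orth_group_columns[OF assms that], of cnj] by simp
  then have "adj N g * (adj N g)\<^sup>T = 1\<^sub>m N"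
    by (intro eq_matI) (auto simp: adj_def scalar_prod_def atLeast0LessThan)
  then show ?thesis by (simp add: orth_group_def adj_def)
qed

lemma orth_mat_in_orth_group:
  assumes "orth_mat N h"
  shows "mat N N (\<lambda>(a, b). complex_of_real (h a b)) \<in> orth_group N"
proof -
  have "(\<Sum>c<N. complex_of_real (h a c) * complex_of_real (h b c)) = of_bool (a = b)"
    if "a < N" "b < N" for a b
  proof -
    have "(\<Sum>c<N. complex_of_real (h a c) * complex_of_real (h b c)) = of_real (\<Sum>c<N. h a c * h b c)"
      by simp
    then show ?thesis using assms that by (simp only: orth_mat_def) simp
  qed
  then have "mat N N (\<lambda>(a, b). complex_of_real (h a b)) * (mat N N (\<lambda>(a, b). complex_of_real (h a b)))\<^sup>T = 1\<^sub>m N"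
    by (intro eq_matI) (auto simp: scalar_prod_def atLeast0LessThan)
  then show ?thesis by (simp add: orth_group_def)
qed

text \<open>Orthonormality of the columns of \<open>g\<close> cancels its action on the two
  contracted slots. Only the filled-up indices have to be of degree \<open>n\<close>, so
  \<open>i\<close> itself may be an index of degree \<open>n - 2\<close>, as for the contraction of
  the last two factors.\<close>

lemma contract_group_act:
  assumes g: "g \<in> orth_group N" and st: "s \<in> {1..n}" "t \<in> {1..n}" "s \<noteq> t"
    and i: "\<And>a. a < N \<Longrightarrow> i(s := a, t := a) \<in> indices N n"
  shows "contract N s t (group_act N n g T) i = (\<Sum>j\<in>{1..n} - {s, t} \<rightarrow>\<^sub>E {..<N}.
    (\<Prod>r\<in>{1..n} - {s, t}. g $$ (i r, j r)) * contract N s t T j)"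
proof -
  let ?A = "{1..n} - {s, t}"
  define w where "w j = (\<Prod>r\<in>?A. g $$ (i r, j r)) * T j" for j
  have split: "(\<Prod>m\<in>{1..n}. f m) = f s * (f t * (\<Prod>m\<in>?A. f m))" for f :: "nat \<Rightarrow> complex"
  proof -
    have "(\<Prod>m\<in>{1..n}. f m) = f s * (\<Prod>m\<in>{1..n} - {s}. f m)"
      by (rule prod.remove) (use st in auto)
    also have "(\<Prod>m\<in>{1..n} - {s}. f m) = f t * (\<Prod>m\<in>{1..n} - {s} - {t}. f m)"
      by (rule prod.remove) (use st in auto)
    also have "{1..n} - {s} - {t} = ?A" by auto
    finally show ?thesis .
  qed
  have "contract N s t (group_act N n g T) i
      = (\<Sum>a<N. \<Sum>j\<in>indices N n. (\<Prod>m\<in>{1..n}. g $$ ((i(s := a, t := a)) m, j m)) * T j)"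
    unfolding contract_def by (intro sum.cong refl group_act_apply i) simp
  also have "\<dots> = (\<Sum>a<N. \<Sum>j\<in>indices N n. g $$ (a, j s) * g $$ (a, j t) * w j)"
  proof (intro sum.cong refl)
    fix a j
    have "(\<Prod>m\<in>?A. g $$ ((i(s := a, t := a)) m, j m)) = (\<Prod>m\<in>?A. g $$ (i m, j m))"
      by (rule prod.cong) auto
    then show "(\<Prod>m\<in>{1..n}. g $$ ((i(s := a, t := a)) m, j m)) * T j = g $$ (a, j s) * g $$ (a, j t) * w j"
      unfolding split w_def using st by simp
  qed
  also have "\<dots> = (\<Sum>j\<in>indices N n. (\<Sum>a<N. g $$ (a, j s) * g $$ (a, j t)) * w j)"
    unfolding sum_distrib_right by (rule sum.swap)
  also have "\<dots> = (\<Sum>j\<in>indices N n. if j t = j s then w j else 0)"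
    using orth_group_columns[OF g] index_less st by (intro sum.cong refl) auto
  also have "\<dots> = (\<Sum>j\<in>?A \<rightarrow>\<^sub>E {..<N}. \<Sum>a<N. w (j(s := a, t := a)))"
    unfolding indices_def by (rule sum_PiE_diagonal) (use st in auto)
  also have "\<dots> = (\<Sum>j\<in>?A \<rightarrow>\<^sub>E {..<N}. (\<Prod>r\<in>?A. g $$ (i r, j r)) * contract N s t T j)"
  proof (intro sum.cong refl)
    fix j
    have "(\<Prod>r\<in>?A. g $$ (i r, (j(s := a, t := a)) r)) = (\<Prod>r\<in>?A. g $$ (i r, j r))" for a
      by (rule prod.cong) auto
    then show "(\<Sum>a<N. w (j(s := a, t := a))) = (\<Prod>r\<in>?A. g $$ (i r, j r)) * contract N s t T j"
      by (simp add: w_def contract_def sum_distrib_left)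
  qed
  finally show ?thesis .
qed

section \<open>The Hermitian form and orthogonal projections\<close>

definition herm :: "nat \<Rightarrow> nat \<Rightarrow> tensor \<Rightarrow> tensor \<Rightarrow> complex" where
  "herm N n S T = (\<Sum>i\<in>indices N n. cnj (S i) * T i)"

lemma herm_add_left: "herm N n (R + S) T = herm N n R T + herm N n S T"
  and herm_add_right: "herm N n R (S + T) = herm N n R S + herm N n R T"
  and herm_minus_right: "herm N n R (S - T) = herm N n R S - herm N n R T"
  and herm_scale_left: "herm N n (scale_fun c R) S = cnj c * herm N n R S"
  and herm_scale_right: "herm N n R (scale_fun c S) = c * herm N n R S"
  by (simp_all add: herm_def scale_fun_def algebra_simps sum.distrib sum_subtractf sum_distrib_left)

lemma herm_commute: "herm N n S T = cnj (herm N n T S)"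
  by (simp add: herm_def mult.commute)

lemma herm_self_zero:
  assumes "herm N n T T = 0" "T \<in> tensors N n"
  shows "T = 0"
proof -
  have "herm N n T T = of_real (\<Sum>i\<in>indices N n. (cmod (T i))\<^sup>2)"
    by (simp add: herm_def complex_norm_square mult.commute del: of_real_power)
  then have "(\<Sum>i\<in>indices N n. (cmod (T i))\<^sup>2) = 0" using assms(1) of_real_eq_0_iff by metis
  then have "\<forall>i\<in>indices N n. (cmod (T i))\<^sup>2 = 0"
    by (subst (asm) sum_nonneg_eq_0_iff) (auto simp: finite_indices)
  then show ?thesis using assms(2) by (auto simp: tensors_def fun_eq_iff)
qed

lemma herm_group_act:
  assumes "g \<in> orth_group N"
  shows "herm N n S (group_act N n g T) = herm N n (group_act N n (adj N g) S) T"
proof -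
  have "herm N n S (group_act N n g T)
      = (\<Sum>i\<in>indices N n. \<Sum>j\<in>indices N n. cnj (S i) * (\<Prod>m\<in>{1..n}. g $$ (i m, j m)) * T j)"
    by (simp add: herm_def group_act_apply sum_distrib_left mult.assoc)
  also have "\<dots> = (\<Sum>j\<in>indices N n. \<Sum>i\<in>indices N n. cnj (S i) * (\<Prod>m\<in>{1..n}. g $$ (i m, j m)) * T j)"
    by (rule sum.swap)
  also have "\<dots> = (\<Sum>j\<in>indices N n. cnj (group_act N n (adj N g) S j) * T j)"
  proof (rule sum.cong[OF refl])
    fix j assume j: "j \<in> indices N n"
    have "(\<Prod>m\<in>{1..n}. adj N g $$ (j m, i m)) = cnj (\<Prod>m\<in>{1..n}. g $$ (i m, j m))"
      if i: "i \<in> indices N n" for i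
      unfolding cnj_prod by (intro prod.cong refl) (use i j in \<open>auto simp: adj_def index_less\<close>)
    then show "(\<Sum>i\<in>indices N n. cnj (S i) * (\<Prod>m\<in>{1..n}. g $$ (i m, j m)) * T j)
        = cnj (group_act N n (adj N g) S j) * T j"
      using j by (simp add: group_act_apply sum_distrib_right sum_distrib_left mult_ac)
  qed
  finally show ?thesis by (simp add: herm_def)
qed

lemma sum_unit_tensor:
  assumes "T \<in> tensors N n"
  shows "T = (\<Sum>j\<in>indices N n. scale_fun (T j) (unit_tensor j))"
proof
  fix i
  have "(\<Sum>j\<in>indices N n. scale_fun (T j) (unit_tensor j)) i = (\<Sum>j\<in>indices N n. if j = i then T i else 0)"
    unfolding sum_fun_apply by (intro sum.cong refl) (auto simp: scale_fun_def unit_tensor_def)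
  also have "\<dots> = T i" using assms finite_indices[of N n] by (auto simp: tensors_def)
  finally show "T i = (\<Sum>j\<in>indices N n. scale_fun (T j) (unit_tensor j)) i" by simp
qed

text \<open>The projection is linear on all functions, which is consistent because
  \<open>herm\<close> reads only the coordinates in \<open>indices\<close>. Being total, it extends
  a linear map given on \<open>W\<close> to all tensors.\<close>

definition is_projection :: "nat \<Rightarrow> nat \<Rightarrow> tensor set \<Rightarrow> (tensor \<Rightarrow> tensor) \<Rightarrow> bool" where
  "is_projection N n W p \<longleftrightarrow> (\<forall>T. p T \<in> W) \<and> (\<forall>S T. p (S + T) = p S + p T) \<and>
     (\<forall>c T. p (scale_fun c T) = scale_fun c (p T)) \<and> (\<forall>T. \<forall>w\<in>W. herm N n w (T - p T) = 0)"

text \<open>One Gram-Schmidt step adds the component along \<open>e = b - p b\<close>. If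
  \<open>b\<close> already lies in the span, then \<open>e\<close> is 0 and so is the added
  term.\<close>

lemma exists_projection_span:
  assumes "finite B" "B \<subseteq> tensors N n"
  shows "\<exists>p. is_projection N n (funs.span B) p"
  using assms
proof (induction B)
  case empty
  have "is_projection N n (funs.span {}) (\<lambda>_. 0)"
    by (auto simp: is_projection_def herm_def scale_fun_def fun_eq_iff)
  then show ?case by blast
next
  case (insert b B)
  then obtain p where p: "is_projection N n (funs.span B) p" by auto
  have pin: "p T \<in> funs.span B" and padd: "p (S + T) = p S + p T"
    and pscale: "p (scale_fun c T) = scale_fun c (p T)"
    and port: "w \<in> funs.span B \<Longrightarrow> herm N n w (T - p T) = 0" for S T c w
    using p by (auto simp: is_projection_def)
  have sub: "funs.span B \<subseteq> funs.span (insert b B)" by (rule funs.span_mono) auto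
  have tens: "funs.span (insert b B) \<subseteq> tensors N n"
    by (rule funs.span_minimal[OF insert.prems subspace_tensors])
  define e where "e = b - p b"
  have e: "e \<in> funs.span (insert b B)"
    unfolding e_def by (rule funs.span_diff[OF funs.span_base subsetD[OF sub pin]]) simp
  define q where "q T = p T + scale_fun (herm N n e T / herm N n e e) e" for T
  have orth_e: "herm N n w e = 0" if "w \<in> funs.span B" for w
    unfolding e_def by (rule port[OF that])
  have ee: "herm N n e (scale_fun (herm N n e T / herm N n e e) e) = herm N n e T" for T
  proof (cases "herm N n e e = 0")
    case True
    then have "e = 0" using herm_self_zero e tens by blast
    then show ?thesis by (simp add: herm_def scale_fun_def)
  qed (simp add: herm_scale_right)
  have "herm N n w (T - q T) = 0" if w: "w \<in> funs.span (insert b B)" for w T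
  proof -
    obtain c where c: "w - scale_fun c b \<in> funs.span B"
      using w by (auto simp: funs.span_insert)
    define w' where "w' = (w - scale_fun c b) + scale_fun c (p b)"
    have w': "w' \<in> funs.span B"
      unfolding w'_def using c pin by (intro funs.span_add funs.span_scale) auto
    have weq: "w = w' + scale_fun c e"
      by (auto simp: w'_def e_def scale_fun_def fun_eq_iff algebra_simps)
    have pe: "herm N n e (p T) = 0"
      using orth_e[OF pin, of T] herm_commute[of N n e "p T"] by simp
    have "herm N n w' (T - q T) = 0"
      using port[OF w', of T] orth_e[OF w']
      by (simp add: q_def herm_minus_right herm_add_right herm_scale_right)
    moreover have "herm N n e (T - q T) = 0"
      using pe ee[of T] by (simp add: q_def herm_minus_right herm_add_right)
    ultimately show ?thesis by (simp add: weq herm_add_left herm_scale_left)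
  qed
  moreover have "q T \<in> funs.span (insert b B)" for T
    unfolding q_def using pin[of T] sub e by (intro funs.span_add funs.span_scale) auto
  moreover have "q (S + T) = q S + q T" for S T
    by (auto simp: q_def padd herm_add_right scale_fun_def fun_eq_iff algebra_simps add_divide_distrib)
  moreover have "q (scale_fun c T) = scale_fun c (q T)" for c T
    by (auto simp: q_def pscale herm_scale_right) (auto simp: scale_fun_def fun_eq_iff algebra_simps)
  ultimately show ?case unfolding is_projection_def by blast
qed

lemma exists_projection:
  assumes "funs.subspace W" "W \<subseteq> tensors N n"
  shows "\<exists>p. is_projection N n W p"
proof -
  obtain B where B: "B \<subseteq> W" "funs.independent B" "W \<subseteq> funs.span B"
    using funs.maximal_independent_subset[of W] by blast
  have "tensors N n \<subseteq> funs.span (unit_tensor ` indices N n)"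
  proof
    fix T assume "T \<in> tensors N n"
    from sum_unit_tensor[OF this] show "T \<in> funs.span (unit_tensor ` indices N n)"
      by (metis (mono_tags, lifting) funs.span_base funs.span_scale funs.span_sum image_eqI)
  qed
  then have "finite B"
    using funs.independent_span_bound[of "unit_tensor ` indices N n" B] B assms(2) finite_indices[of N n] by auto
  moreover have "funs.span B = W" using B assms(1) by (simp add: funs.span_minimal subset_antisym)
  ultimately show ?thesis using exists_projection_span[of B N n] B(1) assms(2) by auto
qed

lemma projection_unique:
  assumes "is_projection N n W p" "funs.subspace W" "W \<subseteq> tensors N n"
    and "w \<in> W" "\<And>u. u \<in> W \<Longrightarrow> herm N n u (T - w) = 0"
  shows "p T = w"
proof -
  have pT: "p T \<in> W" using assms(1) by (simp add: is_projection_def)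
  then have d: "p T - w \<in> W" using assms(2,4) by (simp add: funs.subspace_diff)
  have "herm N n (p T - w) (p T - w) = herm N n (p T - w) (T - w) - herm N n (p T - w) (T - p T)"
    by (simp add: herm_minus_right)
  also have "\<dots> = 0" using assms(1,5) d by (simp add: is_projection_def)
  finally have "p T - w = 0" using herm_self_zero d assms(3) by blast
  then show ?thesis by simp
qed

lemma projection_id:
  assumes "is_projection N n W p" "funs.subspace W" "W \<subseteq> tensors N n" "w \<in> W"
  shows "p w = w"
  using assms by (intro projection_unique[OF assms]) (simp add: herm_def)

definition G_stable :: "nat \<Rightarrow> nat \<Rightarrow> tensor set \<Rightarrow> bool" where
  "G_stable N n W \<longleftrightarrow> funs.subspace W \<and> W \<subseteq> tensors N n \<and>
     (\<forall>g\<in>orth_group N. \<forall>T\<in>W. group_act N n g T \<in> W)"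

lemma G_stableD:
  assumes "G_stable N n W"
  shows "funs.subspace W" "W \<subseteq> tensors N n" "g \<in> orth_group N \<Longrightarrow> T \<in> W \<Longrightarrow> group_act N n g T \<in> W"
  using assms by (auto simp: G_stable_def)

text \<open>Moved to the other side of \<open>herm\<close> as its adjoint, \<open>g\<close> keeps
  the test vector in \<open>W\<close>. So the image of \<open>p T\<close> under \<open>g\<close>
  satisfies the conditions that determine the projection.\<close>

lemma projection_equivariant:
  assumes p: "is_projection N n W p" and W: "G_stable N n W" and g: "g \<in> orth_group N"
  shows "p (group_act N n g T) = group_act N n g (p T)"
proof (rule projection_unique[OF p G_stableD(1,2)[OF W]])
  show "group_act N n g (p T) \<in> W"
    using p by (intro G_stableD(3)[OF W g]) (simp add: is_projection_def)
  fix u assume "u \<in> W"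
  then have "herm N n (group_act N n (adj N g) u) (T - p T) = 0"
    using p G_stableD(3)[OF W adj_in_orth_group[OF g]] by (simp add: is_projection_def)
  then show "herm N n u (group_act N n g T - group_act N n g (p T)) = 0"
    using herm_group_act[OF g, of n u "T - p T"] by (simp add: group_act_minus)
qed

lemma projection_sum:
  assumes "is_projection N n W p"
  shows "p (\<Sum>x\<in>A. f x) = (\<Sum>x\<in>A. p (f x))"
  by (rule Modules.additive.sum[of p]) (rule Modules.additive.intro, use assms in \<open>simp only: is_projection_def\<close>)

lemma sum_additive_on:
  fixes f :: "tensor \<Rightarrow> 'b::ab_group_add"
  assumes W: "funs.subspace W" and add: "\<And>S T. S \<in> W \<Longrightarrow> T \<in> W \<Longrightarrow> f (S + T) = f S + f T"
    and "\<And>j. j \<in> J \<Longrightarrow> h j \<in> W"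
  shows "f (\<Sum>j\<in>J. h j) = (\<Sum>j\<in>J. f (h j))"
proof -
  have "f 0 = 0" using add[of 0 0] funs.subspace_0[OF W] by simp
  then show ?thesis
    using assms(3)
  proof (induction J rule: infinite_finite_induct)
    case (insert j J)
    have "(\<Sum>j\<in>J. h j) \<in> W" by (rule funs.subspace_sum[OF W]) (use insert.prems in auto)
    then show ?case
      unfolding sum.insert[OF insert.hyps] using add insert by (metis insertCI)
  next
    case (infinite J)
    then show ?case unfolding sum.infinite[OF infinite(1)] by blast
  qed (simp only: sum.empty)
qed

section \<open>Traceless tensors of different degrees\<close>

lemma contract_fun_upd: "k \<noteq> l \<Longrightarrow> contract N k l T (i(l := a)) = contract N k l T i"
  by (auto simp: contract_def fun_upd_twist)

text \<open>The bar shows contractions only at indices with \<open>i k = i l\<close>. As a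
  contraction does not depend on \<open>i l\<close>, this loses no information.\<close>

lemma traceless_iff:
  "T \<in> traceless N m \<longleftrightarrow> T \<in> tensors N m \<and>
    (\<forall>k\<in>{1..m}. \<forall>l\<in>{1..m}. k \<noteq> l \<longrightarrow> (\<forall>i\<in>indices N m. contract N k l T i = 0))"
proof -
  have "act N m (brauer_basis (bar_diagram m k l)) T = 0 \<longleftrightarrow> (\<forall>i\<in>indices N m. contract N k l T i = 0)"
    if kl: "k \<in> {1..m}" "l \<in> {1..m}" "k \<noteq> l" for k l
  proof
    assume *: "act N m (brauer_basis (bar_diagram m k l)) T = 0"
    show "\<forall>i\<in>indices N m. contract N k l T i = 0"
    proof
      fix i assume i: "i \<in> indices N m"
      have "i(l := i k) \<in> indices N m" using index_upd[OF i kl(2)] index_less[OF i kl(1)] by blast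
      then have "contract N k l T (i(l := i k)) = 0"
        using fun_cong[OF *, of "i(l := i k)"] kl by (simp add: act_bar_diagram[OF kl])
      then show "contract N k l T i = 0" by (simp add: contract_fun_upd[OF kl(3)])
    qed
  next
    assume "\<forall>i\<in>indices N m. contract N k l T i = 0"
    then show "act N m (brauer_basis (bar_diagram m k l)) T = 0"
      by (auto simp: act_bar_diagram[OF kl] fun_eq_iff)
  qed
  then show ?thesis unfolding traceless_def by auto
qed

lemma G_stable_traceless: "G_stable N m (traceless N m)"
  unfolding G_stable_def
proof (intro conjI ballI)
  have eq: "traceless N m = {T. T \<in> tensors N m \<and>
      (\<forall>k\<in>{1..m}. \<forall>l\<in>{1..m}. k \<noteq> l \<longrightarrow> (\<forall>i\<in>indices N m. contract N k l T i = 0))}"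
    using traceless_iff[of _ N m] by blast
  show "funs.subspace (traceless N m)"
    unfolding funs.subspace_def eq
    by (auto simp: tensors_def contract_def scale_fun_def sum.distrib sum_distrib_left[symmetric])
  show "traceless N m \<subseteq> tensors N m" by (auto simp: traceless_iff)
  fix g T assume g: "g \<in> orth_group N" and T: "T \<in> traceless N m"
  have "contract N k l (group_act N m g T) i = 0"
    if kl: "k \<in> {1..m}" "l \<in> {1..m}" "k \<noteq> l" and i: "i \<in> indices N m" for k l i
  proof -
    have "contract N k l (group_act N m g T) i = (\<Sum>j\<in>{1..m} - {k, l} \<rightarrow>\<^sub>E {..<N}.
        (\<Prod>r\<in>{1..m} - {k, l}. g $$ (i r, j r)) * contract N k l T j)"
      by (rule contract_group_act[OF g kl]) (use index_upd2[OF i kl(1,2)] in auto)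
    also have "\<dots> = 0"
    proof (rule sum.neutral, rule ballI)
      fix j assume j: "j \<in> {1..m} - {k, l} \<rightarrow>\<^sub>E {..<N}"
      \<comment> \<open>The index \<open>j\<close> lacks the slots \<open>k\<close> and
        \<open>l\<close>. Filling them with values of \<open>i\<close> makes the tracelessness of
        \<open>T\<close> applicable and does not change the contraction.\<close>
      have "j(k := i k, l := i l) \<in> indices N m"
        using j kl index_less[OF i kl(1)] index_less[OF i kl(2)]
        by (auto simp: indices_def PiE_iff extensional_def)
      then have "contract N k l T (j(k := i k, l := i l)) = 0"
        using T kl by (auto simp: traceless_iff)
      moreover have "contract N k l T (j(k := i k, l := i l)) = contract N k l T j"
        using kl(3) by (simp add: contract_def fun_upd_twist)
      ultimately show "(\<Prod>r\<in>{1..m} - {k, l}. g $$ (i r, j r)) * contract N k l T j = 0" by simp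
    qed
    finally show ?thesis .
  qed
  then show "group_act N m g T \<in> traceless N m"
    by (auto simp: traceless_iff group_act_in_tensors)
qed

lemma index_comp:
  assumes "i \<in> Inl ` {1..m1} \<union> Inr ` {1..m2} \<rightarrow>\<^sub>E {..<N}"
  shows "i \<circ> Inl \<in> indices N m1" "i \<circ> Inr \<in> indices N m2"
proof -
  have "i (Inl m) \<in> {..<N}" if "m \<in> {1..m1}" for m
    by (rule PiE_mem[OF assms]) (use that in auto)
  moreover have "i (Inl m) = undefined" if "m \<notin> {1..m1}" for m
    by (rule PiE_arb[OF assms]) (use that in auto)
  ultimately show "i \<circ> Inl \<in> indices N m1"
    unfolding indices_def by (intro PiE_I) (auto simp: comp_def)
  have "i (Inr m) \<in> {..<N}" if "m \<in> {1..m2}" for m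
    by (rule PiE_mem[OF assms]) (use that in auto)
  moreover have "i (Inr m) = undefined" if "m \<notin> {1..m2}" for m
    by (rule PiE_arb[OF assms]) (use that in auto)
  ultimately show "i \<circ> Inr \<in> indices N m2"
    unfolding indices_def by (intro PiE_I) (auto simp: comp_def)
qed

lemma sum_sum_type_PiE:
  "(\<Sum>j\<in>Inl ` {1..m1} \<union> Inr ` {1..m2} \<rightarrow>\<^sub>E {..<N}. f (j \<circ> Inl) (j \<circ> Inr))
    = (\<Sum>j1\<in>indices N m1. \<Sum>j2\<in>indices N m2. f j1 j2)" for f :: "(nat \<Rightarrow> nat) \<Rightarrow> (nat \<Rightarrow> nat) \<Rightarrow> complex"
proof -
  have "(\<Sum>j\<in>Inl ` {1..m1} \<union> Inr ` {1..m2} \<rightarrow>\<^sub>E {..<N}. f (j \<circ> Inl) (j \<circ> Inr))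
      = (\<Sum>(j1, j2)\<in>indices N m1 \<times> indices N m2. f j1 j2)"
  proof (rule sum.reindex_bij_witness[where i = "\<lambda>p. case_sum (fst p) (snd p)" and j = "\<lambda>j. (j \<circ> Inl, j \<circ> Inr)"])
    fix p assume "p \<in> indices N m1 \<times> indices N m2"
    then have j: "fst p \<in> indices N m1" "snd p \<in> indices N m2" by auto
    have "case_sum (fst p) (snd p) s = undefined" if "s \<notin> Inl ` {1..m1} \<union> Inr ` {1..m2}" for s
    proof (cases s)
      case (Inl m)
      then have "m \<notin> {1..m1}" using that by blast
      then show ?thesis using index_undefined[OF j(1)] Inl by simp
    next
      case (Inr m)
      then have "m \<notin> {1..m2}" using that by blast
      then show ?thesis using index_undefined[OF j(2)] Inr by simp
    qed
    then show "case_sum (fst p) (snd p) \<in> Inl ` {1..m1} \<union> Inr ` {1..m2} \<rightarrow>\<^sub>E {..<N}"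
      using index_less[OF j(1)] index_less[OF j(2)] by (intro PiE_I) auto
    show "(case_sum (fst p) (snd p) \<circ> Inl, case_sum (fst p) (snd p) \<circ> Inr) = p"
      by (simp only: case_sum_o_inj prod.collapse)
  next
    fix j :: "nat + nat \<Rightarrow> nat"
    show "case_sum (fst (j \<circ> Inl, j \<circ> Inr)) (snd (j \<circ> Inl, j \<circ> Inr)) = j"
    proof
      fix s show "case_sum (fst (j \<circ> Inl, j \<circ> Inr)) (snd (j \<circ> Inl, j \<circ> Inr)) s = j s"
        by (cases s) auto
    qed
    show "(case (j \<circ> Inl, j \<circ> Inr) of (j1, j2) \<Rightarrow> f j1 j2) = f (j \<circ> Inl) (j \<circ> Inr)"
      by (simp only: prod.case)
    assume "j \<in> Inl ` {1..m1} \<union> Inr ` {1..m2} \<rightarrow>\<^sub>E {..<N}"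
    then show "(j \<circ> Inl, j \<circ> Inr) \<in> indices N m1 \<times> indices N m2"
      by (intro SigmaI index_comp)
  qed
  then show ?thesis by (simp only: sum.cartesian_product)
qed

lemma sesquilinear_sum:
  fixes B :: "tensor \<Rightarrow> tensor \<Rightarrow> complex"
  assumes sub: "funs.subspace W1" "funs.subspace W2"
    and add1: "\<And>y y' x. y \<in> W1 \<Longrightarrow> y' \<in> W1 \<Longrightarrow> x \<in> W2 \<Longrightarrow> B (y + y') x = B y x + B y' x"
    and add2: "\<And>y x x'. y \<in> W1 \<Longrightarrow> x \<in> W2 \<Longrightarrow> x' \<in> W2 \<Longrightarrow> B y (x + x') = B y x + B y x'"
    and scale1: "\<And>c y x. y \<in> W1 \<Longrightarrow> x \<in> W2 \<Longrightarrow> B (scale_fun c y) x = cnj c * B y x"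
    and scale2: "\<And>c y x. y \<in> W1 \<Longrightarrow> x \<in> W2 \<Longrightarrow> B y (scale_fun c x) = c * B y x"
    and "\<And>j. j \<in> J \<Longrightarrow> y j \<in> W1" "\<And>j. j \<in> K \<Longrightarrow> x j \<in> W2"
  shows "B (\<Sum>j\<in>J. scale_fun (c j) (y j)) (\<Sum>k\<in>K. scale_fun (d k) (x k))
    = (\<Sum>j\<in>J. \<Sum>k\<in>K. cnj (c j) * d k * B (y j) (x k))"
proof -
  let ?X = "\<Sum>k\<in>K. scale_fun (d k) (x k)"
  have x: "scale_fun (d k) (x k) \<in> W2" if "k \<in> K" for k
    using assms(8)[OF that] by (rule funs.subspace_scale[OF sub(2)])
  then have X: "?X \<in> W2" by (rule funs.subspace_sum[OF sub(2)])
  have y: "scale_fun (c j) (y j) \<in> W1" if "j \<in> J" for j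
    using assms(7)[OF that] by (rule funs.subspace_scale[OF sub(1)])
  have "B (\<Sum>j\<in>J. scale_fun (c j) (y j)) ?X = (\<Sum>j\<in>J. B (scale_fun (c j) (y j)) ?X)"
    by (rule sum_additive_on[OF sub(1), of "\<lambda>y. B y ?X"]) (use add1 X y in auto)
  also have "\<dots> = (\<Sum>j\<in>J. \<Sum>k\<in>K. cnj (c j) * d k * B (y j) (x k))"
  proof (rule sum.cong[OF refl])
    fix j assume j: "j \<in> J"
    have "B (y j) ?X = (\<Sum>k\<in>K. B (y j) (scale_fun (d k) (x k)))"
      by (rule sum_additive_on[OF sub(2)], rule add2[OF assms(7)[OF j]], assumption+, rule x)
    also have "\<dots> = (\<Sum>k\<in>K. d k * B (y j) (x k))"
      by (intro sum.cong refl scale2 assms(7,8) j)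
    finally show "B (scale_fun (c j) (y j)) ?X = (\<Sum>k\<in>K. cnj (c j) * d k * B (y j) (x k))"
      by (simp only: scale1[OF assms(7)[OF j] X] sum_distrib_left mult.assoc)
  qed
  finally show ?thesis .
qed

lemma pairing_zero:
  fixes B :: "tensor \<Rightarrow> tensor \<Rightarrow> complex"
  assumes W1: "G_stable N m1 W1" and W2: "G_stable N m2 W2" "W2 \<subseteq> traceless N m2" and less: "m1 < m2"
    and add1: "\<And>y y' x. y \<in> W1 \<Longrightarrow> y' \<in> W1 \<Longrightarrow> x \<in> W2 \<Longrightarrow> B (y + y') x = B y x + B y' x"
    and add2: "\<And>y x x'. y \<in> W1 \<Longrightarrow> x \<in> W2 \<Longrightarrow> x' \<in> W2 \<Longrightarrow> B y (x + x') = B y x + B y x'"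
    and scale1: "\<And>c y x. y \<in> W1 \<Longrightarrow> x \<in> W2 \<Longrightarrow> B (scale_fun c y) x = cnj c * B y x"
    and scale2: "\<And>c y x. y \<in> W1 \<Longrightarrow> x \<in> W2 \<Longrightarrow> B y (scale_fun c x) = c * B y x"
    and inv: "\<And>g y x. g \<in> orth_group N \<Longrightarrow> adj N g = g\<^sup>T \<Longrightarrow> y \<in> W1 \<Longrightarrow> x \<in> W2 \<Longrightarrow>
      B (group_act N m1 g y) (group_act N m2 g x) = B y x"
    and y: "y \<in> W1" and x: "x \<in> W2"
  shows "B y x = 0"
proof -
  obtain p1 p2 where p1: "is_projection N m1 W1 p1" and p2: "is_projection N m2 W2 p2"
    using exists_projection[OF G_stableD(1,2)[OF W1]] exists_projection[OF G_stableD(1,2)[OF W2(1)]] by blast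
  note sesq = sesquilinear_sum[OF G_stableD(1)[OF W1] G_stableD(1)[OF W2(1)], of B, OF add1 add2 scale1 scale2]
  have p1W: "p1 T \<in> W1" and p2W: "p2 T \<in> W2" for T using p1 p2 by (auto simp: is_projection_def)
  have p1s: "p1 (scale_fun c T) = scale_fun c (p1 T)" and p2s: "p2 (scale_fun c T) = scale_fun c (p2 T)" for c T
    using p1 p2 by (auto simp: is_projection_def)
  define F where "F i = B (p1 (unit_tensor (i \<circ> Inl))) (p2 (unit_tensor (i \<circ> Inr)))" for i :: "nat + nat \<Rightarrow> nat"
  let ?A1 = "Inl ` {1..m1} :: (nat + nat) set" and ?A2 = "Inr ` {1..m2} :: (nat + nat) set"
  note comp_in = index_comp[of _ m1 m2 N]
  have F0: "F i = 0" if "i \<in> ?A1 \<union> ?A2 \<rightarrow>\<^sub>E {..<N}" for i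
  proof (rule invariant_traceless_zero[where F = F, OF _ _ _ _ _ _ that])
    show "card ?A1 < card ?A2" using less by (simp add: card_image)
    fix s t j assume st: "s \<in> ?A2" "t \<in> ?A2" "s \<noteq> t" and j: "j \<in> ?A1 \<union> ?A2 \<rightarrow>\<^sub>E {..<N}"
    obtain a where a: "s = Inr a" "a \<in> {1..m2}" using st(1) by (elim imageE)
    obtain b where b: "t = Inr b" "b \<in> {1..m2}" using st(2) by (elim imageE)
    have ab: "s = Inr a" "t = Inr b" "a \<in> {1..m2}" "b \<in> {1..m2}" "a \<noteq> b" using a b st(3) by auto
    define r where "r = j \<circ> Inr"
    have r: "r \<in> indices N m2" using comp_in(2)[OF j] by (simp add: r_def)
    have eq: "j(s := c, t := c) \<circ> Inl = j \<circ> Inl" "j(s := c, t := c) \<circ> Inr = r(a := c, b := c)" for c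
      by (auto simp: fun_eq_iff ab r_def)
    let ?S = "\<Sum>c<N. scale_fun 1 (unit_tensor (r(a := c, b := c)))"
    \<comment> \<open>Pairing \<open>u\<close> with this sum gives the conjugate of a contraction of
      \<open>u\<close>, which is 0 because \<open>W2\<close> is traceless. The factors 1, and below
      the sum over \<open>{()}\<close>, bring the terms into the shape of
      \<open>sesquilinear_sum\<close>.\<close>
    have "p2 ?S = 0"
    proof (rule projection_unique[OF p2 G_stableD(1,2)[OF W2(1)]])
      show "0 \<in> W2" using funs.subspace_0[OF G_stableD(1)[OF W2(1)]] .
      fix u assume u: "u \<in> W2"
      have idx: "r(a := c, b := c) \<in> indices N m2" if "c < N" for c
        by (rule index_upd2[OF r ab(3,4)]) (use that in auto)
      have "herm N m2 u ?S = (\<Sum>i\<in>indices N m2. \<Sum>c<N. cnj (u i) * (if i = r(a := c, b := c) then 1 else 0))"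
        unfolding herm_def sum_fun_apply scale_fun_def unit_tensor_def by (simp add: sum_distrib_left)
      also have "\<dots> = (\<Sum>c<N. \<Sum>i\<in>indices N m2. cnj (u i) * (if i = r(a := c, b := c) then 1 else 0))"
        by (rule sum.swap)
      also have "\<dots> = (\<Sum>c<N. cnj (u (r(a := c, b := c))))"
        by (intro sum.cong refl) (simp add: finite_indices idx if_distrib cong: if_cong)
      also have "\<dots> = cnj (contract N a b u r)" by (simp add: contract_def)
      also have "contract N a b u r = 0" using u W2(2) r ab by (auto simp: traceless_iff)
      finally have "herm N m2 u ?S = 0" by (simp only: complex_cnj_zero)
      then show "herm N m2 u (?S - 0) = 0" by (simp only: diff_zero)
    qed
    then have *: "(\<Sum>c<N. scale_fun 1 (p2 (unit_tensor (r(a := c, b := c))))) = 0"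
      unfolding projection_sum[OF p2] p2s .
    have "(\<Sum>c<N. F (j(s := c, t := c)))
        = (\<Sum>u\<in>{()}. \<Sum>c<N. cnj 1 * 1 * B (p1 (unit_tensor (j \<circ> Inl))) (p2 (unit_tensor (r(a := c, b := c)))))"
      by (simp add: F_def eq)
    also have "\<dots> = B (\<Sum>u\<in>{()}. scale_fun 1 (p1 (unit_tensor (j \<circ> Inl))))
        (\<Sum>c<N. scale_fun 1 (p2 (unit_tensor (r(a := c, b := c)))))"
      by (rule sesq[symmetric]) (auto intro: p1W p2W)
    also have "\<dots> = B (\<Sum>u\<in>{()}. scale_fun 1 (p1 (unit_tensor (j \<circ> Inl)))) 0"
      unfolding * ..
    also have "\<dots> = 0"
    proof -
      have "(\<Sum>u\<in>{()}. scale_fun 1 (p1 (unit_tensor (j \<circ> Inl)))) \<in> W1"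
        by (intro funs.subspace_sum funs.subspace_scale G_stableD(1)[OF W1] p1W)
      then show ?thesis
        using add2[of _ 0 0] funs.subspace_0[OF G_stableD(1)[OF W2(1)]] by fastforce
    qed
    finally show "(\<Sum>c<N. F (j(s := c, t := c))) = 0" .
  next
    fix h i assume h: "orth_mat N h" and i: "i \<in> ?A1 \<union> ?A2 \<rightarrow>\<^sub>E {..<N}"
    \<comment> \<open>The transpose of \<open>h\<close>: the image of a unit tensor under
      \<open>g\<close> has products of column entries of \<open>g\<close> as coefficients, while the
      invariance of \<open>F\<close> is stated with the rows of \<open>h\<close>.\<close>
    define g where "g = mat N N (\<lambda>(a, b). complex_of_real (h b a))"
    have g: "g \<in> orth_group N"
      unfolding g_def by (rule orth_mat_in_orth_group[OF orth_mat_transpose[OF h]])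
    have adj: "adj N g = g\<^sup>T" by (rule eq_matI) (auto simp: adj_def g_def)
    have ga: "(\<Sum>j\<in>indices N m. scale_fun (\<Prod>r\<in>{1..m}. of_real (h (i r) (j r))) (unit_tensor j))
        = group_act N m g (unit_tensor i)" if i: "i \<in> indices N m" for m i
    proof -
      have "group_act N m g (unit_tensor i) j = (\<Prod>r\<in>{1..m}. of_real (h (i r) (j r)))"
        if j: "j \<in> indices N m" for j
      proof -
        have "group_act N m g (unit_tensor i) j
            = (\<Sum>j'\<in>indices N m. if j' = i then \<Prod>r\<in>{1..m}. g $$ (j r, i r) else 0)"
          unfolding group_act_apply[OF j] by (intro sum.cong refl) (auto simp: unit_tensor_def)
        also have "\<dots> = (\<Prod>r\<in>{1..m}. g $$ (j r, i r))" using i by (simp add: finite_indices)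
        also have "\<dots> = (\<Prod>r\<in>{1..m}. of_real (h (i r) (j r)))"
          by (intro prod.cong refl) (use index_less[OF i] index_less[OF j] in \<open>auto simp: g_def\<close>)
        finally show ?thesis .
      qed
      then show ?thesis
        by (subst sum_unit_tensor[OF group_act_in_tensors]) (intro sum.cong refl, simp)
    qed
    let ?c1 = "\<lambda>j. \<Prod>r\<in>{1..m1}. complex_of_real (h ((i \<circ> Inl) r) (j r))"
    let ?c2 = "\<lambda>j. \<Prod>r\<in>{1..m2}. complex_of_real (h ((i \<circ> Inr) r) (j r))"
    have "(\<Sum>j\<in>?A1 \<union> ?A2 \<rightarrow>\<^sub>E {..<N}. (\<Prod>s\<in>?A1 \<union> ?A2. of_real (h (i s) (j s))) * F j)
        = (\<Sum>j\<in>?A1 \<union> ?A2 \<rightarrow>\<^sub>E {..<N}. cnj (?c1 (j \<circ> Inl)) * ?c2 (j \<circ> Inr) *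
            B (p1 (unit_tensor (j \<circ> Inl))) (p2 (unit_tensor (j \<circ> Inr))))"
    proof (rule sum.cong[OF refl])
      fix j :: "nat + nat \<Rightarrow> nat"
      have "(\<Prod>s\<in>?A1 \<union> ?A2. complex_of_real (h (i s) (j s)))
          = (\<Prod>s\<in>?A1. complex_of_real (h (i s) (j s))) * (\<Prod>s\<in>?A2. complex_of_real (h (i s) (j s)))"
        by (rule prod.union_disjoint) auto
      also have "(\<Prod>s\<in>?A1. complex_of_real (h (i s) (j s))) = cnj (?c1 (j \<circ> Inl))"
        by (simp add: prod.reindex)
      also have "(\<Prod>s\<in>?A2. complex_of_real (h (i s) (j s))) = ?c2 (j \<circ> Inr)"
        by (simp add: prod.reindex)
      finally show "(\<Prod>s\<in>?A1 \<union> ?A2. complex_of_real (h (i s) (j s))) * F j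
          = cnj (?c1 (j \<circ> Inl)) * ?c2 (j \<circ> Inr) * B (p1 (unit_tensor (j \<circ> Inl))) (p2 (unit_tensor (j \<circ> Inr)))"
        by (simp only: F_def)
    qed
    also have "\<dots> = (\<Sum>j1\<in>indices N m1. \<Sum>j2\<in>indices N m2. cnj (?c1 j1) * ?c2 j2 *
            B (p1 (unit_tensor j1)) (p2 (unit_tensor j2)))"
      by (rule sum_sum_type_PiE)
    also have "\<dots> = B (\<Sum>j\<in>indices N m1. scale_fun (?c1 j) (p1 (unit_tensor j)))
        (\<Sum>j\<in>indices N m2. scale_fun (?c2 j) (p2 (unit_tensor j)))"
      by (rule sesq[symmetric]) (auto intro: p1W p2W)
    also have "(\<Sum>j\<in>indices N m1. scale_fun (?c1 j) (p1 (unit_tensor j)))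
        = group_act N m1 g (p1 (unit_tensor (i \<circ> Inl)))"
      unfolding projection_equivariant[OF p1 W1 g, symmetric] ga[OF comp_in(1)[OF i], symmetric]
        projection_sum[OF p1] p1s ..
    also have "(\<Sum>j\<in>indices N m2. scale_fun (?c2 j) (p2 (unit_tensor j)))
        = group_act N m2 g (p2 (unit_tensor (i \<circ> Inr)))"
      unfolding projection_equivariant[OF p2 W2(1) g, symmetric] ga[OF comp_in(2)[OF i], symmetric]
        projection_sum[OF p2] p2s ..
    also have "B (group_act N m1 g (p1 (unit_tensor (i \<circ> Inl)))) (group_act N m2 g (p2 (unit_tensor (i \<circ> Inr)))) = F i"
      unfolding F_def by (rule inv[OF g adj p1W p2W])
    finally show "(\<Sum>j\<in>?A1 \<union> ?A2 \<rightarrow>\<^sub>E {..<N}. (\<Prod>s\<in>?A1 \<union> ?A2. of_real (h (i s) (j s))) * F j) = F i" .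
  qed auto
  have "y = p1 (\<Sum>j\<in>indices N m1. scale_fun (y j) (unit_tensor j))"
    unfolding sum_unit_tensor[OF subsetD[OF G_stableD(2)[OF W1] y], symmetric]
    by (rule projection_id[OF p1 G_stableD(1,2)[OF W1] y, symmetric])
  then have "y = (\<Sum>j\<in>indices N m1. scale_fun (y j) (p1 (unit_tensor j)))"
    unfolding projection_sum[OF p1] p1s .
  moreover have "x = p2 (\<Sum>j\<in>indices N m2. scale_fun (x j) (unit_tensor j))"
    unfolding sum_unit_tensor[OF subsetD[OF G_stableD(2)[OF W2(1)] x], symmetric]
    by (rule projection_id[OF p2 G_stableD(1,2)[OF W2(1)] x, symmetric])
  then have "x = (\<Sum>j\<in>indices N m2. scale_fun (x j) (p2 (unit_tensor j)))"
    unfolding projection_sum[OF p2] p2s .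
  ultimately have "B y x = B (\<Sum>j\<in>indices N m1. scale_fun (y j) (p1 (unit_tensor j)))
      (\<Sum>j\<in>indices N m2. scale_fun (x j) (p2 (unit_tensor j)))" by (rule arg_cong2)
  also have "\<dots> = (\<Sum>j1\<in>indices N m1. \<Sum>j2\<in>indices N m2. cnj (y j1) * x j2 *
            B (p1 (unit_tensor j1)) (p2 (unit_tensor j2)))"
    by (rule sesq) (auto intro: p1W p2W)
  also have "\<dots> = (\<Sum>j\<in>?A1 \<union> ?A2 \<rightarrow>\<^sub>E {..<N}. cnj (y (j \<circ> Inl)) * x (j \<circ> Inr) *
            B (p1 (unit_tensor (j \<circ> Inl))) (p2 (unit_tensor (j \<circ> Inr))))"
    by (rule sum_sum_type_PiE[symmetric])
  also have "\<dots> = 0"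
    using F0 by (intro sum.neutral) (simp add: F_def)
  finally show ?thesis .
qed

section \<open>The Casimir operator\<close>

text \<open>\<open>so_deriv N n a b\<close> is the action of the element \<open>E\<^sub>a\<^sub>b - E\<^sub>b\<^sub>a\<close> of the Lie algebra of the
  orthogonal group.\<close>

definition so_deriv :: "nat \<Rightarrow> nat \<Rightarrow> nat \<Rightarrow> nat \<Rightarrow> tensor \<Rightarrow> tensor" where
  "so_deriv N n a b T = (\<lambda>i. if i \<in> indices N n
     then \<Sum>s\<in>{1..n}. (if i s = a then T (i(s := b)) else 0) - (if i s = b then T (i(s := a)) else 0) else 0)"

text \<open>The rotation by \<open>\<theta>\<close> in the plane of the coordinates \<open>a\<close>
  and \<open>b\<close>. Complex angles make the entries holomorphic, so complex derivatives apply,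
  and the matrix stays in the complex orthogonal group.\<close>

definition rotation :: "nat \<Rightarrow> nat \<Rightarrow> nat \<Rightarrow> complex \<Rightarrow> complex mat" where
  "rotation N a b \<theta> = mat N N (\<lambda>(x, y). of_bool (x = y) +
     (of_bool (x = y \<and> (x = a \<or> x = b))) * (cos \<theta> - 1) +
     (of_bool (x = a \<and> y = b) - of_bool (x = b \<and> y = a)) * sin \<theta>)"

lemma rotation_in_orth_group:
  assumes "a < N" "b < N" "a \<noteq> b"
  shows "rotation N a b \<theta> \<in> orth_group N"
proof -
  define h where "h x y = of_bool (x = y) + (of_bool (x = y \<and> (x = a \<or> x = b))) * (cos \<theta> - 1) +
     (of_bool (x = a \<and> y = b) - of_bool (x = b \<and> y = a)) * sin \<theta>" for x y
  have cs: "cos \<theta> * cos \<theta> + sin \<theta> * sin \<theta> = 1"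
    using sin_cos_squared_add[of \<theta>] by (simp add: power2_eq_square algebra_simps)
  have "(\<Sum>c<N. h x c * h y c) = of_bool (x = y)" if xy: "x < N" "y < N" for x y
  proof (cases "x = a \<or> x = b")
    case True
    have "(\<Sum>c<N. h x c * h y c) = (\<Sum>c\<in>{a, b}. h x c * h y c)"
      by (rule sum.mono_neutral_right) (use True assms in \<open>auto simp: h_def\<close>)
    also have "\<dots> = h x a * h y a + h x b * h y b" using assms by simp
    also have "\<dots> = of_bool (x = y)"
      using True assms cs by (auto simp: h_def algebra_simps)
    finally show ?thesis .
  next
    case False
    have "(\<Sum>c<N. h x c * h y c) = (\<Sum>c\<in>{x}. h x c * h y c)"
      by (rule sum.mono_neutral_right) (use False xy in \<open>auto simp: h_def\<close>)
    also have "\<dots> = of_bool (x = y)" using False by (auto simp: h_def)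
    finally show ?thesis .
  qed
  moreover have "rotation N a b \<theta> = mat N N (\<lambda>(x, y). h x y)"
    by (simp add: rotation_def h_def)
  ultimately have "rotation N a b \<theta> * (rotation N a b \<theta>)\<^sup>T = 1\<^sub>m N"
    by (intro eq_matI) (auto simp: scalar_prod_def atLeast0LessThan)
  then show ?thesis by (simp add: orth_group_def rotation_def)
qed

lemma sum_one_slot:
  assumes i: "i \<in> indices N n" and s: "s \<in> {1..n}"
  shows "(\<Sum>j\<in>indices N n. if \<forall>t\<in>{1..n} - {s}. i t = j t then w j else 0) = (\<Sum>c<N. w (i(s := c)))"
proof -
  have "(\<Sum>j\<in>indices N n. if \<forall>t\<in>{1..n} - {s}. i t = j t then w j else 0)
      = (\<Sum>j\<in>{j \<in> indices N n. \<forall>t\<in>{1..n} - {s}. i t = j t}. w j)"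
    by (rule sum.inter_filter[symmetric, OF finite_indices])
  also have "\<dots> = (\<Sum>c<N. w (i(s := c)))"
  proof (rule sum.reindex_bij_witness[where i = "\<lambda>c. i(s := c)" and j = "\<lambda>j. j s"])
    fix j assume j: "j \<in> {j \<in> indices N n. \<forall>t\<in>{1..n} - {s}. i t = j t}"
    show eq: "i(s := j s) = j"
    proof
      fix t show "(i(s := j s)) t = j t"
        using j index_undefined[OF i, of t] index_undefined[of j N n t] by (cases "t \<in> {1..n}") auto
    qed
    show "w (i(s := j s)) = w j" unfolding eq ..
    show "j s \<in> {..<N}" using j index_less[OF _ s] by auto
  next
    fix c assume "c \<in> {..<N}"
    then show "i(s := c) \<in> {j \<in> indices N n. \<forall>t\<in>{1..n} - {s}. i t = j t}"
      using index_upd[OF i s] by auto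
  qed simp
  finally show ?thesis .
qed

text \<open>The product rule over the slots: at angle 0 all matrix factors but the differentiated
  one are Kronecker symbols, so the index changes in one slot only.\<close>

lemma group_act_rotation_deriv:
  assumes ab: "a < N" "b < N" "a \<noteq> b" and i: "i \<in> indices N n"
  shows "((\<lambda>\<theta>. group_act N n (rotation N a b \<theta>) T i) has_field_derivative so_deriv N n a b T i) (at 0)"
proof -
  define h where "h x y \<theta> = of_bool (x = y) + (of_bool (x = y \<and> (x = a \<or> x = b))) * (cos \<theta> - 1) +
     (of_bool (x = a \<and> y = b) - of_bool (x = b \<and> y = a)) * sin \<theta>" for x y and \<theta> :: complex
  define d where "d x y = (of_bool (x = a \<and> y = b) - of_bool (x = b \<and> y = a) :: complex)" for x y
  have h0: "h x y 0 = of_bool (x = y)" for x y by (simp add: h_def)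
  have hd: "(h x y has_field_derivative d x y) (at 0)" for x y
  proof -
    have "((\<lambda>\<theta>. u + v * (cos \<theta> - 1) + w * sin \<theta>) has_field_derivative w) (at 0)" for u v w :: complex
      by (auto intro!: derivative_eq_intros)
    then show ?thesis unfolding h_def d_def .
  qed
  have "((\<lambda>\<theta>. \<Sum>j\<in>indices N n. (\<Prod>s\<in>{1..n}. h (i s) (j s) \<theta>) * T j) has_field_derivative
      (\<Sum>j\<in>indices N n. (\<Sum>s\<in>{1..n}. d (i s) (j s) * (\<Prod>t\<in>{1..n} - {s}. h (i t) (j t) 0)) * T j)) (at 0)"
    by (intro DERIV_sum DERIV_cmult_right has_field_derivative_prod hd)
  also have "(\<lambda>\<theta>. \<Sum>j\<in>indices N n. (\<Prod>s\<in>{1..n}. h (i s) (j s) \<theta>) * T j)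
      = (\<lambda>\<theta>. group_act N n (rotation N a b \<theta>) T i)"
  proof
    fix \<theta>
    have "(\<Prod>s\<in>{1..n}. h (i s) (j s) \<theta>) = (\<Prod>s\<in>{1..n}. rotation N a b \<theta> $$ (i s, j s))"
      if j: "j \<in> indices N n" for j
      by (rule prod.cong[OF refl]) (simp only: rotation_def index_mat prod.case h_def index_less[OF i] index_less[OF j])
    then show "(\<Sum>j\<in>indices N n. (\<Prod>s\<in>{1..n}. h (i s) (j s) \<theta>) * T j) = group_act N n (rotation N a b \<theta>) T i"
      unfolding group_act_apply[OF i] by (intro sum.cong refl) simp
  qed
  also have "(\<Sum>j\<in>indices N n. (\<Sum>s\<in>{1..n}. d (i s) (j s) * (\<Prod>t\<in>{1..n} - {s}. h (i t) (j t) 0)) * T j)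
      = (\<Sum>s\<in>{1..n}. \<Sum>c<N. d (i s) c * T (i(s := c)))"
  proof -
    have p: "(\<Prod>t\<in>{1..n} - {s}. h (i t) (j t) 0) = of_bool (\<forall>t\<in>{1..n} - {s}. i t = j t)" for s j
    proof (cases "\<forall>t\<in>{1..n} - {s}. i t = j t")
      case True
      then have "(\<Prod>t\<in>{1..n} - {s}. h (i t) (j t) 0) = 1"
        unfolding h0 by (intro prod.neutral) auto
      then show ?thesis using True by simp
    next
      case False
      then obtain t where "t \<in> {1..n} - {s}" "i t \<noteq> j t" by blast
      then have "(\<Prod>t\<in>{1..n} - {s}. h (i t) (j t) 0) = 0"
        unfolding h0 by (intro prod_zero) auto
      then show ?thesis by (simp only: False of_bool_eq)
    qed
    have "(\<Sum>j\<in>indices N n. (\<Sum>s\<in>{1..n}. d (i s) (j s) * (\<Prod>t\<in>{1..n} - {s}. h (i t) (j t) 0)) * T j)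
        = (\<Sum>s\<in>{1..n}. \<Sum>j\<in>indices N n. d (i s) (j s) * of_bool (\<forall>t\<in>{1..n} - {s}. i t = j t) * T j)"
      unfolding p sum_distrib_right by (rule sum.swap)
    also have "\<dots> = (\<Sum>s\<in>{1..n}. \<Sum>c<N. d (i s) c * T (i(s := c)))"
    proof (rule sum.cong[OF refl])
      fix s assume s: "s \<in> {1..n}"
      have "(\<Sum>j\<in>indices N n. d (i s) (j s) * of_bool (\<forall>t\<in>{1..n} - {s}. i t = j t) * T j)
          = (\<Sum>j\<in>indices N n. if \<forall>t\<in>{1..n} - {s}. i t = j t then d (i s) (j s) * T j else 0)"
        by (intro sum.cong refl) auto
      also have "\<dots> = (\<Sum>c<N. d (i s) c * T (i(s := c)))"
        unfolding sum_one_slot[OF i s] by simp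
      finally show "(\<Sum>j\<in>indices N n. d (i s) (j s) * of_bool (\<forall>t\<in>{1..n} - {s}. i t = j t) * T j)
        = (\<Sum>c<N. d (i s) c * T (i(s := c)))" .
    qed
    finally show ?thesis .
  qed
  also have "\<dots> = so_deriv N n a b T i"
  proof -
    have "(\<Sum>c<N. d (i s) c * T (i(s := c)))
        = (if i s = a then T (i(s := b)) else 0) - (if i s = b then T (i(s := a)) else 0)" for s
    proof -
      have "(\<Sum>c<N. d (i s) c * T (i(s := c))) = (\<Sum>c<N. (if c = b then of_bool (i s = a) * T (i(s := b)) else 0) -
          (if c = a then of_bool (i s = b) * T (i(s := a)) else 0))"
        by (intro sum.cong refl) (auto simp: d_def)
      then show ?thesis using ab by (simp add: sum_subtractf)
    qed
    then show ?thesis using i by (simp add: so_deriv_def)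
  qed
  finally show ?thesis .
qed

text \<open>The derivative of a curve in \<open>W\<close> is not known beforehand to lie in
  \<open>W\<close>. Therefore \<open>f\<close> is replaced by its linear extension
  \<open>f \<circ> p\<close>, which is a finite combination of coordinates and commutes with
  differentiation. Applied to the identity map, this shows that \<open>p\<close> fixes the
  derivative, so \<open>W\<close> is stable under the Lie algebra.\<close>

lemma projection_so_deriv:
  assumes ab: "a < N" "b < N" "a \<noteq> b" and W: "G_stable N m W" and p: "is_projection N m W p"
    and add: "\<And>S T. S \<in> W \<Longrightarrow> T \<in> W \<Longrightarrow> f (S + T) = f S + f T"
    and scale: "\<And>c T. T \<in> W \<Longrightarrow> f (scale_fun c T) = scale_fun c (f T)"
    and comm: "\<And>g T. g \<in> orth_group N \<Longrightarrow> T \<in> W \<Longrightarrow> f (group_act N m g T) = group_act N n g (f T)"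
    and y: "y \<in> W" and fy: "\<And>T. T \<in> W \<Longrightarrow> f T \<in> tensors N n"
  shows "f (p (so_deriv N m a b y)) = so_deriv N n a b (f y)"
proof (rule tensors_eqI)
  have pW: "p T \<in> W" for T using p by (simp add: is_projection_def)
  have ps: "p (scale_fun c T) = scale_fun c (p T)" for c T using p by (simp add: is_projection_def)
  show "f (p (so_deriv N m a b y)) \<in> tensors N n" using fy pW by blast
  show "so_deriv N n a b (f y) \<in> tensors N n" by (simp add: so_deriv_def tensors_def)
  have fp: "f (p T) i = (\<Sum>j\<in>indices N m. T j * f (p (unit_tensor j)) i)" if T: "T \<in> tensors N m" for T i
  proof -
    have "p T = (\<Sum>j\<in>indices N m. scale_fun (T j) (p (unit_tensor j)))"
      by (subst sum_unit_tensor[OF T]) (simp only: projection_sum[OF p] ps)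
    then have "f (p T) = (\<Sum>j\<in>indices N m. f (scale_fun (T j) (p (unit_tensor j))))"
      by (simp only:) (rule sum_additive_on[OF G_stableD(1)[OF W] add], assumption+,
        rule funs.subspace_scale[OF G_stableD(1)[OF W] pW])
    also have "\<dots> = (\<Sum>j\<in>indices N m. scale_fun (T j) (f (p (unit_tensor j))))"
      by (intro sum.cong refl scale pW)
    finally have "f (p T) = (\<Sum>j\<in>indices N m. scale_fun (T j) (f (p (unit_tensor j))))" .
    then show ?thesis by (simp only: sum_fun_apply scale_fun_def)
  qed
  fix i assume i: "i \<in> indices N n"
  have "((\<lambda>\<theta>. \<Sum>j\<in>indices N m. group_act N m (rotation N a b \<theta>) y j * f (p (unit_tensor j)) i) has_field_derivative
      (\<Sum>j\<in>indices N m. so_deriv N m a b y j * f (p (unit_tensor j)) i)) (at 0)"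
    by (intro DERIV_sum DERIV_cmult_right group_act_rotation_deriv[OF ab])
  also have "(\<lambda>\<theta>. \<Sum>j\<in>indices N m. group_act N m (rotation N a b \<theta>) y j * f (p (unit_tensor j)) i)
      = (\<lambda>\<theta>. group_act N n (rotation N a b \<theta>) (f y) i)"
  proof
    fix \<theta>
    have g: "rotation N a b \<theta> \<in> orth_group N" by (rule rotation_in_orth_group[OF ab])
    have "p (group_act N m (rotation N a b \<theta>) y) = group_act N m (rotation N a b \<theta>) y"
      by (rule projection_id[OF p G_stableD(1,2)[OF W] G_stableD(3)[OF W g y]])
    then show "(\<Sum>j\<in>indices N m. group_act N m (rotation N a b \<theta>) y j * f (p (unit_tensor j)) i)
        = group_act N n (rotation N a b \<theta>) (f y) i"
      using fp[OF group_act_in_tensors] comm[OF g y] by metis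
  qed
  also have "(\<Sum>j\<in>indices N m. so_deriv N m a b y j * f (p (unit_tensor j)) i) = f (p (so_deriv N m a b y)) i"
    by (rule fp[symmetric]) (simp add: so_deriv_def tensors_def)
  finally show "f (p (so_deriv N m a b y)) i = so_deriv N n a b (f y) i"
    using group_act_rotation_deriv[OF ab i] by (rule DERIV_unique)
qed

lemma so_deriv_same: "so_deriv N n a a T = 0"
  by (auto simp: so_deriv_def fun_eq_iff)

lemma so_deriv_hom:
  assumes ab: "a < N" "b < N" and W: "G_stable N m W" and f: "f \<in> hom_G N m W n (tensors N n)" and y: "y \<in> W"
  shows "so_deriv N m a b y \<in> W" "f (so_deriv N m a b y) = so_deriv N n a b (f y)"
proof -
  obtain p where p: "is_projection N m W p" using exists_projection[OF G_stableD(1,2)[OF W]] by blast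
  have add: "f (S + T) = f S + f T" if "S \<in> W" "T \<in> W" for S T using f that by (auto simp: hom_G_def)
  have "so_deriv N m a b y \<in> W \<and> f (so_deriv N m a b y) = so_deriv N n a b (f y)"
  proof (cases "a = b")
    case True
    have "f 0 = 0" using add[of 0 0] funs.subspace_0[OF G_stableD(1)[OF W]] by simp
    then show ?thesis unfolding True so_deriv_same using funs.subspace_0[OF G_stableD(1)[OF W]] by blast
  next
    case False
    have id: "p (so_deriv N m a b y) = so_deriv N m a b y"
      using projection_so_deriv[OF ab False W p, of "\<lambda>T. T" m y] y G_stableD(2)[OF W] by auto
    then have "so_deriv N m a b y \<in> W" using p by (metis is_projection_def)
    moreover have "f (p (so_deriv N m a b y)) = so_deriv N n a b (f y)"
      by (rule projection_so_deriv[OF ab False W p add _ _ y]) (use f in \<open>auto simp: hom_G_def\<close>)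
    ultimately show ?thesis unfolding id by blast
  qed
  then show "so_deriv N m a b y \<in> W" "f (so_deriv N m a b y) = so_deriv N n a b (f y)" by auto
qed

section \<open>The Casimir operator as the sum of the Jucys-Murphy elements\<close>

definition jm_sum :: "nat \<Rightarrow> nat \<Rightarrow> tensor \<Rightarrow> tensor" where
  "jm_sum N n T = (\<lambda>i. if i \<in> indices N n then \<Sum>p\<in>{1..n}. jm N p T i else 0)"

lemma sum_pairs_symmetric:
  fixes h :: "nat \<Rightarrow> nat \<Rightarrow> 'a::comm_semiring_1"
  assumes "\<And>s t. h s t = h t s"
  shows "(\<Sum>s\<in>{1..n}. \<Sum>t\<in>{1..n} - {s}. h s t) = 2 * (\<Sum>p\<in>{1..n}. \<Sum>l\<in>{1..<p}. h p l)"
proof (induction n)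
  case (Suc n)
  have "(\<Sum>s\<in>{1..Suc n}. \<Sum>t\<in>{1..Suc n} - {s}. h s t)
      = (\<Sum>s\<in>{1..n}. \<Sum>t\<in>{1..Suc n} - {s}. h s t) + (\<Sum>t\<in>{1..Suc n} - {Suc n}. h (Suc n) t)"
    by simp
  also have "(\<Sum>s\<in>{1..n}. \<Sum>t\<in>{1..Suc n} - {s}. h s t)
      = (\<Sum>s\<in>{1..n}. (\<Sum>t\<in>{1..n} - {s}. h s t) + h s (Suc n))"
  proof (rule sum.cong[OF refl])
    fix s assume "s \<in> {1..n}"
    then have "{1..Suc n} - {s} = insert (Suc n) ({1..n} - {s})" by auto
    then show "(\<Sum>t\<in>{1..Suc n} - {s}. h s t) = (\<Sum>t\<in>{1..n} - {s}. h s t) + h s (Suc n)"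
      by (simp add: add.commute)
  qed
  also have "{1..Suc n} - {Suc n} = {1..n}" by auto
  also have "(\<Sum>t\<in>{1..n}. h (Suc n) t) = (\<Sum>s\<in>{1..n}. h s (Suc n))"
    by (intro sum.cong refl assms)
  finally have "(\<Sum>s\<in>{1..Suc n}. \<Sum>t\<in>{1..Suc n} - {s}. h s t)
      = 2 * (\<Sum>p\<in>{1..n}. \<Sum>l\<in>{1..<p}. h p l) + 2 * (\<Sum>s\<in>{1..n}. h s (Suc n))"
    unfolding sum.distrib Suc by (simp add: mult_2 add_ac)
  also have "(\<Sum>s\<in>{1..n}. h s (Suc n)) = (\<Sum>l\<in>{1..<Suc n}. h (Suc n) l)"
    by (intro sum.cong) (auto intro: assms)
  finally show ?case by (simp add: distrib_left)
qed simp

text \<open>Expanded over pairs of slots, a slot paired with itself gives 1 - N, and two different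
  slots give the bar minus the transposition; all this occurs twice because \<open>so_deriv\<close>
  is antisymmetric in \<open>a\<close> and \<open>b\<close>. Each unordered pair of slots occurs
  twice as well, whereas the sum of the x_p has (N - 1)/2 per slot; this yields the factor
  -4.\<close>

lemma casimir:
  assumes i: "i \<in> indices N n"
  shows "(\<Sum>a<N. \<Sum>b<N. so_deriv N n a b (so_deriv N n a b T) i) = - 4 * jm_sum N n T i"
proof -
  let ?D = "\<lambda>a b. so_deriv N n a b T"
  define S where "S = (\<Sum>p\<in>{1..n}. \<Sum>l\<in>{1..<p}. T (i \<circ> transpose p l) -
    (if i p = i l then contract N p l T i else 0))"
  have anti: "?D a b j = - ?D b a j" for a b j
    by (simp add: so_deriv_def sum_negf[symmetric])
  have "(\<Sum>a<N. \<Sum>b<N. so_deriv N n a b (?D a b) i)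
      = (\<Sum>a<N. \<Sum>b<N. \<Sum>s\<in>{1..n}. (if i s = a then ?D a b (i(s := b)) else 0) - (if i s = b then ?D a b (i(s := a)) else 0))"
    using i by (intro sum.cong refl) (simp add: so_deriv_def[of N n _ _ "so_deriv _ _ _ _ _"])
  also have "\<dots> = (\<Sum>s\<in>{1..n}. \<Sum>a<N. \<Sum>b<N. (if i s = a then ?D a b (i(s := b)) else 0) - (if i s = b then ?D a b (i(s := a)) else 0))"
    by (simp only: sum.swap[of _ "{1..n}"])
  also have "\<dots> = (\<Sum>s\<in>{1..n}. 2 * (\<Sum>b<N. ?D (i s) b (i(s := b))))"
  proof (rule sum.cong[OF refl])
    fix s assume s: "s \<in> {1..n}"
    have "(\<Sum>a<N. \<Sum>b<N. if i s = a then ?D a b (i(s := b)) else 0)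
        = (\<Sum>a<N. if i s = a then \<Sum>b<N. ?D a b (i(s := b)) else 0)"
      by (intro sum.cong refl) simp
    also have "\<dots> = (\<Sum>b<N. ?D (i s) b (i(s := b)))"
      using index_less[OF i s] by simp
    finally have 1: "(\<Sum>a<N. \<Sum>b<N. if i s = a then ?D a b (i(s := b)) else 0) = (\<Sum>b<N. ?D (i s) b (i(s := b)))" .
    have "(\<Sum>a<N. \<Sum>b<N. if i s = b then ?D a b (i(s := a)) else 0) = (\<Sum>a<N. ?D a (i s) (i(s := a)))"
      using index_less[OF i s] by simp
    also have "\<dots> = - (\<Sum>b<N. ?D (i s) b (i(s := b)))"
      unfolding sum_negf[symmetric] by (intro sum.cong refl anti)
    finally show "(\<Sum>a<N. \<Sum>b<N. (if i s = a then ?D a b (i(s := b)) else 0) - (if i s = b then ?D a b (i(s := a)) else 0))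
        = 2 * (\<Sum>b<N. ?D (i s) b (i(s := b)))"
      unfolding sum_subtractf 1 by simp
  qed
  also have "\<dots> = (\<Sum>s\<in>{1..n}. 2 * ((1 - of_nat N) * T i + (\<Sum>t\<in>{1..n} - {s}.
      (if i s = i t then contract N s t T i else 0) - T (i \<circ> transpose s t))))"
  proof (intro sum.cong refl arg_cong2[of _ _ _ _ "(*)"])
    fix s assume s: "s \<in> {1..n}"
    define e where "e t b = (if (i(s := b)) t = i s then T (i(s := b, t := b)) else 0) -
        (if (i(s := b)) t = b then T (i(s := b, t := i s)) else 0)" for t b
    have "(\<Sum>b<N. ?D (i s) b (i(s := b))) = (\<Sum>b<N. \<Sum>t\<in>{1..n}. e t b)"
      using index_upd[OF i s] by (intro sum.cong refl) (simp add: so_deriv_def e_def)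
    also have "\<dots> = (\<Sum>t\<in>{1..n}. \<Sum>b<N. e t b)" by (rule sum.swap)
    also have "\<dots> = (\<Sum>b<N. e s b) + (\<Sum>t\<in>{1..n} - {s}. \<Sum>b<N. e t b)"
      by (rule sum.remove) (use s in auto)
    also have "(\<Sum>b<N. e s b) = (\<Sum>b<N. (if b = i s then T i else 0) - T i)"
      by (intro sum.cong refl) (auto simp: e_def)
    also have "\<dots> = (1 - of_nat N) * T i"
      using index_less[OF i s] by (simp add: sum_subtractf algebra_simps)
    also have "(\<Sum>t\<in>{1..n} - {s}. \<Sum>b<N. e t b)
        = (\<Sum>t\<in>{1..n} - {s}. (if i s = i t then contract N s t T i else 0) - T (i \<circ> transpose s t))"
    proof (rule sum.cong[OF refl])
      fix t assume t: "t \<in> {1..n} - {s}"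
      have tr: "i(s := i t, t := i s) = i \<circ> transpose s t"
        by (auto simp: fun_eq_iff Transposition.transpose_def)
      have "(\<Sum>b<N. e t b) = (\<Sum>b<N. if i s = i t then T (i(s := b, t := b)) else 0) -
          (\<Sum>b<N. if b = i t then T (i(s := i t, t := i s)) else 0)"
        unfolding sum_subtractf[symmetric] by (intro sum.cong refl) (use t in \<open>auto simp: e_def\<close>)
      also have "(\<Sum>b<N. if i s = i t then T (i(s := b, t := b)) else 0) = (if i s = i t then contract N s t T i else 0)"
        by (simp add: contract_def)
      also have "(\<Sum>b<N. if b = i t then T (i(s := i t, t := i s)) else 0) = T (i \<circ> transpose s t)"
        unfolding tr using index_less[OF i, of t] t by simp
      finally show "(\<Sum>b<N. e t b) = (if i s = i t then contract N s t T i else 0) - T (i \<circ> transpose s t)" .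
    qed
    finally show "(\<Sum>b<N. ?D (i s) b (i(s := b))) = (1 - of_nat N) * T i + (\<Sum>t\<in>{1..n} - {s}.
      (if i s = i t then contract N s t T i else 0) - T (i \<circ> transpose s t))" .
  qed
  also have "\<dots> = 2 * (of_nat n * ((1 - of_nat N) * T i)) + 2 * (\<Sum>s\<in>{1..n}. \<Sum>t\<in>{1..n} - {s}.
      (if i s = i t then contract N s t T i else 0) - T (i \<circ> transpose s t))"
    by (simp add: sum_distrib_left[symmetric] sum.distrib distrib_left)
  also have "(\<Sum>s\<in>{1..n}. \<Sum>t\<in>{1..n} - {s}. (if i s = i t then contract N s t T i else 0) - T (i \<circ> transpose s t))
      = 2 * (\<Sum>p\<in>{1..n}. \<Sum>l\<in>{1..<p}. (if i p = i l then contract N p l T i else 0) - T (i \<circ> transpose p l))"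
  proof (rule sum_pairs_symmetric)
    fix s t
    have "contract N s t T i = contract N t s T i"
      unfolding contract_def by (cases "s = t") (auto simp: fun_upd_twist)
    then show "(if i s = i t then contract N s t T i else 0) - T (i \<circ> transpose s t)
        = (if i t = i s then contract N t s T i else 0) - T (i \<circ> transpose t s)"
      by (auto simp: transpose_commute)
  qed
  also have "(\<Sum>p\<in>{1..n}. \<Sum>l\<in>{1..<p}. (if i p = i l then contract N p l T i else 0) - T (i \<circ> transpose p l))
      = - S"
    unfolding sum_negf[symmetric] S_def by (intro sum.cong refl) simp
  also have "2 * (of_nat n * ((1 - of_nat N) * T i)) + 2 * (2 * - S)
      = - 4 * (of_nat n * ((of_nat N - 1) / 2 * T i) + S)"
    by (simp add: algebra_simps)
  also have "of_nat n * ((of_nat N - 1) / 2 * T i) + S = jm_sum N n T i"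
    using i by (simp add: jm_sum_def jm_def sum.distrib S_def)
  finally show ?thesis .
qed

lemma jm_sum_hom:
  assumes W: "G_stable N m W" and f: "f \<in> hom_G N m W n (tensors N n)" and y: "y \<in> W"
  shows "f (jm_sum N m y) = jm_sum N n (f y)"
proof -
  let ?C = "\<lambda>n y. \<Sum>a<N. \<Sum>b<N. so_deriv N n a b (so_deriv N n a b y)"
  have cas: "jm_sum N n T = scale_fun (- 1 / 4) (?C n T)" for n T
  proof
    fix i
    show "jm_sum N n T i = scale_fun (- 1 / 4) (?C n T) i"
    proof (cases "i \<in> indices N n")
      case True
      then show ?thesis using casimir[OF True, of T] by (simp add: scale_fun_def sum_fun_apply)
    next
      case False
      then show ?thesis by (simp add: jm_sum_def scale_fun_def sum_fun_apply so_deriv_def)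
    qed
  qed
  note sub = G_stableD(1)[OF W]
  have add: "f (S + T) = f S + f T" if "S \<in> W" "T \<in> W" for S T using f that by (auto simp: hom_G_def)
  have DW: "so_deriv N m a b T \<in> W" if "a < N" "b < N" "T \<in> W" for a b T
    by (rule so_deriv_hom(1)[OF that(1,2) W f that(3)])
  have D2: "so_deriv N m a b (so_deriv N m a b y) \<in> W" if "a < N" "b < N" for a b
    by (intro DW that y)
  have inner: "f (\<Sum>b<N. so_deriv N m a b (so_deriv N m a b y)) = (\<Sum>b<N. so_deriv N n a b (so_deriv N n a b (f y)))"
    if a: "a < N" for a
  proof -
    have "f (\<Sum>b<N. so_deriv N m a b (so_deriv N m a b y)) = (\<Sum>b<N. f (so_deriv N m a b (so_deriv N m a b y)))"
      by (rule sum_additive_on[OF sub add]) (use D2[OF a] in auto)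
    also have "\<dots> = (\<Sum>b<N. so_deriv N n a b (so_deriv N n a b (f y)))"
      by (intro sum.cong refl) (simp add: so_deriv_hom(2)[OF a _ W f] DW[OF a] y)
    finally show ?thesis .
  qed
  have CW: "?C m y \<in> W"
    by (intro funs.subspace_sum[OF sub]) (use D2 in auto)
  have "f (?C m y) = (\<Sum>a<N. f (\<Sum>b<N. so_deriv N m a b (so_deriv N m a b y)))"
    by (rule sum_additive_on[OF sub add]) (use D2 in \<open>auto intro!: funs.subspace_sum[OF sub]\<close>)
  also have "\<dots> = ?C n (f y)"
    by (intro sum.cong refl) (simp add: inner)
  finally have fC: "f (?C m y) = ?C n (f y)" .
  have "f (scale_fun c T) = scale_fun c (f T)" if "T \<in> W" for c T
    using f that by (auto simp: hom_G_def)
  from this[OF CW] show ?thesis unfolding cas fC .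
qed

section \<open>Young symmetrizers\<close>

definition cell :: "young \<Rightarrow> nat \<Rightarrow> nat \<times> nat" where
  "cell \<mu> = inv_into \<mu> (tableau \<mu>)"

lemma bij_betw_tableau:
  assumes "finite \<mu>"
  shows "bij_betw (tableau \<mu>) \<mu> {1..card \<mu>}"
proof -
  define S where "S x = {y \<in> \<mu>. fst y < fst x \<or> fst y = fst x \<and> snd y \<le> snd x}" for x :: "nat \<times> nat"
  have S: "finite (S x)" "S x \<subseteq> \<mu>" for x using assms by (auto simp: S_def)
  have tab: "tableau \<mu> x = card (S x)" for x by (simp add: tableau_def S_def)
  have less: "tableau \<mu> x < tableau \<mu> y"
    if "y \<in> \<mu>" "fst x < fst y \<or> fst x = fst y \<and> snd x < snd y" for x y
  proof -
    have "S x \<subseteq> S y" "y \<in> S y" "y \<notin> S x" using that by (auto simp: S_def)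
    then have "S x \<subset> S y" by blast
    then show ?thesis unfolding tab by (rule psubset_card_mono[OF S(1)])
  qed
  have inj: "inj_on (tableau \<mu>) \<mu>"
  proof (rule inj_onI)
    fix x y assume xy: "x \<in> \<mu>" "y \<in> \<mu>" "tableau \<mu> x = tableau \<mu> y"
    then have "\<not> (fst x < fst y \<or> fst x = fst y \<and> snd x < snd y)"
      "\<not> (fst y < fst x \<or> fst y = fst x \<and> snd y < snd x)"
      using less[of y x] less[of x y] by auto
    then show "x = y" by (auto simp: prod_eq_iff)
  qed
  have "tableau \<mu> ` \<mu> \<subseteq> {1..card \<mu>}"
  proof (rule image_subsetI)
    fix x assume "x \<in> \<mu>"
    then have "x \<in> S x" by (simp add: S_def)
    then have "card (S x) \<noteq> 0" using S by auto
    then show "tableau \<mu> x \<in> {1..card \<mu>}"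
      using card_mono[OF assms S(2)[of x]] by (simp add: tab)
  qed
  moreover have "card (tableau \<mu> ` \<mu>) = card {1..card \<mu>}" using card_image[OF inj] by simp
  ultimately have "tableau \<mu> ` \<mu> = {1..card \<mu>}" by (intro card_subset_eq) auto
  then show ?thesis using inj by (simp add: bij_betw_def)
qed

lemma bij_betw_cell: "finite \<mu> \<Longrightarrow> bij_betw (cell \<mu>) {1..card \<mu>} \<mu>"
  unfolding cell_def by (rule bij_betw_inv_into[OF bij_betw_tableau])

lemma cell_tableau: "finite \<mu> \<Longrightarrow> x \<in> \<mu> \<Longrightarrow> cell \<mu> (tableau \<mu> x) = x"
  unfolding cell_def by (rule bij_betw_inv_into_left[OF bij_betw_tableau])

lemma tableau_cell: "finite \<mu> \<Longrightarrow> s \<in> {1..card \<mu>} \<Longrightarrow> tableau \<mu> (cell \<mu> s) = s"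
  unfolding cell_def by (rule bij_betw_inv_into_right[OF bij_betw_tableau])

lemma tableau_range: "finite \<mu> \<Longrightarrow> x \<in> \<mu> \<Longrightarrow> tableau \<mu> x \<in> {1..card \<mu>}"
  using bij_betw_tableau bij_betwE by blast

lemma cell_range: "finite \<mu> \<Longrightarrow> s \<in> {1..card \<mu>} \<Longrightarrow> cell \<mu> s \<in> \<mu>"
  using bij_betw_cell bij_betwE by blast

lemma tableau_condition:
  assumes "finite \<mu>" "p permutes {1..card \<mu>}"
  shows "(\<forall>x\<in>\<mu>. \<forall>y\<in>\<mu>. p (tableau \<mu> x) = tableau \<mu> y \<longrightarrow> f x = f y)
    \<longleftrightarrow> (\<forall>s\<in>{1..card \<mu>}. f (cell \<mu> (p s)) = f (cell \<mu> s))"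
proof safe
  fix s assume *: "\<forall>x\<in>\<mu>. \<forall>y\<in>\<mu>. p (tableau \<mu> x) = tableau \<mu> y \<longrightarrow> f x = f y" and s: "s \<in> {1..card \<mu>}"
  have "p s \<in> {1..card \<mu>}" using s assms(2) by (simp only: permutes_in_image)
  then show "f (cell \<mu> (p s)) = f (cell \<mu> s)"
    using *[rule_format, of "cell \<mu> s" "cell \<mu> (p s)"] s assms(1) by (simp only: cell_range tableau_cell)
next
  fix a b c d assume *: "\<forall>s\<in>{1..card \<mu>}. f (cell \<mu> (p s)) = f (cell \<mu> s)"
    and "(a, b) \<in> \<mu>" "(c, d) \<in> \<mu>" "p (tableau \<mu> (a, b)) = tableau \<mu> (c, d)"
  then show "f (a, b) = f (c, d)"
    using *[rule_format, OF tableau_range[OF assms(1)], of "(a, b)"] assms(1) by (simp add: cell_tableau)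
qed

lemma row_group_eq:
  "finite \<mu> \<Longrightarrow> row_group \<mu> = {p. p permutes {1..card \<mu>} \<and> (\<forall>s\<in>{1..card \<mu>}. fst (cell \<mu> (p s)) = fst (cell \<mu> s))}"
  unfolding row_group_def using tableau_condition[of \<mu> _ fst] by blast

lemma column_group_eq:
  "finite \<mu> \<Longrightarrow> column_group \<mu> = {p. p permutes {1..card \<mu>} \<and> (\<forall>s\<in>{1..card \<mu>}. snd (cell \<mu> (p s)) = snd (cell \<mu> s))}"
  unfolding column_group_def using tableau_condition[of \<mu> _ snd] by blast

lemma row_group_permutes: "p \<in> row_group \<mu> \<Longrightarrow> p permutes {1..card \<mu>}"
  by (simp add: row_group_def)

lemma column_group_permutes: "p \<in> column_group \<mu> \<Longrightarrow> p permutes {1..card \<mu>}"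
  by (simp add: column_group_def)

lemma act_young_symmetrizer:
  "act N (card \<mu>) (young_symmetrizer \<mu>) T = (\<Sum>p\<in>row_group \<mu>. \<Sum>q\<in>column_group \<mu>.
     scale_fun (of_int (sign q)) (act N (card \<mu>) (brauer_basis (perm_diagram (card \<mu>) (p \<circ> q))) T))"
  unfolding young_symmetrizer_def act_sum act_scale ..

lemma act_young_symmetrizer_apply:
  assumes "i \<in> indices N (card \<mu>)"
  shows "act N (card \<mu>) (young_symmetrizer \<mu>) T i
    = (\<Sum>p\<in>row_group \<mu>. \<Sum>q\<in>column_group \<mu>. of_int (sign q) * T (i \<circ> (p \<circ> q)))"
  unfolding act_young_symmetrizer sum_fun_apply
proof (intro sum.cong refl)
  fix p q assume "p \<in> row_group \<mu>" "q \<in> column_group \<mu>"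
  then have "p \<circ> q permutes {1..card \<mu>}"
    by (intro permutes_compose row_group_permutes column_group_permutes)
  then show "scale_fun (of_int (sign q)) (act N (card \<mu>) (brauer_basis (perm_diagram (card \<mu>) (p \<circ> q))) T) i
      = of_int (sign q) * T (i \<circ> (p \<circ> q))"
    using assms by (simp add: scale_fun_def act_perm)
qed

lemma group_act_sum: "group_act N n g (\<Sum>x\<in>A. f x) = (\<Sum>x\<in>A. group_act N n g (f x))"
  by (rule Modules.additive.sum[of "group_act N n g"]) (rule Modules.additive.intro, rule group_act_add)

lemma group_act_young_symmetrizer:
  "group_act N (card \<mu>) g (act N (card \<mu>) (young_symmetrizer \<mu>) T)
    = act N (card \<mu>) (young_symmetrizer \<mu>) (group_act N (card \<mu>) g T)"
  unfolding act_young_symmetrizer group_act_sum group_act_scale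
  by (intro sum.cong refl arg_cong[of _ _ "scale_fun _"] group_act_perm permutes_compose
      row_group_permutes column_group_permutes)

lemma traceless_perm:
  assumes s: "s permutes {1..m}" and T: "T \<in> traceless N m"
  shows "act N m (brauer_basis (perm_diagram m s)) T \<in> traceless N m"
  unfolding traceless_iff
proof (intro conjI ballI impI)
  show "act N m (brauer_basis (perm_diagram m s)) T \<in> tensors N m" by (rule act_in_tensors)
  fix k l i assume kl: "k \<in> {1..m}" "l \<in> {1..m}" "k \<noteq> l" and i: "i \<in> indices N m"
  obtain k' where k': "s k' = k" using s by (metis permutes_surj surjD)
  obtain l' where l': "s l' = l" using s by (metis permutes_surj surjD)
  have in': "k' \<in> {1..m}" "l' \<in> {1..m}" using kl(1,2) permutes_in_image[OF s] k' l' by blast+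
  have inj: "s x = s y \<longleftrightarrow> x = y" for x y using permutes_inj[OF s] by (simp add: inj_eq)
  have upd: "i(k := a, l := a) \<circ> s = (i \<circ> s)(k' := a, l' := a)" for a
    using inj by (auto simp: fun_eq_iff k'[symmetric] l'[symmetric])
  have "contract N k l (act N m (brauer_basis (perm_diagram m s)) T) i = contract N k' l' T (i \<circ> s)"
    unfolding contract_def
    by (intro sum.cong refl) (use index_upd2[OF i kl(1,2)] in \<open>auto simp: act_perm[OF s] upd\<close>)
  also have "\<dots> = 0"
  proof -
    have "k' \<noteq> l'" using kl(3) k' l' by blast
    then show ?thesis using T[unfolded traceless_iff] in' index_perm[OF s i] by blast
  qed
  finally show "contract N k l (act N m (brauer_basis (perm_diagram m s)) T) i = 0" .
qed

lemma weyl_module_traceless: "weyl_module \<mu> N \<subseteq> traceless N (card \<mu>)"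
proof
  fix y assume "y \<in> weyl_module \<mu> N"
  then obtain T where T: "T \<in> traceless N (card \<mu>)" "y = act N (card \<mu>) (young_symmetrizer \<mu>) T"
    by (auto simp: weyl_module_def)
  note sub = G_stableD(1)[OF G_stable_traceless]
  show "y \<in> traceless N (card \<mu>)"
    unfolding T(2) act_young_symmetrizer
    by (intro funs.subspace_sum[OF sub] funs.subspace_scale[OF sub] traceless_perm T(1) permutes_compose
        row_group_permutes column_group_permutes)
qed

lemma G_stable_weyl_module: "G_stable N (card \<mu>) (weyl_module \<mu> N)"
proof -
  let ?c = "act N (card \<mu>) (young_symmetrizer \<mu>)"
  note tr = G_stableD[OF G_stable_traceless[of N "card \<mu>"]]
  have "funs.subspace (weyl_module \<mu> N)"
    unfolding funs.subspace_def
  proof (intro conjI ballI allI)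
    have "?c 0 = 0" by (auto simp: act_def)
    then show "0 \<in> weyl_module \<mu> N"
      unfolding weyl_module_def using funs.subspace_0[OF tr(1)] by (metis image_eqI)
    fix x assume "x \<in> weyl_module \<mu> N"
    then obtain S where S: "S \<in> traceless N (card \<mu>)" "x = ?c S" by (auto simp: weyl_module_def)
    show "scale_fun c x \<in> weyl_module \<mu> N" for c
      unfolding weyl_module_def S(2) act_linear(2)[symmetric]
      by (intro imageI funs.subspace_scale[OF tr(1)] S(1))
    fix y assume "y \<in> weyl_module \<mu> N"
    then obtain T where T: "T \<in> traceless N (card \<mu>)" "y = ?c T" by (auto simp: weyl_module_def)
    show "x + y \<in> weyl_module \<mu> N"
      unfolding weyl_module_def S(2) T(2) act_linear(1)[symmetric]
      by (intro imageI funs.subspace_add[OF tr(1)] S(1) T(1))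
  qed
  moreover have "group_act N (card \<mu>) g x \<in> weyl_module \<mu> N" if g: "g \<in> orth_group N" and x: "x \<in> weyl_module \<mu> N" for g x
  proof -
    obtain S where S: "S \<in> traceless N (card \<mu>)" "x = ?c S" using x by (auto simp: weyl_module_def)
    show ?thesis unfolding weyl_module_def S(2) group_act_young_symmetrizer
      by (intro imageI tr(3)[OF g] S(1))
  qed
  moreover have "weyl_module \<mu> N \<subseteq> tensors N (card \<mu>)" using weyl_module_traceless tr(2) by blast
  ultimately show ?thesis by (simp add: G_stable_def)
qed

section \<open>Transpositions inside the Young symmetrizer\<close>

lemma sum_row_group_shift:
  assumes "finite \<mu>" "s \<in> {1..card \<mu>}" "t \<in> {1..card \<mu>}" "fst (cell \<mu> s) = fst (cell \<mu> t)"
  shows "(\<Sum>p\<in>row_group \<mu>. f (p \<circ> transpose s t)) = (\<Sum>p\<in>row_group \<mu>. f p)"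
proof (rule sum.reindex_bij_witness[where i = "\<lambda>p. p \<circ> transpose s t" and j = "\<lambda>p. p \<circ> transpose s t"])
  have tr: "transpose s t permutes {1..card \<mu>}" using assms(2,3) by (rule permutes_swap_id)
  have row: "fst (cell \<mu> (transpose s t u)) = fst (cell \<mu> u)" for u
    using assms(4) by (simp add: Transposition.transpose_def)
  show *: "p \<circ> transpose s t \<in> row_group \<mu>" if "p \<in> row_group \<mu>" for p
    using that tr row permutes_in_image[OF tr]
    unfolding row_group_eq[OF assms(1)] by (auto simp: permutes_compose simp del: atLeastAtMost_iff)
  show "p \<circ> transpose s t \<in> row_group \<mu>" if "p \<in> row_group \<mu>" for p by (rule *[OF that])
qed (simp_all add: comp_assoc)

lemma sum_column_group_shift:
  fixes f :: "(nat \<Rightarrow> nat) \<Rightarrow> complex"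
  assumes "finite \<mu>" "s \<in> {1..card \<mu>}" "t \<in> {1..card \<mu>}" "snd (cell \<mu> s) = snd (cell \<mu> t)" "s \<noteq> t"
  shows "(\<Sum>q\<in>column_group \<mu>. of_int (sign q) * f (transpose s t \<circ> q))
    = - (\<Sum>q\<in>column_group \<mu>. of_int (sign q) * f q)"
proof -
  have tr: "transpose s t permutes {1..card \<mu>}" using assms(2,3) by (rule permutes_swap_id)
  have col: "snd (cell \<mu> (transpose s t u)) = snd (cell \<mu> u)" for u
    using assms(4) by (simp add: Transposition.transpose_def)
  have mem: "transpose s t \<circ> q \<in> column_group \<mu>" if "q \<in> column_group \<mu>" for q
    using that tr col
    unfolding column_group_eq[OF assms(1)] by (auto simp: permutes_compose simp del: atLeastAtMost_iff)
  have "(\<Sum>q\<in>column_group \<mu>. of_int (sign q) * f (transpose s t \<circ> q))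
      = (\<Sum>q\<in>column_group \<mu>. of_int (sign (transpose s t \<circ> q)) * f q)"
  proof (rule sum.reindex_bij_witness[where i = "\<lambda>q. transpose s t \<circ> q" and j = "\<lambda>q. transpose s t \<circ> q"])
    show "transpose s t \<circ> q \<in> column_group \<mu>" if "q \<in> column_group \<mu>" for q by (rule mem[OF that])
    then show "transpose s t \<circ> q \<in> column_group \<mu>" if "q \<in> column_group \<mu>" for q using that .
  qed (simp_all add: comp_assoc[symmetric])
  also have "\<dots> = (\<Sum>q\<in>column_group \<mu>. - (of_int (sign q) * f q))"
  proof (rule sum.cong[OF refl])
    fix q assume "q \<in> column_group \<mu>"
    then have "permutation q" using column_group_permutes permutation_permutes by blast
    then have "sign (transpose s t \<circ> q) = - sign q"
      using assms(5) by (simp add: sign_compose permutation_swap_id sign_swap_id)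
    then show "of_int (sign (transpose s t \<circ> q)) * f q = - (of_int (sign q) * f q)" by simp
  qed
  finally show ?thesis by (simp add: sum_negf)
qed

text \<open>For \<open>s\<close> and \<open>t\<close> in different rows and columns, let \<open>h\<close> be the entry in the row of \<open>s\<close> and the
  column of \<open>t\<close>. Then \<open>(s h) (s t) = (s t) (h t)\<close> shows that the sum is equal to its negative.\<close>

lemma young_symmetrizer_insert_transposition:
  fixes \<Theta> :: "(nat \<Rightarrow> nat) \<Rightarrow> complex"
  assumes \<mu>: "young_diagram \<mu>" and st: "s \<in> {1..card \<mu>}" "t \<in> {1..card \<mu>}" "s \<noteq> t"
  shows "(\<Sum>p\<in>row_group \<mu>. \<Sum>q\<in>column_group \<mu>. of_int (sign q) * \<Theta> (p \<circ> transpose s t \<circ> q))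
    = (of_bool (fst (cell \<mu> s) = fst (cell \<mu> t)) - of_bool (snd (cell \<mu> s) = snd (cell \<mu> t))) *
      (\<Sum>p\<in>row_group \<mu>. \<Sum>q\<in>column_group \<mu>. of_int (sign q) * \<Theta> (p \<circ> q))"
proof -
  have fin: "finite \<mu>" using \<mu> by (simp add: young_diagram_def)
  define X where "X s t = (\<Sum>p\<in>row_group \<mu>. \<Sum>q\<in>column_group \<mu>. of_int (sign q) * \<Theta> (p \<circ> transpose s t \<circ> q))" for s t
  have ne: "cell \<mu> s \<noteq> cell \<mu> t"
    using st tableau_cell[OF fin] by metis
  have zero: "X s t = 0" if st: "s \<in> {1..card \<mu>}" "t \<in> {1..card \<mu>}"
    and lt: "fst (cell \<mu> s) < fst (cell \<mu> t)" and c: "snd (cell \<mu> s) \<noteq> snd (cell \<mu> t)" for s t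
  proof -
    \<comment> \<open>As the row of \<open>s\<close> lies above the row of \<open>t\<close>, this
      box is in the rectangle spanned by the box of \<open>t\<close>, hence in \<open>\<mu>\<close>.
      The opposite order is reduced to this one by exchanging \<open>s\<close> and
      \<open>t\<close>.\<close>
    define x where "x = (fst (cell \<mu> s), snd (cell \<mu> t))"
    have "cell \<mu> s \<in> \<mu>" "cell \<mu> t \<in> \<mu>" using cell_range[OF fin] st by auto
    then have "x \<in> {1..fst (cell \<mu> t)} \<times> {1..snd (cell \<mu> t)}" "{1..fst (cell \<mu> t)} \<times> {1..snd (cell \<mu> t)} \<subseteq> \<mu>"
      using \<mu> lt by (force simp: young_diagram_def x_def)+
    then have x: "x \<in> \<mu>" by blast
    define h where "h = tableau \<mu> x"
    have h: "h \<in> {1..card \<mu>}" "cell \<mu> h = x"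
      using tableau_range[OF fin x] cell_tableau[OF fin x] by (simp_all add: h_def)
    have hs: "h \<noteq> s" using h(2) c by (metis x_def snd_conv)
    have ht: "h \<noteq> t" using h(2) lt by (metis x_def fst_conv less_irrefl)
    have st': "s \<noteq> t" using lt by auto
    have eq: "transpose s h \<circ> transpose s t = transpose s t \<circ> transpose h t"
      using hs ht st' by (auto simp: fun_eq_iff Transposition.transpose_def)
    have assoc: "transpose s h \<circ> (transpose s t \<circ> q) = transpose s t \<circ> (transpose h t \<circ> q)" for q
      using arg_cong[OF eq, of "\<lambda>f. f \<circ> q"] by (simp only: comp_assoc)
    have comp: "p \<circ> transpose s h \<circ> transpose s t \<circ> q = p \<circ> transpose s t \<circ> (transpose h t \<circ> q)"
      for p q :: "nat \<Rightarrow> nat"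
      unfolding comp_assoc assoc ..
    have "X s t = (\<Sum>p\<in>row_group \<mu>. \<Sum>q\<in>column_group \<mu>. of_int (sign q) * \<Theta> (p \<circ> transpose s h \<circ> transpose s t \<circ> q))"
      unfolding X_def
      by (rule sum_row_group_shift[OF fin st(1) h(1), symmetric]) (simp add: h(2) x_def)
    also have "\<dots> = (\<Sum>p\<in>row_group \<mu>. \<Sum>q\<in>column_group \<mu>. of_int (sign q) * \<Theta> (p \<circ> transpose s t \<circ> (transpose h t \<circ> q)))"
      by (simp only: comp)
    also have "\<dots> = (\<Sum>p\<in>row_group \<mu>. - (\<Sum>q\<in>column_group \<mu>. of_int (sign q) * \<Theta> (p \<circ> transpose s t \<circ> q)))"
      by (intro sum.cong refl sum_column_group_shift[OF fin h(1) st(2)]) (use ht in \<open>auto simp: h(2) x_def\<close>)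
    also have "\<dots> = - X s t" by (simp add: X_def sum_negf)
    finally show ?thesis by simp
  qed
  consider "fst (cell \<mu> s) = fst (cell \<mu> t)" "snd (cell \<mu> s) \<noteq> snd (cell \<mu> t)"
    | "fst (cell \<mu> s) \<noteq> fst (cell \<mu> t)" "snd (cell \<mu> s) = snd (cell \<mu> t)"
    | "fst (cell \<mu> s) < fst (cell \<mu> t)" "snd (cell \<mu> s) \<noteq> snd (cell \<mu> t)"
    | "fst (cell \<mu> t) < fst (cell \<mu> s)" "snd (cell \<mu> s) \<noteq> snd (cell \<mu> t)"
    using ne by (metis linorder_neqE_nat prod_eq_iff)
  then show ?thesis
  proof cases
    case 1
    have "X s t = (\<Sum>p\<in>row_group \<mu>. \<Sum>q\<in>column_group \<mu>. of_int (sign q) * \<Theta> (p \<circ> q))"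
      unfolding X_def by (rule sum_row_group_shift[OF fin st(1,2) 1(1)])
    then show ?thesis using 1 by (simp add: X_def)
  next
    case 2
    have "X s t = (\<Sum>p\<in>row_group \<mu>. - (\<Sum>q\<in>column_group \<mu>. of_int (sign q) * \<Theta> (p \<circ> q)))"
      unfolding X_def comp_assoc
      by (intro sum.cong refl sum_column_group_shift[OF fin st(1,2) 2(2) st(3)])
    then show ?thesis using 2 by (simp add: X_def sum_negf)
  next
    case 3
    then show ?thesis using zero[OF st(1,2)] by (simp add: X_def)
  next
    case 4
    then show ?thesis using zero[OF st(2,1)] by (simp add: X_def transpose_commute[of s t])
  qed
qed

section \<open>Content sums and the scalar on Weyl's modules\<close>

lemma bij_betw_remove: "bij_betw f A B \<Longrightarrow> a \<in> A \<Longrightarrow> bij_betw f (A - {a}) (B - {f a})"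
  by (auto simp: bij_betw_def inj_on_def)

definition content_sum :: "young \<Rightarrow> int" where
  "content_sum \<mu> = (\<Sum>x\<in>\<mu>. int (snd x) - int (fst x))"

text \<open>Made for rows and for columns: \<open>f\<close> names the line of a box and
  \<open>g\<close> its place on it. Of two boxes on a line exactly one comes first, and
  \<open>g x - 1\<close> boxes precede \<open>x\<close>; ordered pairs count everything
  twice.\<close>

lemma sum_same_line:
  fixes f g :: "nat \<times> nat \<Rightarrow> nat"
  assumes fin: "finite \<mu>" and inj: "\<And>x y. f x = f y \<Longrightarrow> g x = g y \<Longrightarrow> x = y"
    and line: "\<And>x. x \<in> \<mu> \<Longrightarrow> card {y \<in> \<mu>. f y = f x \<and> g y < g x} = g x - 1"
  shows "(\<Sum>s\<in>{1..card \<mu>}. \<Sum>t\<in>{1..card \<mu>} - {s}. of_bool (f (cell \<mu> s) = f (cell \<mu> t)))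
    = 2 * (\<Sum>x\<in>\<mu>. of_nat (g x - 1) :: complex)"
proof -
  let ?h = "\<lambda>x y. of_bool (f y = f x \<and> g y < g x) :: complex"
  note bij = bij_betw_cell[OF fin]
  have injb: "inj_on (cell \<mu>) {1..card \<mu>}" and img: "cell \<mu> ` {1..card \<mu>} = \<mu>"
    using bij by (auto simp: bij_betw_def)
  have "(\<Sum>s\<in>{1..card \<mu>}. \<Sum>t\<in>{1..card \<mu>} - {s}. of_bool (f (cell \<mu> s) = f (cell \<mu> t)) :: complex)
      = (\<Sum>s\<in>{1..card \<mu>}. \<Sum>y\<in>\<mu> - {cell \<mu> s}. of_bool (f (cell \<mu> s) = f y))"
  proof (rule sum.cong[OF refl])
    fix s assume s: "s \<in> {1..card \<mu>}"
    have "bij_betw (cell \<mu>) ({1..card \<mu>} - {s}) (\<mu> - {cell \<mu> s})"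
      using bij_betw_remove[OF bij s] .
    then show "(\<Sum>t\<in>{1..card \<mu>} - {s}. of_bool (f (cell \<mu> s) = f (cell \<mu> t)) :: complex)
        = (\<Sum>y\<in>\<mu> - {cell \<mu> s}. of_bool (f (cell \<mu> s) = f y))"
      by (rule sum.reindex_bij_betw)
  qed
  also have "\<dots> = (\<Sum>x\<in>\<mu>. \<Sum>y\<in>\<mu> - {x}. of_bool (f x = f y))"
    by (rule sum.reindex_bij_betw[OF bij])
  also have "\<dots> = (\<Sum>x\<in>\<mu>. \<Sum>y\<in>\<mu>. ?h x y + ?h y x)"
  proof (rule sum.cong[OF refl])
    fix x assume x: "x \<in> \<mu>"
    have "(\<Sum>y\<in>\<mu>. ?h x y + ?h y x) = (\<Sum>y\<in>\<mu> - {x}. ?h x y + ?h y x)"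
      using sum.remove[OF fin x, of "\<lambda>y. ?h x y + ?h y x"] by simp
    also have "\<dots> = (\<Sum>y\<in>\<mu> - {x}. of_bool (f x = f y))"
    proof (rule sum.cong[OF refl])
      fix y assume "y \<in> \<mu> - {x}"
      then have "f x = f y \<Longrightarrow> g x \<noteq> g y" using inj[of x y] by auto
      then show "?h x y + ?h y x = of_bool (f x = f y)"
        by (cases "f x = f y"; cases "g y < g x") auto
    qed
    finally show "(\<Sum>y\<in>\<mu> - {x}. of_bool (f x = f y)) = (\<Sum>y\<in>\<mu>. ?h x y + ?h y x)" by simp
  qed
  also have "\<dots> = (\<Sum>x\<in>\<mu>. \<Sum>y\<in>\<mu>. ?h x y) + (\<Sum>x\<in>\<mu>. \<Sum>y\<in>\<mu>. ?h y x)"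
    by (simp only: sum.distrib)
  also have "(\<Sum>x\<in>\<mu>. \<Sum>y\<in>\<mu>. ?h y x) = (\<Sum>x\<in>\<mu>. \<Sum>y\<in>\<mu>. ?h x y)"
    by (rule sum.swap)
  also have "(\<Sum>x\<in>\<mu>. \<Sum>y\<in>\<mu>. ?h x y) = (\<Sum>x\<in>\<mu>. of_nat (g x - 1))"
  proof (rule sum.cong[OF refl])
    fix x assume x: "x \<in> \<mu>"
    have "(\<Sum>y\<in>\<mu>. ?h x y) = of_nat (card {y \<in> \<mu>. f y = f x \<and> g y < g x})"
      using fin by (simp add: of_bool_def sum.inter_filter[symmetric])
    then show "(\<Sum>y\<in>\<mu>. ?h x y) = of_nat (g x - 1)" by (simp only: line[OF x])
  qed
  finally show ?thesis by simp
qed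

text \<open>The sum of all transpositions commutes with every permutation, so it can be moved from
  the left of the row permutations to the place between rows and columns. There each transposition
  contributes 1, -1 or 0 according as its entries share a row, share a column or do neither, and
  counting the pairs in rows and columns gives the contents.\<close>

lemma sum_transpositions_young_symmetrizer:
  assumes \<mu>: "young_diagram \<mu>" and i: "i \<in> indices N (card \<mu>)"
    and y: "y = act N (card \<mu>) (young_symmetrizer \<mu>) T"
  shows "(\<Sum>s\<in>{1..card \<mu>}. \<Sum>t\<in>{1..card \<mu>} - {s}. y (i \<circ> transpose s t)) = 2 * of_int (content_sum \<mu>) * y i"
proof -
  let ?m = "card \<mu>"
  have fin: "finite \<mu>" and pos: "\<And>x. x \<in> \<mu> \<Longrightarrow> 1 \<le> fst x \<and> 1 \<le> snd x"
    using \<mu> by (auto simp: young_diagram_def)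
  have young: "{1..fst x} \<times> {1..snd x} \<subseteq> \<mu>" if "x \<in> \<mu>" for x
  proof -
    have "case x of (i, j) \<Rightarrow> {1..i} \<times> {1..j} \<subseteq> \<mu>"
      using \<mu> that unfolding young_diagram_def by blast
    then show ?thesis by (simp only: case_prod_beta)
  qed
  define G where "G x = (\<Sum>q\<in>column_group \<mu>. of_int (sign q) * T (i \<circ> (x \<circ> q)))" for x
  have yi: "y i = (\<Sum>p\<in>row_group \<mu>. G p)"
    unfolding y G_def by (rule act_young_symmetrizer_apply[OF i])
  have "(\<Sum>s\<in>{1..?m}. \<Sum>t\<in>{1..?m} - {s}. y (i \<circ> transpose s t))
      = (\<Sum>s\<in>{1..?m}. \<Sum>t\<in>{1..?m} - {s}. \<Sum>p\<in>row_group \<mu>. G (transpose s t \<circ> p))"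
  proof (intro sum.cong refl)
    fix s t assume "s \<in> {1..?m}" "t \<in> {1..?m} - {s}"
    then have "transpose s t permutes {1..?m}" by (intro permutes_swap_id) auto
    from act_young_symmetrizer_apply[OF index_perm[OF this i], of T]
    show "y (i \<circ> transpose s t) = (\<Sum>p\<in>row_group \<mu>. G (transpose s t \<circ> p))"
      unfolding y G_def by (simp only: comp_assoc)
  qed
  also have "\<dots> = (\<Sum>p\<in>row_group \<mu>. \<Sum>s\<in>{1..?m}. \<Sum>t\<in>{1..?m} - {s}. G (transpose s t \<circ> p))"
    by (simp only: sum.swap[of _ _ "row_group \<mu>"])
  also have "\<dots> = (\<Sum>p\<in>row_group \<mu>. \<Sum>s\<in>{1..?m}. \<Sum>t\<in>{1..?m} - {s}. G (p \<circ> transpose s t))"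
  proof (rule sum.cong[OF refl])
    fix p assume "p \<in> row_group \<mu>"
    then have p: "p permutes {1..?m}" by (rule row_group_permutes)
    have bij: "bij_betw p {1..?m} {1..?m}" by (rule permutes_imp_bij[OF p])
    have inj: "p a = p b \<longleftrightarrow> a = b" for a b using permutes_inj[OF p] by (simp add: inj_eq)
    have conj: "transpose (p s) (p t) \<circ> p = p \<circ> transpose s t" for s t
      using inj by (auto simp: fun_eq_iff Transposition.transpose_def)
    have "(\<Sum>s\<in>{1..?m}. \<Sum>t\<in>{1..?m} - {s}. G (transpose s t \<circ> p))
        = (\<Sum>s\<in>{1..?m}. \<Sum>t\<in>{1..?m} - {p s}. G (transpose (p s) t \<circ> p))"
      by (rule sum.reindex_bij_betw[OF bij, symmetric])
    also have "\<dots> = (\<Sum>s\<in>{1..?m}. \<Sum>t\<in>{1..?m} - {s}. G (transpose (p s) (p t) \<circ> p))"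
      by (rule sum.cong[OF refl], rule sum.reindex_bij_betw[symmetric], rule bij_betw_remove[OF bij])
    finally show "(\<Sum>s\<in>{1..?m}. \<Sum>t\<in>{1..?m} - {s}. G (transpose s t \<circ> p))
        = (\<Sum>s\<in>{1..?m}. \<Sum>t\<in>{1..?m} - {s}. G (p \<circ> transpose s t))" unfolding conj .
  qed
  also have "\<dots> = (\<Sum>s\<in>{1..?m}. \<Sum>t\<in>{1..?m} - {s}. \<Sum>p\<in>row_group \<mu>. G (p \<circ> transpose s t))"
    by (simp only: sum.swap[of _ _ "row_group \<mu>"])
  also have "\<dots> = (\<Sum>s\<in>{1..?m}. \<Sum>t\<in>{1..?m} - {s}.
      (of_bool (fst (cell \<mu> s) = fst (cell \<mu> t)) - of_bool (snd (cell \<mu> s) = snd (cell \<mu> t))) * y i)"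
    unfolding yi G_def
    by (intro sum.cong refl young_symmetrizer_insert_transposition[OF \<mu>, of _ _ "\<lambda>x. T (i \<circ> x)"]) auto
  also have "\<dots> = ((\<Sum>s\<in>{1..?m}. \<Sum>t\<in>{1..?m} - {s}. of_bool (fst (cell \<mu> s) = fst (cell \<mu> t))) -
      (\<Sum>s\<in>{1..?m}. \<Sum>t\<in>{1..?m} - {s}. of_bool (snd (cell \<mu> s) = snd (cell \<mu> t)))) * y i"
    by (simp only: sum_subtractf sum_distrib_right[symmetric])
  also have "(\<Sum>s\<in>{1..?m}. \<Sum>t\<in>{1..?m} - {s}. of_bool (fst (cell \<mu> s) = fst (cell \<mu> t)))
      = 2 * (\<Sum>x\<in>\<mu>. of_nat (snd x - 1) :: complex)"
  proof (rule sum_same_line[OF fin])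
    fix x assume x: "x \<in> \<mu>"
    have "{fst x} \<times> {1..<snd x} \<subseteq> {1..fst x} \<times> {1..snd x}"
      using pos[OF x] by auto
    then have "{fst x} \<times> {1..<snd x} \<subseteq> \<mu>" using young[OF x] by (rule subset_trans)
    then have "{y \<in> \<mu>. fst y = fst x \<and> snd y < snd x} = {fst x} \<times> {1..<snd x}"
      using pos by (auto simp: subset_iff)
    then show "card {y \<in> \<mu>. fst y = fst x \<and> snd y < snd x} = snd x - 1" by simp
  qed (simp add: prod_eq_iff)
  also have "(\<Sum>s\<in>{1..?m}. \<Sum>t\<in>{1..?m} - {s}. of_bool (snd (cell \<mu> s) = snd (cell \<mu> t)))
      = 2 * (\<Sum>x\<in>\<mu>. of_nat (fst x - 1) :: complex)"
  proof (rule sum_same_line[OF fin])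
    fix x assume x: "x \<in> \<mu>"
    have "{1..<fst x} \<times> {snd x} \<subseteq> {1..fst x} \<times> {1..snd x}"
      using pos[OF x] by auto
    then have "{1..<fst x} \<times> {snd x} \<subseteq> \<mu>" using young[OF x] by (rule subset_trans)
    then have "{y \<in> \<mu>. snd y = snd x \<and> fst y < fst x} = {1..<fst x} \<times> {snd x}"
      using pos by (auto simp: subset_iff)
    then show "card {y \<in> \<mu>. snd y = snd x \<and> fst y < fst x} = fst x - 1" by simp
  qed (simp add: prod_eq_iff)
  also have "2 * (\<Sum>x\<in>\<mu>. of_nat (snd x - 1) :: complex) - 2 * (\<Sum>x\<in>\<mu>. of_nat (fst x - 1)) = 2 * of_int (content_sum \<mu>)"
  proof -
    have "(\<Sum>x\<in>\<mu>. of_nat (snd x - 1) :: complex) - (\<Sum>x\<in>\<mu>. of_nat (fst x - 1)) = of_int (content_sum \<mu>)"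
      unfolding content_sum_def sum_subtractf[symmetric] of_int_sum
      by (intro sum.cong refl) (use pos in \<open>auto simp: of_nat_diff\<close>)
    then show ?thesis by (simp only: right_diff_distrib[symmetric])
  qed
  finally show ?thesis .
qed

definition jm_value :: "nat \<Rightarrow> young \<Rightarrow> complex" where
  "jm_value N \<mu> = of_nat (card \<mu>) * ((of_nat N - 1) / 2) + of_int (content_sum \<mu>)"

text \<open>All bars act as 0 on traceless tensors, so only the constants and the sum of all
  transpositions remain. The latter has been computed over ordered pairs, whence the factor 2 that
  is cancelled.\<close>

lemma jm_sum_weyl_module:
  assumes \<mu>: "young_diagram \<mu>" and y: "y \<in> weyl_module \<mu> N"
  shows "jm_sum N (card \<mu>) y = scale_fun (jm_value N \<mu>) y"
proof
  fix i
  let ?m = "card \<mu>"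
  obtain T where T: "y = act N ?m (young_symmetrizer \<mu>) T" using y by (auto simp: weyl_module_def)
  have tr: "y \<in> traceless N ?m" using y weyl_module_traceless by blast
  show "jm_sum N ?m y i = scale_fun (jm_value N \<mu>) y i"
  proof (cases "i \<in> indices N ?m")
    case False
    then show ?thesis using tr by (simp add: jm_sum_def scale_fun_def traceless_iff tensors_def)
  next
    case True
    have "jm_sum N ?m y i = of_nat ?m * ((of_nat N - 1) / 2 * y i) +
        (\<Sum>p\<in>{1..?m}. \<Sum>l\<in>{1..<p}. y (i \<circ> transpose p l) - (if i p = i l then contract N p l y i else 0))"
      using True by (simp add: jm_sum_def jm_def sum.distrib)
    also have "(\<Sum>p\<in>{1..?m}. \<Sum>l\<in>{1..<p}. y (i \<circ> transpose p l) - (if i p = i l then contract N p l y i else 0))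
        = (\<Sum>p\<in>{1..?m}. \<Sum>l\<in>{1..<p}. y (i \<circ> transpose p l))"
      by (intro sum.cong refl) (use tr True in \<open>auto simp: traceless_iff\<close>)
    also have "\<dots> = of_int (content_sum \<mu>) * y i"
    proof -
      have sym: "y (i \<circ> transpose s t) = y (i \<circ> transpose t s)" for s t
        by (simp only: transpose_commute)
      have "2 * (\<Sum>p\<in>{1..?m}. \<Sum>l\<in>{1..<p}. y (i \<circ> transpose p l)) = 2 * (of_int (content_sum \<mu>) * y i)"
        using sum_transpositions_young_symmetrizer[OF \<mu> True T]
        unfolding sum_pairs_symmetric[of "\<lambda>s t. y (i \<circ> transpose s t)", OF sym] mult.assoc .
      then show ?thesis by (simp only: mult_cancel_left) simp
    qed
    finally show ?thesis by (simp add: jm_value_def scale_fun_def algebra_simps)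
  qed
qed

section \<open>Canonical bases\<close>

lemma hom_GD:
  assumes "f \<in> hom_G N m W n X"
  shows "T \<in> W \<Longrightarrow> f T \<in> X" "S \<in> W \<Longrightarrow> T \<in> W \<Longrightarrow> f (S + T) = f S + f T"
    "T \<in> W \<Longrightarrow> f (scale_fun c T) = scale_fun c (f T)"
    "g \<in> orth_group N \<Longrightarrow> T \<in> W \<Longrightarrow> f (group_act N m g T) = group_act N n g (f T)"
    "T \<notin> W \<Longrightarrow> f T = 0"
  using assms by (auto simp: hom_G_def)

lemma zero_in_tensors: "0 \<in> tensors N n"
  by (simp add: tensors_def)

lemma mult_module_in_tensors: "f \<in> mult_module N \<gamma> k \<Longrightarrow> f T \<in> tensors N k"
  unfolding mult_module_def using hom_GD(1,5) zero_in_tensors by metis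

text \<open>The isotypic component of type U(\<gamma>,N) in the \<open>k\<close>-th tensor
  power.\<close>

definition isotypic :: "nat \<Rightarrow> young \<Rightarrow> nat \<Rightarrow> tensor set" where
  "isotypic N \<gamma> k = funs.span {h y |h y. h \<in> mult_module N \<gamma> k \<and> y \<in> weyl_module \<gamma> N}"

lemma isotypic_induct:
  assumes "funs.subspace {T. P T}" "\<And>h y. h \<in> mult_module N \<gamma> k \<Longrightarrow> y \<in> weyl_module \<gamma> N \<Longrightarrow> P (h y)"
    and "T \<in> isotypic N \<gamma> k"
  shows "P T"
  using funs.span_minimal[of "{h y |h y. h \<in> mult_module N \<gamma> k \<and> y \<in> weyl_module \<gamma> N}" "{T. P T}"] assms
  by (auto simp: isotypic_def)

lemma isotypic_base: "h \<in> mult_module N \<gamma> k \<Longrightarrow> y \<in> weyl_module \<gamma> N \<Longrightarrow> h y \<in> isotypic N \<gamma> k"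
  unfolding isotypic_def by (rule funs.span_base) blast

lemma subspace_isotypic: "funs.subspace (isotypic N \<gamma> k)"
  unfolding isotypic_def by (rule funs.subspace_span)

lemma mult_module_in_isotypic:
  assumes "h \<in> mult_module N \<gamma> k"
  shows "h T \<in> isotypic N \<gamma> k"
proof (cases "T \<in> weyl_module \<gamma> N")
  case True
  then show ?thesis by (rule isotypic_base[OF assms])
next
  case False
  show ?thesis
    unfolding hom_GD(5)[OF assms[unfolded mult_module_def] False] by (rule funs.subspace_0[OF subspace_isotypic])
qed

lemma G_stable_isotypic: "G_stable N k (isotypic N \<gamma> k)"
  unfolding G_stable_def
proof (intro conjI ballI subspace_isotypic subsetI)
  fix T assume T: "T \<in> isotypic N \<gamma> k"
  show "T \<in> tensors N k"
    by (rule isotypic_induct[OF _ _ T]) (auto simp: mult_module_in_tensors subspace_tensors)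
  fix g assume g: "g \<in> orth_group N"
  show "group_act N k g T \<in> isotypic N \<gamma> k"
  proof (rule isotypic_induct[OF _ _ T])
    show "funs.subspace {T. group_act N k g T \<in> isotypic N \<gamma> k}"
      unfolding funs.subspace_def
    proof (intro conjI ballI allI CollectI)
      have "group_act N k g 0 = 0" by (auto simp: group_act_def)
      then show "group_act N k g 0 \<in> isotypic N \<gamma> k"
        using funs.subspace_0[OF subspace_isotypic] by metis
    qed (auto simp: group_act_add group_act_scale funs.subspace_add[OF subspace_isotypic]
        funs.subspace_scale[OF subspace_isotypic])
    fix h y assume h: "h \<in> mult_module N \<gamma> k" and y: "y \<in> weyl_module \<gamma> N"
    have "group_act N k g (h y) = h (group_act N (card \<gamma>) g y)"
      using hom_GD(4)[OF h[unfolded mult_module_def] g y] by simp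
    then show "group_act N k g (h y) \<in> isotypic N \<gamma> k"
      using isotypic_base[OF h G_stableD(3)[OF G_stable_weyl_module g y]] by metis
  qed
qed

lemma contract_add: "contract N k l (S + T) i = contract N k l S i + contract N k l T i"
  by (simp add: contract_def sum.distrib)

lemma contract_scale: "contract N k l (scale_fun c T) i = c * contract N k l T i"
  by (simp add: contract_def scale_fun_def sum_distrib_left)

lemma jm_add: "jm N p (S + T) i = jm N p S i + jm N p T i"
proof -
  have "(\<Sum>l\<in>{1..<p}. (S + T) (i \<circ> transpose p l) - (if i p = i l then contract N p l (S + T) i else 0))
      = (\<Sum>l\<in>{1..<p}. (S (i \<circ> transpose p l) - (if i p = i l then contract N p l S i else 0)) +
        (T (i \<circ> transpose p l) - (if i p = i l then contract N p l T i else 0)))"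
    by (intro sum.cong refl) (simp add: contract_add)
  then show ?thesis unfolding jm_def sum.distrib by (simp add: distrib_left)
qed

lemma jm_scale: "jm N p (scale_fun c T) i = c * jm N p T i"
proof -
  have "(\<Sum>l\<in>{1..<p}. scale_fun c T (i \<circ> transpose p l) - (if i p = i l then contract N p l (scale_fun c T) i else 0))
      = c * (\<Sum>l\<in>{1..<p}. T (i \<circ> transpose p l) - (if i p = i l then contract N p l T i else 0))"
    unfolding sum_distrib_left contract_scale
    by (intro sum.cong refl) (auto simp: scale_fun_def right_diff_distrib)
  then show ?thesis unfolding jm_def by (simp add: scale_fun_def distrib_left)
qed

text \<open>The scalar is known on Weyl's module, in degree \<open>card \<gamma>\<close>.
  Homomorphisms carry it to degree \<open>k\<close>: they change the degree but commute with the
  Casimir operator.\<close>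

lemma jm_sum_isotypic:
  assumes "young_diagram \<gamma>" "T \<in> isotypic N \<gamma> k"
  shows "jm_sum N k T = scale_fun (jm_value N \<gamma>) T"
proof (rule isotypic_induct[OF _ _ assms(2)])
  show "funs.subspace {T. jm_sum N k T = scale_fun (jm_value N \<gamma>) T}"
    unfolding funs.subspace_def
  proof (intro conjI ballI allI CollectI)
    have "jm N p 0 i = 0" for p i using jm_scale[of N p 0 0 i] by (simp add: scale_fun_def zero_fun_def)
    then show "jm_sum N k 0 = scale_fun (jm_value N \<gamma>) 0"
      by (auto simp: jm_sum_def scale_fun_def fun_eq_iff)
    fix S assume S: "S \<in> {T. jm_sum N k T = scale_fun (jm_value N \<gamma>) T}"
    have "jm_sum N k (scale_fun c S) = scale_fun c (jm_sum N k S)" for c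
      by (auto simp: jm_sum_def scale_fun_def[of c "\<lambda>i. if i \<in> indices N k then _ i else 0"] jm_scale sum_distrib_left fun_eq_iff)
    then show "jm_sum N k (scale_fun c S) = scale_fun (jm_value N \<gamma>) (scale_fun c S)" for c
      using S by (simp add: scale_fun_def mult.left_commute)
    fix T assume T: "T \<in> {T. jm_sum N k T = scale_fun (jm_value N \<gamma>) T}"
    have "jm_sum N k (S + T) = jm_sum N k S + jm_sum N k T"
      by (auto simp: jm_sum_def jm_add sum.distrib fun_eq_iff)
    then show "jm_sum N k (S + T) = scale_fun (jm_value N \<gamma>) (S + T)"
      using S T by (simp add: funs.scale_right_distrib)
  qed
  fix h y assume h: "h \<in> mult_module N \<gamma> k" and y: "y \<in> weyl_module \<gamma> N"
  note h' = h[unfolded mult_module_def]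
  show "jm_sum N k (h y) = scale_fun (jm_value N \<gamma>) (h y)"
    using jm_sum_hom[OF G_stable_weyl_module h' y] hom_GD(3)[OF h' y]
    unfolding jm_sum_weyl_module[OF assms(1) y] by metis
qed

section \<open>Slices of the canonical basis vectors\<close>

definition slices_in :: "nat \<Rightarrow> young \<Rightarrow> nat \<Rightarrow> nat \<Rightarrow> (tensor \<Rightarrow> tensor) \<Rightarrow> bool" where
  "slices_in N \<gamma> k n f \<longleftrightarrow> (\<forall>T. \<forall>i\<in>indices N n. slice N k (f T) i \<in> isotypic N \<gamma> k)"

lemma glue_index:
  assumes "j \<in> indices N k" "i \<in> indices N n" "k \<le> n"
  shows "glue k j i \<in> indices N n"
proof -
  have "glue k j i m < N" if "m \<in> {1..n}" for m
    using index_less[OF assms(1), of m] index_less[OF assms(2), of m] that by (simp add: glue_def)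
  moreover have "glue k j i m = undefined" if "m \<notin> {1..n}" for m
    using index_undefined[OF assms(1), of m] index_undefined[OF assms(2), of m] that assms(3)
    by (auto simp: glue_def)
  ultimately show ?thesis unfolding indices_def by (intro PiE_I) auto
qed

lemma restrict_glue:
  assumes "j \<in> indices N k"
  shows "restrict (glue k j i) {1..k} = j"
proof
  fix m show "restrict (glue k j i) {1..k} m = j m"
    using index_undefined[OF assms, of m] by (auto simp: glue_def)
qed

lemma slices_in_component:
  assumes "k \<le> n" "f \<in> component N \<gamma> k \<mu> n"
  shows "slices_in N \<gamma> k n f"
proof -
  let ?I = "isotypic N \<gamma> k"
  obtain p where p: "is_projection N k ?I p"
    using exists_projection[OF G_stableD(1,2)[OF G_stable_isotypic]] by blast
  have pI: "p T \<in> ?I" for T using p by (simp add: is_projection_def)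
  have pid: "p T = T" if "T \<in> ?I" for T
    by (rule projection_id[OF p G_stableD(1,2)[OF G_stable_isotypic] that])
  \<comment> \<open>Elements of the centralizer vanish outside the space of tensors, hence the
    cut-off.\<close>
  define P where "P T = (if T \<in> tensors N k then p T else 0)" for T
  have PI: "P T \<in> ?I" for T using pI funs.subspace_0[OF subspace_isotypic] by (auto simp: P_def)
  have "P \<in> centralizer k N"
    unfolding centralizer_def hom_G_def
  proof (intro CollectI conjI ballI allI impI)
    show "P T \<in> tensors N k" for T using PI G_stableD(2)[OF G_stable_isotypic] by blast
    show "P (S + T) = P S + P T" if "S \<in> tensors N k" "T \<in> tensors N k" for S T
      using that p funs.subspace_add[OF subspace_tensors that] by (simp only: P_def if_True is_projection_def)
    show "P (scale_fun c T) = scale_fun c (P T)" if "T \<in> tensors N k" for c T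
      using that p funs.subspace_scale[OF subspace_tensors that] by (simp only: P_def if_True is_projection_def)
    show "P (group_act N k g T) = group_act N k g (P T)" if "g \<in> orth_group N" "T \<in> tensors N k" for g T
      using that projection_equivariant[OF p G_stable_isotypic that(1)]
      by (simp only: P_def if_True group_act_in_tensors)
    show "P T = 0" if "T \<notin> tensors N k" for T using that by (simp only: P_def if_False)
  qed
  note P = this
  have Ph: "P \<circ> h = h" if h: "h \<in> mult_module N \<gamma> k" for h
  proof
    fix T show "(P \<circ> h) T = h T"
      using pid[OF mult_module_in_isotypic[OF h, of T]] mult_module_in_tensors[OF h, of T] by (simp add: P_def)
  qed
  have copy: "slices_in N \<gamma> k n f" if W: "is_copy N \<gamma> k \<mu> n W" and f: "f \<in> W" for W f
    unfolding slices_in_def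
  proof (intro allI ballI)
    fix T i assume i: "i \<in> indices N n"
    obtain \<phi> where \<phi>: "bij_betw \<phi> (mult_module N \<gamma> k) W"
      "\<And>A h. A \<in> centralizer k N \<Longrightarrow> h \<in> mult_module N \<gamma> k \<Longrightarrow> \<phi> (A \<circ> h) = embed N k n A \<circ> \<phi> h"
      using W unfolding is_copy_def by blast
    obtain h where h: "h \<in> mult_module N \<gamma> k" "\<phi> h = f"
      using \<phi>(1) f by (auto simp: bij_betw_def)
    have "f = embed N k n P \<circ> f" using \<phi>(2)[OF P h(1)] Ph[OF h(1)] h(2) by simp
    then have fT: "f T = embed N k n P (f T)" by (metis comp_apply)
    have "slice N k (f T) i = P (slice N k (f T) i)"
    proof (rule tensors_eqI)
      show "slice N k (f T) i \<in> tensors N k" by (rule slice_in_tensors)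
      show "P (slice N k (f T) i) \<in> tensors N k" using PI G_stableD(2)[OF G_stable_isotypic] by blast
      fix j assume j: "j \<in> indices N k"
      \<comment> \<open>A slice depends only on the indices after \<open>k\<close>, and gluing
        leaves those alone.\<close>
      have sl: "slice N k (f T) (glue k j i) = slice N k (f T) i"
      proof -
        have glue: "glue k j' (glue k j i) = glue k j' i" for j' by (auto simp: glue_def)
        show ?thesis unfolding slice_def glue ..
      qed
      have "slice N k (f T) i j = f T (glue k j i)" using j by (simp add: slice_def)
      also have "\<dots> = embed N k n P (f T) (glue k j i)" using fT by metis
      also have "\<dots> = P (slice N k (f T) (glue k j i)) (restrict (glue k j i) {1..k})"
        using glue_index[OF j i assms(1)] by (simp only: embed_def if_True slice_def)
      finally show "slice N k (f T) i j = P (slice N k (f T) i) j"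
        by (simp only: sl restrict_glue[OF j])
    qed
    then show "slice N k (f T) i \<in> ?I" using PI by metis
  qed
  have "maps.subspace {f. slices_in N \<gamma> k n f}"
    unfolding maps.subspace_def
  proof (intro conjI ballI allI CollectI)
    have "slice N k (0 T) i = 0" for T :: tensor and i by (auto simp: slice_def)
    then show "slices_in N \<gamma> k n 0"
      unfolding slices_in_def using funs.subspace_0[OF subspace_isotypic] by metis
    fix f assume f: "f \<in> {f. slices_in N \<gamma> k n f}"
    have scale: "slice N k (scale_map c f T) i = scale_fun c (slice N k (f T) i)" for c T i
      by (auto simp: slice_def scale_map_def scale_fun_def)
    show "slices_in N \<gamma> k n (scale_map c f)" for c
      unfolding slices_in_def scale
      using f[unfolded mem_Collect_eq slices_in_def] funs.subspace_scale[OF subspace_isotypic] by blast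
    fix g assume g: "g \<in> {f. slices_in N \<gamma> k n f}"
    have add: "slice N k ((f + g) T) i = slice N k (f T) i + slice N k (g T) i" for T i
      by (auto simp: slice_def)
    show "slices_in N \<gamma> k n (f + g)"
      unfolding slices_in_def add
      using f[unfolded mem_Collect_eq slices_in_def] g[unfolded mem_Collect_eq slices_in_def]
        funs.subspace_add[OF subspace_isotypic] by blast
  qed
  then have "component N \<gamma> k \<mu> n \<subseteq> {f. slices_in N \<gamma> k n f}"
    unfolding component_def by (intro maps.span_minimal) (use copy in auto)
  then show ?thesis using assms(2) by blast
qed

text \<open>The case \<open>k = n\<close>, with the module itself in place of a component: in full
  degree a slice is the whole tensor.\<close>

lemma slices_in_mult_module:
  assumes "f \<in> mult_module N \<mu> n"
  shows "slices_in N \<mu> n n f"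
  unfolding slices_in_def
proof (intro allI ballI)
  fix T i assume i: "i \<in> indices N n"
  have "slice N n (f T) i = f T"
  proof (rule tensors_eqI[OF slice_in_tensors mult_module_in_tensors[OF assms]])
    fix j assume j: "j \<in> indices N n"
    have "glue n j i = j"
    proof
      fix m show "glue n j i m = j m"
        using index_undefined[OF i, of m] index_undefined[OF j, of m] by (auto simp: glue_def)
    qed
    then show "slice N n (f T) i j = f T j" using j by (simp add: slice_def)
  qed
  then show "slice N n (f T) i \<in> isotypic N \<mu> n" using mult_module_in_isotypic[OF assms] by metis
qed

text \<open>The case \<open>k = 0\<close>, where the path starts: in degree 0 Weyl's module consists
  of all tensors, and the identity on it is a homomorphism whose image is everything.\<close>

lemma slices_in_empty: "slices_in N {} 0 n f"
proof -
  have id: "{p :: nat \<Rightarrow> nat. p permutes {}} = {id}" by (auto simp: permutes_empty)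
  have rc: "row_group ({} :: young) = {id}" "column_group {} = {id}"
    using id by (auto simp: row_group_def column_group_def permutes_empty)
  have W: "T \<in> weyl_module {} N" if T: "T \<in> tensors N 0" for T
  proof -
    have "act N (card ({} :: young)) (young_symmetrizer {}) T = T"
    proof (rule tensors_eqI[OF act_in_tensors])
      show "T \<in> tensors N (card ({} :: young))" using T by simp
      fix i assume "i \<in> indices N (card ({} :: young))"
      from act_young_symmetrizer_apply[OF this, of T]
      show "act N (card ({} :: young)) (young_symmetrizer {}) T i = T i" by (simp add: rc)
    qed
    moreover have "T \<in> traceless N (card ({} :: young))" using T by (simp add: traceless_iff)
    ultimately show ?thesis unfolding weyl_module_def by (metis image_eqI)
  qed
  define h where "h T = (if T \<in> weyl_module {} N then T else 0)" for T
  note st = G_stableD[OF G_stable_weyl_module[of N "{}"]]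
  have "h \<in> mult_module N {} 0"
    unfolding mult_module_def hom_G_def
  proof (intro CollectI conjI ballI allI impI)
    show "h T \<in> tensors N 0" if "T \<in> weyl_module {} N" for T
      using that st(2) by (auto simp: h_def)
    show "h (S + T) = h S + h T" if "S \<in> weyl_module {} N" "T \<in> weyl_module {} N" for S T
      using that funs.subspace_add[OF st(1) that] by (simp only: h_def if_True)
    show "h (scale_fun c T) = scale_fun c (h T)" if "T \<in> weyl_module {} N" for c T
      using that funs.subspace_scale[OF st(1) that] by (simp only: h_def if_True)
    show "h (group_act N (card ({} :: young)) g T) = group_act N 0 g (h T)"
      if "g \<in> orth_group N" "T \<in> weyl_module {} N" for g T
      using that st(3)[OF that] by (simp only: h_def if_True card.empty)
    show "h T = 0" if "T \<notin> weyl_module {} N" for T using that by (simp only: h_def if_False)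
  qed
  then have "T \<in> isotypic N {} 0" if "T \<in> tensors N 0" for T
    using isotypic_base[of h N "{}" 0 T] W[OF that] by (simp only: h_def if_True)
  then show ?thesis unfolding slices_in_def using slice_in_tensors by blast
qed

lemma sum_jm_slices_in:
  assumes "young_diagram \<gamma>" "slices_in N \<gamma> k n f" "k \<le> n" "i \<in> indices N n"
  shows "(\<Sum>p\<in>{1..k}. jm N p (f T) i) = jm_value N \<gamma> * f T i"
proof -
  let ?r = "restrict i {1..k}"
  have "(\<Sum>p\<in>{1..k}. jm N p (f T) i) = (\<Sum>p\<in>{1..k}. jm N p (slice N k (f T) i) ?r)"
    by (intro sum.cong refl jm_slice[OF assms(4), symmetric] assms(3)) auto
  also have "\<dots> = jm_sum N k (slice N k (f T) i) ?r"
    using index_restrict[OF assms(4,3)] by (simp only: jm_sum_def if_True)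
  also have "jm_sum N k (slice N k (f T) i) = scale_fun (jm_value N \<gamma>) (slice N k (f T) i)"
    by (rule jm_sum_isotypic[OF assms(1)]) (use assms in \<open>simp only: slices_in_def\<close>)
  finally show ?thesis by (simp only: scale_fun_def slice_restrict[OF assms(4,3)])
qed

section \<open>Contraction of the factors k and k + 1\<close>

lemma group_act_transpose_cancel:
  assumes g: "g \<in> orth_group N" and T: "T \<in> tensors N n"
  shows "group_act N n g\<^sup>T (group_act N n g T) = T"
proof (rule tensors_eqI[OF group_act_in_tensors T])
  fix i assume i: "i \<in> indices N n"
  have g': "g \<in> carrier_mat N N" using g by (simp add: orth_group_def)
  have "group_act N n g\<^sup>T (group_act N n g T) i
      = (\<Sum>j\<in>indices N n. (\<Prod>m\<in>{1..n}. g $$ (j m, i m)) * (\<Sum>l\<in>indices N n. (\<Prod>m\<in>{1..n}. g $$ (j m, l m)) * T l))"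
    unfolding group_act_apply[OF i]
  proof (rule sum.cong[OF refl])
    fix j assume j: "j \<in> indices N n"
    have "(\<Prod>m\<in>{1..n}. g\<^sup>T $$ (i m, j m)) = (\<Prod>m\<in>{1..n}. g $$ (j m, i m))"
      by (rule prod.cong[OF refl]) (use g' index_less[OF i] index_less[OF j] in auto)
    then show "(\<Prod>m\<in>{1..n}. g\<^sup>T $$ (i m, j m)) * group_act N n g T j
        = (\<Prod>m\<in>{1..n}. g $$ (j m, i m)) * (\<Sum>l\<in>indices N n. (\<Prod>m\<in>{1..n}. g $$ (j m, l m)) * T l)"
      by (simp only: group_act_apply[OF j])
  qed
  also have "\<dots> = (\<Sum>j\<in>indices N n. \<Sum>l\<in>indices N n. (\<Prod>m\<in>{1..n}. g $$ (j m, i m) * g $$ (j m, l m)) * T l)"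
    by (simp only: sum_distrib_left prod.distrib mult.assoc)
  also have "\<dots> = (\<Sum>l\<in>indices N n. (\<Sum>j\<in>indices N n. \<Prod>m\<in>{1..n}. g $$ (j m, i m) * g $$ (j m, l m)) * T l)"
    unfolding sum_distrib_right by (rule sum.swap)
  also have "\<dots> = (\<Sum>l\<in>indices N n. if l = i then T i else 0)"
  proof (rule sum.cong[OF refl])
    fix l assume l: "l \<in> indices N n"
    have "(\<Sum>j\<in>indices N n. \<Prod>m\<in>{1..n}. g $$ (j m, i m) * g $$ (j m, l m))
        = (\<Prod>m\<in>{1..n}. \<Sum>c<N. g $$ (c, i m) * g $$ (c, l m))"
      unfolding indices_def by (rule prod_sum_PiE[symmetric]) auto
    also have "\<dots> = (\<Prod>m\<in>{1..n}. of_bool (i m = l m))"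
      by (intro prod.cong refl orth_group_columns[OF g] index_less[OF i] index_less[OF l])
    also have "\<dots> = of_bool (l = i)"
    proof (cases "l = i")
      case False
      then obtain m where m: "l m \<noteq> i m" by auto
      then have "m \<in> {1..n}" using index_undefined[OF i, of m] index_undefined[OF l, of m] by metis
      then have "(\<Prod>m\<in>{1..n}. of_bool (i m = l m) :: complex) = 0"
        using m by (intro prod_zero) (auto intro!: bexI[of _ m])
      then show ?thesis by (simp only: False of_bool_eq)
    qed simp
    finally show "(\<Sum>j\<in>indices N n. \<Prod>m\<in>{1..n}. g $$ (j m, i m) * g $$ (j m, l m)) * T l = (if l = i then T i else 0)"
      by auto
  qed
  also have "\<dots> = T i" using i by (simp add: finite_indices)
  finally show "group_act N n g\<^sup>T (group_act N n g T) i = T i" .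
qed

text \<open>The equivariant map from degree \<open>k + 1\<close> to degree \<open>k - 1\<close>
  behind the bar of \<open>(k, k + 1)\<close>. In contrast to \<open>contract\<close> its values are
  genuine tensors of the lower degree, comparable with slices of that degree.\<close>

definition contract_last :: "nat \<Rightarrow> nat \<Rightarrow> tensor \<Rightarrow> tensor" where
  "contract_last N k T = (\<lambda>j. if j \<in> indices N (k - 1) then contract N k (k + 1) T j else 0)"

lemma contract_last_linear:
  "contract_last N k (S + T) = contract_last N k S + contract_last N k T"
  "contract_last N k (scale_fun c T) = scale_fun c (contract_last N k T)"
  by (auto simp: contract_last_def contract_add contract_scale scale_fun_def[of c "\<lambda>j. if _ j then _ j else _"] fun_eq_iff)

lemma contract_last_in_tensors: "contract_last N k T \<in> tensors N (k - 1)"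
  by (simp add: contract_last_def tensors_def)

lemma index_extend:
  assumes i: "i \<in> indices N (k - 1)" and k: "k \<ge> 1" and a: "a < N"
  shows "i(k := a, k + 1 := a) \<in> indices N (k + 1)"
proof -
  have "(i(k := a, k + 1 := a)) m < N" if "m \<in> {1..k + 1}" for m
    using index_less[OF i, of m] that a k by auto
  moreover have "(i(k := a, k + 1 := a)) m = undefined" if "m \<notin> {1..k + 1}" for m
    using index_undefined[OF i, of m] that k by auto
  ultimately show ?thesis unfolding indices_def by (intro PiE_I) auto
qed

lemma contract_last_group_act:
  assumes g: "g \<in> orth_group N" and k: "k \<ge> 1"
  shows "contract_last N k (group_act N (k + 1) g T) = group_act N (k - 1) g (contract_last N k T)"
proof (rule tensors_eqI[OF contract_last_in_tensors group_act_in_tensors])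
  fix i assume i: "i \<in> indices N (k - 1)"
  have dom: "{1..k + 1} - {k, k + 1} = {1..k - 1}" using k by auto
  have idx: "i(k := a, k + 1 := a) \<in> indices N (k + 1)" if "a < N" for a
    by (rule index_extend[OF i k that])
  have "contract_last N k (group_act N (k + 1) g T) i = contract N k (k + 1) (group_act N (k + 1) g T) i"
    using i by (simp only: contract_last_def if_True)
  also have "\<dots> = (\<Sum>j\<in>{1..k + 1} - {k, k + 1} \<rightarrow>\<^sub>E {..<N}.
      (\<Prod>r\<in>{1..k + 1} - {k, k + 1}. g $$ (i r, j r)) * contract N k (k + 1) T j)"
    by (rule contract_group_act[OF g _ _ _ idx]) (use k in auto)
  also have "\<dots> = (\<Sum>j\<in>indices N (k - 1). (\<Prod>r\<in>{1..k - 1}. g $$ (i r, j r)) * contract_last N k T j)"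
    unfolding dom indices_def[symmetric] by (intro sum.cong refl) (simp only: contract_last_def if_True)
  also have "\<dots> = group_act N (k - 1) g (contract_last N k T) i"
    by (simp only: group_act_apply[OF i])
  finally show "contract_last N k (group_act N (k + 1) g T) i = group_act N (k - 1) g (contract_last N k T) i" .
qed

text \<open>Pulled back along two homomorphisms, the form pairs Weyl's modules of different degrees
  and is invariant under real orthogonal matrices, which is the situation of
  \<open>pairing_zero\<close>. The passage to spans is made in one argument at a time.\<close>

lemma isotypic_contract_last_orthogonal:
  assumes k: "k \<ge> 1" and card: "card \<alpha> \<noteq> card \<beta>"
    and S: "S \<in> isotypic N \<alpha> (k - 1)" and T: "T \<in> isotypic N \<beta> (k + 1)"
  shows "herm N (k - 1) S (contract_last N k T) = 0"
proof -
  have gen: "herm N (k - 1) (h' y) (contract_last N k (h x)) = 0"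
    if h': "h' \<in> mult_module N \<alpha> (k - 1)" and h: "h \<in> mult_module N \<beta> (k + 1)"
      and y: "y \<in> weyl_module \<alpha> N" and x: "x \<in> weyl_module \<beta> N" for h' h x y
  proof -
    note h1 = hom_GD[OF h'[unfolded mult_module_def]] and h2 = hom_GD[OF h[unfolded mult_module_def]]
    define B where "B y x = herm N (k - 1) (h' y) (contract_last N k (h x))" for y x
    have add1: "B (y + y') x = B y x + B y' x" if "y \<in> weyl_module \<alpha> N" "y' \<in> weyl_module \<alpha> N" for y y' x
      unfolding B_def h1(2)[OF that] herm_add_left ..
    have add2: "B y (x + x') = B y x + B y x'" if "x \<in> weyl_module \<beta> N" "x' \<in> weyl_module \<beta> N" for y x x'
      unfolding B_def h2(2)[OF that] contract_last_linear herm_add_right ..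
    have scale1: "B (scale_fun c y) x = cnj c * B y x" if "y \<in> weyl_module \<alpha> N" for c y x
      unfolding B_def h1(3)[OF that] herm_scale_left ..
    have scale2: "B y (scale_fun c x) = c * B y x" if "x \<in> weyl_module \<beta> N" for c y x
      unfolding B_def h2(3)[OF that] contract_last_linear herm_scale_right ..
    have inv: "B (group_act N (card \<alpha>) g y) (group_act N (card \<beta>) g x) = B y x"
      if g: "g \<in> orth_group N" "adj N g = g\<^sup>T" and y: "y \<in> weyl_module \<alpha> N" and x: "x \<in> weyl_module \<beta> N" for g x y
      unfolding B_def h1(4)[OF g(1) y] h2(4)[OF g(1) x] contract_last_group_act[OF g(1) k]
        herm_group_act[OF g(1)] g(2) group_act_transpose_cancel[OF g(1) mult_module_in_tensors[OF h']] ..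
    have "B y x = 0"
    proof (cases "card \<alpha> < card \<beta>")
      case True
      show ?thesis
        by (rule pairing_zero[OF G_stable_weyl_module G_stable_weyl_module weyl_module_traceless True,
              where B = B, OF add1 add2 scale1 scale2 inv y x])
    next
      case False
      then have less: "card \<beta> < card \<alpha>" using card by simp
      \<comment> \<open>\<open>pairing_zero\<close> wants the larger degree in the second argument.
        Exchanging the arguments is accompanied by a conjugation so that the form stays sesquilinear
        in the same order.\<close>
      have "cnj (B y x) = 0"
      proof (rule pairing_zero[OF G_stable_weyl_module G_stable_weyl_module weyl_module_traceless less,
              where B = "\<lambda>x y. cnj (B y x)", OF _ _ _ _ _ x y])
      qed (simp_all only: add1 add2 scale1 scale2 inv complex_cnj_add complex_cnj_mult complex_cnj_cnj)
      then show ?thesis by simp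
    qed
    then show ?thesis by (simp only: B_def)
  qed
  show ?thesis
  proof (rule isotypic_induct[OF _ _ T])
    show "funs.subspace {T. herm N (k - 1) S (contract_last N k T) = 0}"
      unfolding funs.subspace_def
    proof (intro conjI ballI allI CollectI)
      have "herm N (k - 1) S (contract_last N k (scale_fun 0 0)) = 0"
        unfolding contract_last_linear herm_scale_right by simp
      then show "herm N (k - 1) S (contract_last N k 0) = 0"
        unfolding funs.scale_zero_left .
    qed (simp_all only: contract_last_linear herm_add_right herm_scale_right mem_Collect_eq add_0 mult_zero_right)
    fix h x assume h: "h \<in> mult_module N \<beta> (k + 1)" and x: "x \<in> weyl_module \<beta> N"
    show "herm N (k - 1) S (contract_last N k (h x)) = 0"
    proof (rule isotypic_induct[OF _ _ S])
      show "funs.subspace {S. herm N (k - 1) S (contract_last N k (h x)) = 0}"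
        unfolding funs.subspace_def
        by (simp add: herm_add_left herm_scale_left) (simp add: herm_def)
    qed (rule gen[OF _ h _ x])
  qed
qed

text \<open>The contraction of a slice of degree \<open>k + 1\<close> is a sum of slices of degree
  \<open>k - 1\<close> and thus lies in the isotypic component of \<open>\<alpha>\<close>. It is
  also orthogonal to that component, hence to itself.\<close>

lemma contract_slices_in_zero:
  assumes k: "1 \<le> k" "k + 1 \<le> n" and card: "card \<alpha> \<noteq> card \<beta>"
    and \<alpha>: "slices_in N \<alpha> (k - 1) n f" and \<beta>: "slices_in N \<beta> (k + 1) n f" and i: "i \<in> indices N n"
  shows "contract N k (k + 1) (f T) i = 0"
proof -
  define u where "u a = i(k := a, k + 1 := a)" for a
  have u: "u a \<in> indices N n" if "a < N" for a
    unfolding u_def by (rule index_upd2[OF i]) (use k that in auto)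
  define C where "C = contract_last N k (slice N (k + 1) (f T) i)"
  have C: "C = (\<Sum>a<N. slice N (k - 1) (f T) (u a))"
  proof
    fix j
    show "C j = (\<Sum>a<N. slice N (k - 1) (f T) (u a)) j"
    proof (cases "j \<in> indices N (k - 1)")
      case False
      then show ?thesis by (simp add: C_def contract_last_def sum_fun_apply slice_def)
    next
      case True
      have idx: "j(k := a, k + 1 := a) \<in> indices N (k + 1)" if "a < N" for a
        by (rule index_extend[OF True k(1) that])
      have "glue (k + 1) (j(k := a, k + 1 := a)) i = glue (k - 1) j (u a)" for a
        using k by (auto simp: glue_def u_def fun_eq_iff)
      then show ?thesis
        using True idx by (simp add: C_def contract_last_def contract_def sum_fun_apply slice_def)
    qed
  qed
  have "C \<in> isotypic N \<alpha> (k - 1)"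
    unfolding C by (rule funs.subspace_sum[OF subspace_isotypic]) (use \<alpha> u in \<open>simp add: slices_in_def\<close>)
  moreover have "slice N (k + 1) (f T) i \<in> isotypic N \<beta> (k + 1)"
    using \<beta> i by (simp only: slices_in_def)
  ultimately have "herm N (k - 1) C (contract_last N k (slice N (k + 1) (f T) i)) = 0"
    by (rule isotypic_contract_last_orthogonal[OF k(1) card])
  then have "C = 0"
    unfolding C_def[symmetric] by (rule herm_self_zero) (simp only: C_def contract_last_in_tensors)
  then have "(\<Sum>a<N. slice N (k - 1) (f T) (u a)) (restrict i {1..k - 1}) = 0"
    unfolding C[symmetric] by simp
  moreover have "slice N (k - 1) (f T) (u a) (restrict i {1..k - 1}) = f T (u a)" if "a < N" for a
  proof -
    have "restrict i {1..k - 1} = restrict (u a) {1..k - 1}" using k by (auto simp: u_def fun_eq_iff)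
    then show ?thesis using slice_restrict[OF u[OF that], of "k - 1"] k by simp
  qed
  ultimately have "(\<Sum>a<N. f T (u a)) = 0" by (simp add: sum_fun_apply)
  then show ?thesis by (simp only: contract_def u_def)
qed

section \<open>Content sums of diagrams with a common neighbour\<close>

lemma content_sum_insert: "finite \<gamma> \<Longrightarrow> x \<notin> \<gamma> \<Longrightarrow> content_sum (insert x \<gamma>) = int (snd x) - int (fst x) + content_sum \<gamma>"
  by (simp add: content_sum_def)

text \<open>Two distinct boxes with the same content are comparable, so they cannot both be removed from,
  or both be added to, the same Young diagram.\<close>

lemma content_sum_differs:
  assumes "young_diagram \<alpha>" "young_diagram \<gamma>" "young_diagram \<beta>"
    and "one_box_apart \<alpha> \<gamma>" "one_box_apart \<gamma> \<beta>" "card \<alpha> = card \<beta>" "\<alpha> \<noteq> \<beta>"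
  shows "content_sum \<alpha> \<noteq> content_sum \<beta>"
proof
  assume eq: "content_sum \<alpha> = content_sum \<beta>"
  have fin: "finite \<alpha>" "finite \<gamma>" "finite \<beta>" using assms(1-3) by (auto simp: young_diagram_def)
  have pos: "1 \<le> fst x \<and> 1 \<le> snd x" if "young_diagram \<delta>" "x \<in> \<delta>" for x \<delta>
    using that by (auto simp: young_diagram_def)
  have down: "x \<in> \<delta>" if "young_diagram \<delta>" "y \<in> \<delta>" "1 \<le> fst x" "1 \<le> snd x" "fst x \<le> fst y" "snd x \<le> snd y" for x y \<delta>
  proof -
    have "case y of (i, j) \<Rightarrow> {1..i} \<times> {1..j} \<subseteq> \<delta>"
      using that(1,2) unfolding young_diagram_def by blast
    then have "{1..fst y} \<times> {1..snd y} \<subseteq> \<delta>" by (simp only: case_prod_beta)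
    moreover have "x \<in> {1..fst y} \<times> {1..snd y}" using that by (simp add: mem_Times_iff)
    ultimately show ?thesis by blast
  qed
  have comparable: "fst x \<le> fst y \<and> snd x \<le> snd y \<or> fst y \<le> fst x \<and> snd y \<le> snd x"
    if "int (snd x) - int (fst x) = int (snd y) - int (fst y)" for x y :: "nat \<times> nat"
    using that by linarith
  from assms(4) consider x where "x \<notin> \<alpha>" "\<gamma> = insert x \<alpha>" | x where "x \<notin> \<gamma>" "\<alpha> = insert x \<gamma>"
    unfolding one_box_apart_def by blast
  then show False
  proof cases
    case (1 x)
    \<comment> \<open>Equal numbers of boxes force the second step to undo the direction of the
      first.\<close>
    have "\<not> (\<exists>y. y \<notin> \<gamma> \<and> \<beta> = insert y \<gamma>)" using 1 fin assms(6) by auto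
    then obtain y where y: "y \<notin> \<beta>" "\<gamma> = insert y \<beta>"
      using assms(5) unfolding one_box_apart_def by blast
    have ne: "x \<noteq> y" using 1 y assms(7) by (metis insert_ident)
    then have mem: "y \<in> \<alpha>" "x \<in> \<beta>" using 1 y by auto
    have "int (snd x) - int (fst x) = int (snd y) - int (fst y)"
      using content_sum_insert[OF fin(1) 1(1)] content_sum_insert[OF fin(3) y(1)] eq 1(2) y(2) by simp
    from comparable[OF this] show False
      using down[OF assms(1) mem(1), of x] down[OF assms(3) mem(2), of y]
        pos[OF assms(3) mem(2)] pos[OF assms(1) mem(1)] 1(1) y(1) by blast
  next
    case (2 x)
    have "\<not> (\<exists>y. y \<notin> \<beta> \<and> \<gamma> = insert y \<beta>)" using 2 fin assms(6) by auto
    then obtain y where y: "y \<notin> \<gamma>" "\<beta> = insert y \<gamma>"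
      using assms(5) unfolding one_box_apart_def by blast
    have ne: "x \<noteq> y" using 2 y assms(7) by blast
    have mem: "x \<in> \<alpha>" "y \<in> \<beta>" using 2 y by auto
    have "int (snd x) - int (fst x) = int (snd y) - int (fst y)"
      using content_sum_insert[OF fin(2) 2(1)] content_sum_insert[OF fin(2) y(1)] eq 2(2) y(2) by simp
    from comparable[OF this] have "x \<in> \<beta> \<or> y \<in> \<alpha>"
      using down[OF assms(3) mem(2), of x] down[OF assms(1) mem(1), of y]
        pos[OF assms(1) mem(1)] pos[OF assms(3) mem(2)] by blast
    then show False using 2 y ne by blast
  qed
qed

section \<open>The matrix element\<close>

lemma act_perm_mult_module:
  assumes s: "s permutes {1..n}" and f: "f \<in> mult_module N \<mu> n"
  shows "act N n (brauer_basis (perm_diagram n s)) \<circ> f \<in> mult_module N \<mu> n"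
proof -
  note h = hom_GD[OF f[unfolded mult_module_def]]
  show ?thesis
    unfolding mult_module_def hom_G_def comp_apply
  proof (intro CollectI conjI ballI allI impI)
    show "act N n (brauer_basis (perm_diagram n s)) (f T) = 0" if "T \<notin> weyl_module \<mu> N" for T
      unfolding h(5)[OF that] by (auto simp: act_def)
  qed (simp_all only: act_in_tensors h(2-4) act_linear group_act_perm[OF s])
qed

lemma act_comp_sum:
  "act N n a \<circ> (\<Sum>b\<in>B. scale_map (r b) b) = (\<Sum>b\<in>B. scale_map (r b) (act N n a \<circ> b))"
proof -
  have "act N n a \<circ> (f + g) = (act N n a \<circ> f) + (act N n a \<circ> g)" for f g
    by (rule ext) (simp only: comp_apply plus_fun_apply act_linear)
  then have sum: "act N n a \<circ> (\<Sum>b\<in>B. scale_map (r b) b) = (\<Sum>b\<in>B. act N n a \<circ> scale_map (r b) b)"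
    by (intro Modules.additive.sum[of "\<lambda>f. act N n a \<circ> f"] Modules.additive.intro)
  have scale: "act N n a \<circ> scale_map c f = scale_map c (act N n a \<circ> f)" for c f
    by (rule ext) (simp only: comp_apply scale_map_def act_linear)
  show ?thesis unfolding sum scale ..
qed

theorem proposition3p2:
  fixes n N k :: nat
    and \<mu> :: young
    and \<Lambda> :: "nat \<Rightarrow> young"
    and v :: "(nat \<Rightarrow> young) \<Rightarrow> tensor \<Rightarrow> tensor"
  assumes "n \<ge> 1" and "N \<ge> 1"
    and "\<mu> \<in> \<O> n N"
    and "canonical_basis N \<mu> n v"
    and "\<Lambda> \<in> \<L> N \<mu> n"
    and "k \<in> {1..n - 1}"
    and "\<Lambda> (k - 1) \<noteq> \<Lambda> (k + 1)"
  shows "x_eigenvalue N n v k \<Lambda> \<noteq> x_eigenvalue N n v (k + 1) \<Lambda> \<and>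
    s_matrix_element N \<mu> n v k \<Lambda> \<Lambda> =
      inverse (x_eigenvalue N n v (k + 1) \<Lambda> - x_eigenvalue N n v k \<Lambda>)"
proof -
  let ?L = "\<L> N \<mu> n"
  let ?B = "v ` ?L"
  have k: "1 \<le> k" "k + 1 \<le> n" using assms(6) by auto
  have indep: "maps.independent ?B" and span: "maps.span ?B = mult_module N \<mu> n"
    and comp: "\<And>\<Lambda> j. \<Lambda> \<in> ?L \<Longrightarrow> j \<in> {1..n - 1} \<Longrightarrow> v \<Lambda> \<in> component N (\<Lambda> j) j \<mu> n"
    using assms(4) by (auto simp: canonical_basis_def)
  have vmod: "v \<Lambda> \<in> mult_module N \<mu> n" if "\<Lambda> \<in> ?L" for \<Lambda>
    unfolding span[symmetric] by (rule maps.span_base) (use that in auto)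
  have O: "\<Lambda> j \<in> \<O> j N" if "\<Lambda> \<in> ?L" "j \<le> n" for \<Lambda> j
    using that by (auto simp: \<L>_def PiE_iff)
  have young: "young_diagram (\<Lambda> j)" if "\<Lambda> \<in> ?L" "j \<le> n" for \<Lambda> j
    using O[OF that] by (auto simp: \<O>_def)
  have empty: "\<Lambda> 0 = {}" if "\<Lambda> \<in> ?L" for \<Lambda>
    using O[OF that, of 0] by (auto simp: \<O>_def young_diagram_def)
  have sl: "slices_in N (\<Lambda> j) j n (v \<Lambda>)" if L: "\<Lambda> \<in> ?L" and j: "j \<le> n" for \<Lambda> j
  proof -
    \<comment> \<open>The canonical basis prescribes components only from 1 to n - 1. The ends 0 and
      n are supplied by the empty diagram and by the module itself.\<close>
    consider "j = 0" | "j = n" | "j \<in> {1..n - 1}" using j by fastforce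
    then show ?thesis
    proof cases
      case 1
      then show ?thesis using slices_in_empty empty[OF L] by simp
    next
      case 2
      have "\<Lambda> n = \<mu>" using L by (simp add: \<L>_def)
      then show ?thesis using slices_in_mult_module[OF vmod[OF L]] 2 by simp
    next
      case 3
      then show ?thesis by (intro slices_in_component[OF j comp[OF L]])
    qed
  qed
  define x where "x p \<Lambda> = jm_value N (\<Lambda> p) - jm_value N (\<Lambda> (p - 1))" for p and \<Lambda> :: "nat \<Rightarrow> young"
  have x: "jm N p (v \<Lambda> T) i = x p \<Lambda> * v \<Lambda> T i"
    if L: "\<Lambda> \<in> ?L" and p: "p \<in> {1..n}" and i: "i \<in> indices N n" for p \<Lambda> T i
  proof -
    have "{1..p} = insert p {1..p - 1}" "p \<notin> {1..p - 1}" using p by auto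
    then have eq: "(\<Sum>q\<in>{1..p}. jm N q (v \<Lambda> T) i) = jm N p (v \<Lambda> T) i + (\<Sum>q\<in>{1..p - 1}. jm N q (v \<Lambda> T) i)"
      by (simp only: sum.insert finite_atLeastAtMost not_False_eq_True)
    have S: "(\<Sum>q\<in>{1..j}. jm N q (v \<Lambda> T) i) = jm_value N (\<Lambda> j) * v \<Lambda> T i" if "j \<le> n" for j
      by (rule sum_jm_slices_in[OF young[OF L that] sl[OF L that] that i])
    have "p \<le> n" "p - 1 \<le> n" using p by auto
    then have "jm_value N (\<Lambda> p) * v \<Lambda> T i = jm N p (v \<Lambda> T) i + jm_value N (\<Lambda> (p - 1)) * v \<Lambda> T i"
      using eq by (simp only: S)
    then show ?thesis by (simp add: x_def algebra_simps)
  qed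
  have vout: "v \<Lambda> T i = 0" if "\<Lambda> \<in> ?L" "i \<notin> indices N n" for \<Lambda> T i
    using mult_module_in_tensors[OF vmod[OF that(1)]] that(2) by (simp add: tensors_def)
  have xact: "act N n (jucys_murphy N n p) \<circ> v \<Lambda> = scale_map (x p \<Lambda>) (v \<Lambda>)"
    if "\<Lambda> \<in> ?L" "p \<in> {1..n}" for p \<Lambda>
    using x[OF that] vout[OF that(1)]
    by (auto simp: act_jucys_murphy[OF that(2)] scale_map_def scale_fun_def fun_eq_iff)
  have vne: "v \<Lambda> \<noteq> 0" if "\<Lambda> \<in> ?L" for \<Lambda>
    using maps.dependent_zero[of ?B] indep that by (metis image_eqI)
  have eigen: "x_eigenvalue N n v p \<Lambda> = x p \<Lambda>" if "\<Lambda> \<in> ?L" "p \<in> {1..n}" for p \<Lambda>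
    unfolding x_eigenvalue_def xact[OF that]
  proof (rule the_equality)
    fix c assume "scale_map (x p \<Lambda>) (v \<Lambda>) = scale_map c (v \<Lambda>)"
    then show "c = x p \<Lambda>" using vne[OF that(1)] by (simp only: maps.scale_cancel_right) simp
  qed simp
  let ?F = "v \<Lambda>"
  have bar: "contract N k (k + 1) (?F T) i = 0" if i: "i \<in> indices N n" for T i
  proof (cases "card (\<Lambda> (k - 1)) = card (\<Lambda> (k + 1))")
    case False
    show ?thesis
      by (rule contract_slices_in_zero[OF k False sl[OF assms(5)] sl[OF assms(5)] i]) (use k in auto)
  next
    case True
    have apart: "one_box_apart (\<Lambda> j) (\<Lambda> (j + 1))" if "j < n" for j
      using assms(5) that by (simp add: \<L>_def)
    have "k - 1 \<le> n" "k \<le> n" "k + 1 \<le> n" using k by auto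
    note young' = this[THEN young[OF assms(5)]]
    have a1: "one_box_apart (\<Lambda> (k - 1)) (\<Lambda> k)" using apart[of "k - 1"] k by simp
    have a2: "one_box_apart (\<Lambda> k) (\<Lambda> (k + 1))" using apart[of k] k by simp
    have "content_sum (\<Lambda> (k - 1)) \<noteq> content_sum (\<Lambda> (k + 1))"
      by (rule content_sum_differs[OF young' a1 a2 True assms(7)])
    \<comment> \<open>The value at \<open>\<Lambda> k\<close> telescopes away from x_k + x_{k+1},
      and with equally many boxes the terms with N cancel, so the difference of the two content sums
      remains.\<close>
    then have ne: "x k \<Lambda> + x (k + 1) \<Lambda> \<noteq> 0"
      using True by (simp add: x_def jm_value_def)
    have u: "i(k := a, k + 1 := a) \<in> indices N n" if "a < N" for a
      by (rule index_upd2[OF i]) (use k that in auto)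
    have "0 = contract N k (k + 1) (\<lambda>i. jm N k (?F T) i + jm N (k + 1) (?F T) i) i"
      by (rule contract_jm[OF i k, symmetric])
    also have "\<dots> = (\<Sum>a<N. (x k \<Lambda> + x (k + 1) \<Lambda>) * ?F T (i(k := a, k + 1 := a)))"
      unfolding contract_def
    proof (rule sum.cong[OF refl])
      fix a assume "a \<in> {..<N}"
      then have "i(k := a, k + 1 := a) \<in> indices N n" using u by simp
      then show "jm N k (?F T) (i(k := a, k + 1 := a)) + jm N (k + 1) (?F T) (i(k := a, k + 1 := a))
          = (x k \<Lambda> + x (k + 1) \<Lambda>) * ?F T (i(k := a, k + 1 := a))"
        using x[OF assms(5), of k] x[OF assms(5), of "k + 1"] k by (simp add: distrib_right)
    qed
    also have "\<dots> = (x k \<Lambda> + x (k + 1) \<Lambda>) * contract N k (k + 1) (?F T) i"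
      by (simp only: contract_def sum_distrib_left)
    finally show ?thesis using ne by simp
  qed
  define \<tau> where "\<tau> = transpose k (k + 1)"
  have \<tau>: "\<tau> permutes {1..n}" unfolding \<tau>_def by (rule permutes_swap_id) (use k in auto)
  let ?S = "act N n (simple_transposition n k)" and ?X = "act N n (jucys_murphy N n (k + 1))"
  have SF: "(?S \<circ> ?F) T = (\<lambda>i. ?F T (i \<circ> \<tau>))" for T
  proof
    fix i
    have "i \<in> indices N n" if "i \<circ> \<tau> \<in> indices N n"
      using index_perm[OF \<tau> that] by (simp add: \<tau>_def comp_assoc)
    then have "?F T (i \<circ> \<tau>) = 0" if "i \<notin> indices N n"
      using that by (intro vout[OF assms(5)]) blast
    moreover have "(?S \<circ> ?F) T i = (if i \<in> indices N n then ?F T (i \<circ> \<tau>) else 0)"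
      unfolding comp_apply simple_transposition_def \<tau>_def[symmetric] act_perm[OF \<tau>] ..
    ultimately show "(?S \<circ> ?F) T i = ?F T (i \<circ> \<tau>)" by simp
  qed
  \<comment> \<open>The image of \<open>v \<Lambda>\<close> under s_k fails to be an eigenvector of
    x_{k+1} with value x_k exactly by \<open>v \<Lambda>\<close>. This inhomogeneity produces the
    matrix element.\<close>
  have XSF: "?X \<circ> (?S \<circ> ?F) = scale_map (x k \<Lambda>) (?S \<circ> ?F) + ?F"
  proof (intro ext)
    fix T i
    show "(?X \<circ> (?S \<circ> ?F)) T i = (scale_map (x k \<Lambda>) (?S \<circ> ?F) + ?F) T i"
    proof (cases "i \<in> indices N n")
      case True
      have "(?X \<circ> (?S \<circ> ?F)) T i = jm N (k + 1) (\<lambda>i. ?F T (i \<circ> \<tau>)) i"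
        using k True by (subst comp_apply, subst SF, subst act_jucys_murphy) auto
      also have "\<dots> = jm N k (?F T) (i \<circ> \<tau>) + ?F T i"
        unfolding \<tau>_def jm_simple_transposition[OF k(1)] using bar[OF True] by simp
      also have "jm N k (?F T) (i \<circ> \<tau>) = x k \<Lambda> * ?F T (i \<circ> \<tau>)"
        by (rule x[OF assms(5) _ index_perm[OF \<tau> True]]) (use k in auto)
      also have "x k \<Lambda> * ?F T (i \<circ> \<tau>) + ?F T i = (scale_map (x k \<Lambda>) (?S \<circ> ?F) + ?F) T i"
        by (simp only: plus_fun_apply scale_map_def scale_fun_def SF)
      finally show ?thesis .
    next
      case False
      have "i \<circ> \<tau> \<notin> indices N n"
        using index_perm[OF \<tau>, of "i \<circ> \<tau>" N] False by (auto simp: \<tau>_def comp_assoc)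
      then have "(scale_map (x k \<Lambda>) (?S \<circ> ?F) + ?F) T i = 0"
        unfolding plus_fun_apply scale_map_def scale_fun_def SF using vout[OF assms(5)] False by simp
      moreover have "(?X \<circ> (?S \<circ> ?F)) T i = 0" using False by (simp add: act_def)
      ultimately show ?thesis by simp
    qed
  qed
  define r where "r = maps.representation ?B (?S \<circ> ?F)"
  have SFmod: "?S \<circ> ?F \<in> maps.span ?B"
    unfolding span simple_transposition_def \<tau>_def[symmetric]
    by (rule act_perm_mult_module[OF \<tau> vmod[OF assms(5)]])
  have FB: "?F \<in> ?B" using assms(5) by blast
  \<comment> \<open>The eigenvalue of x_{k+1} as a function of the basis vector instead of its
    label, because \<open>representation\<close> is indexed by vectors. It is the right one since
    \<open>v\<close> is injective.\<close>
  define e where "e b = x (k + 1) (inv_into ?L v b)" for b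
  have e: "e (v \<Lambda>') = x (k + 1) \<Lambda>'" if "\<Lambda>' \<in> ?L" for \<Lambda>'
    unfolding e_def using inv_into_f_f[of v ?L] assms(4) that by (simp only: canonical_basis_def)
  have Xb: "?X \<circ> b = scale_map (e b) b" if "b \<in> ?B" for b
  proof -
    obtain \<Lambda>' where L: "\<Lambda>' \<in> ?L" "b = v \<Lambda>'" using \<open>b \<in> ?B\<close> by (elim imageE)
    have "k + 1 \<in> {1..n}" using k by simp
    then show ?thesis unfolding L(2) e[OF L(1)] by (rule xact[OF L(1)])
  qed
  define B' where "B' = {b. r b \<noteq> 0}"
  have B': "finite B'" "B' \<subseteq> ?B"
    using maps.finite_representation[of ?B "?S \<circ> ?F"] maps.representation_ne_zero[of ?B "?S \<circ> ?F"]
    by (auto simp: B'_def r_def)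
  have "?S \<circ> ?F = (\<Sum>b\<in>B'. scale_map (r b) b)"
    unfolding B'_def r_def using maps.sum_nonzero_representation_eq[OF indep SFmod] by simp
  then have "?X \<circ> (?S \<circ> ?F) = (\<Sum>b\<in>B'. scale_map (r b) (?X \<circ> b))"
    by (simp only: act_comp_sum)
  also have "\<dots> = (\<Sum>b\<in>B'. scale_map (r b * e b) b)"
    by (intro sum.cong refl) (use Xb B'(2) in \<open>auto simp: maps.scale_scale\<close>)
  finally have "maps.representation ?B (scale_map (x k \<Lambda>) (?S \<circ> ?F) + ?F) ?F
      = maps.representation ?B (\<Sum>b\<in>B'. scale_map (r b * e b) b) ?F"
    unfolding XSF by simp
  also have "\<dots> = (\<Sum>b\<in>B'. maps.representation ?B (scale_map (r b * e b) b) ?F)"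
  proof -
    have "maps.representation ?B (\<Sum>b\<in>B'. scale_map (r b * e b) b)
        = (\<lambda>c. \<Sum>b\<in>B'. maps.representation ?B (scale_map (r b * e b) b) c)"
      by (rule maps.representation_sum[OF indep]) (use B' in \<open>auto intro: maps.span_scale maps.span_base\<close>)
    then show ?thesis by simp
  qed
  also have "\<dots> = (\<Sum>b\<in>B'. if b = ?F then r ?F * e ?F else 0)"
  proof (rule sum.cong[OF refl])
    fix b assume "b \<in> B'"
    then have b: "b \<in> ?B" using B' by blast
    have "maps.representation ?B (scale_map (r b * e b) b) = (\<lambda>c. r b * e b * maps.representation ?B b c)"
      by (rule maps.representation_scale[OF indep maps.span_base[OF b]])
    then show "maps.representation ?B (scale_map (r b * e b) b) ?F = (if b = ?F then r ?F * e ?F else 0)"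
      using maps.representation_basis[OF indep b] by simp
  qed
  also have "\<dots> = r ?F * e ?F" using B'(1) by (simp add: B'_def)
  finally have "maps.representation ?B (scale_map (x k \<Lambda>) (?S \<circ> ?F) + ?F) ?F = r ?F * x (k + 1) \<Lambda>"
    by (simp only: e[OF assms(5)])
  moreover have "maps.representation ?B (scale_map (x k \<Lambda>) (?S \<circ> ?F) + ?F) ?F = x k \<Lambda> * r ?F + 1"
    unfolding maps.representation_add[OF indep maps.span_base[OF FB] maps.span_scale[OF SFmod]]
      maps.representation_scale[OF indep SFmod] maps.representation_basis[OF indep FB] r_def by simp
  \<comment> \<open>The coefficients of \<open>v \<Lambda>\<close> in the two expansions agree. A
    product equal to 1 settles both claims: its first factor is nonzero, so the eigenvalues differ,
    and the second factor is the inverse of the first.\<close>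
  ultimately have *: "(x (k + 1) \<Lambda> - x k \<Lambda>) * r ?F = 1"
    by (simp add: algebra_simps)
  then have "x k \<Lambda> \<noteq> x (k + 1) \<Lambda>" by auto
  moreover have "r ?F = inverse (x (k + 1) \<Lambda> - x k \<Lambda>)" using * by (rule inverse_unique[symmetric])
  moreover have "k \<in> {1..n}" "k + 1 \<in> {1..n}" using k by auto
  ultimately show ?thesis
    unfolding s_matrix_element_def r_def[symmetric] eigen[OF assms(5) \<open>k \<in> {1..n}\<close>] eigen[OF assms(5) \<open>k + 1 \<in> {1..n}\<close>]
    by blast
qed

end
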